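(* Let $k$ be a field, $R=k[x_1,\dots,x_n]$, $I\subseteq R$ a squarefree monomial ideal, and fix $r$. Let $\mathcal M=\{[H^r_I(R)]_\alpha\}_{\alpha\in\{0,1\}^n}$ be the $n$-hypercube of the local cohomology module $H^r_I(R)$ and let $\mathcal M^\bullet$ be its associated complex of $k$-vector spaces. Then (in suitable bases) $\mathcal M^\bullet$ is the complex of $k$-vector spaces whose matrices are the transposes of the monomial matrices (i.e. of the matrices of scalar entries) of the $r$-linear strand $\mathbb L^{<r>}_\bullet(I^\vee)$ of the minimal free resolution of the Alexander dual ideal $I^\vee$ of $I$; here the term of $\mathcal M^\bullet$ in homological degree $p$ corresponds to the term $L^{<r>}_{n-r-p}$ of the strand.
   Context: Notation: $\varepsilon_1,\dots,\varepsilon_n$ is the natural basis of $\mathbb Z^n$, $\mathbf 1=(1,\dots,1)$; for $\alpha\in\{0,1\}^n$, $|\alpha|=\sum\alpha_i$, $\mathbf x^\alpha=\prod x_i^{\alpha_i}$, $\mathfrak p_\alpha=\langle x_i\mid\alpha_i\ne0\rangle$. If $I=\bigcap_j\mathfrak p_{\alpha^j}$ is the minimal primary decomposition of $I$, the Alexander dual is $I^\vee=(\mathbf x^{\alpha^1},\mathbf x^{\alpha^2},\dots)$. Hypercube: $M=H^r_I(R)$ is $\mathbb Z^n$-graded. For $\alpha\in\{0,1\}^n$ set $[M]_\alpha:=\mathrm{Hom}_{D_{R|k}}(M,E_\alpha)$, where $D_{R|k}$ is the ring of $k$-linear differential operators and $E_\alpha={}^*E_R(R/\mathfrak p_\alpha)(\mathbf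 1)$ is the shifted $\mathbb Z^n$-graded injective hull (in positive characteristic, use degree-preserving $R$-linear maps); for $\alpha_i=0$ the map $u_{\alpha,i}:[M]_\alpha\to[M]_{\alpha+\varepsilon_i}$ is induced by the natural epimorphism $E_\alpha\to E_{\alpha+\varepsilon_i}$. Equivalently, $[M]_\alpha\cong(M_{-\alpha})^*$, the $k$-dual of the degree $-\alpha$ part of $M$, and $u_{\alpha,i}$ is the dual of multiplication by $x_i$, $M_{-\alpha-\varepsilon_i}\to M_{-\alpha}$. For $\alpha_i\ne0$, $\mathrm{sign}(i,\alpha)=(-1)^{s-1}$ if $\alpha_i$ is the $s$-th nonzero component of $\alpha$. The complex $\mathcal M^\bullet$ is $$0\leftarrow[M]_{\mathbf 1}\leftarrow\bigoplus_{|\alpha|=n-1}[M]_\alpha\leftarrow\cdots\leftarrow\bigoplus_{|\alpha|=n-p}[M]_\alpha\leftarrow\cdots\leftarrow[M]_{\mathbf 0}\leftarrow0,$$ with $\bigoplus_{|\alpha|=n-p}[M]_\alpha$ in homological degree $p$ and maps $[M]_\alpha\to[M]_{\alpha+\varepsilon_i}$ equal to $\mathrm{sign}(i,\alpha+\varepsilon_i)u_{\alpha,i}$. Linear strand: let $\mathbb L_\bullet(I^\vee)$ be the minimal $\mathbb Z^n$-graded free resolution of $I^\vee$, $L_j=\bigoplus_\alpha R(-\alpha)^{\beta_{j,\alpha}(I^\vee)}$, $j\ge0$, with $L_0\to I^\vee$ the augmentation. The $r$-linear strand $\mathbb L^{<r>}_\bullet(I^\vee)$ is the complex with terms $L^{<r>}_j=\bigoplus_{|\alpha|=j+r}R(-\alpha)^{\beta_{j,\alpha}(I^\vee)}$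 ($0\le j\le n-r$) and differentials the corresponding components of those of $\mathbb L_\bullet(I^\vee)$. A $\mathbb Z^n$-graded map between free modules sends a basis element of degree $\alpha$ to a combination of basis elements of degree $\beta\le\alpha$ with coefficients $c\,\mathbf x^{\alpha-\beta}$, $c\in k$; the monomial matrix records the scalars $c$ (together with the degrees of the basis elements). *)

theory Defs
  imports
    "HOL-Algebra.Module"
    "HOL-Algebra.AbelCoset"
    "HOL-Algebra.Ideal"
    "HOL-Algebra.Algebraic_Closure_Type"
    "HOL-Library.Cardinality"
    "HOL-Library.Function_Algebras"
    "HOL-Library.Poly_Mapping"
begin

text \<open>
  The variables \<open>x\<^sub>1, \<dots>, x\<^sub>n\<close> are indexed by a finite linearly ordered type \<open>'n\<close> (so
  \<open>n = CARD('n)\<close>); exponents and degrees are functions on \<open>'n\<close> with pointwise addition.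
  Degrees, including the vertices \<open>\<alpha> \<in> {0,1}\<^sup>n\<close>, live in \<open>\<int>\<^sup>n\<close>.
\<close>

type_synonym 'n deg = "'n \<Rightarrow> int"
type_synonym ('n, 'k) mpoly = "('n \<Rightarrow> nat) \<Rightarrow>\<^sub>0 'k"
type_synonym ('n, 'k) laurent = "('n \<Rightarrow> int) \<Rightarrow>\<^sub>0 'k"

abbreviation base_field :: "'k::field ring" where
  "base_field \<equiv> ring_of_type_algebra"

abbreviation mpoly_ring :: "('n, 'k::field) mpoly ring" where
  "mpoly_ring \<equiv> ring_of_type_algebra"

definition cube :: "'n deg set" where
  "cube = {\<alpha>. \<forall>i. \<alpha> i = 0 \<or> \<alpha> i = 1}"

definition unit_vec :: "'n \<Rightarrow> 'n deg" where
  "unit_vec i = (\<lambda>j. if j = i then 1 else 0)"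

definition weight :: "('n::finite) deg \<Rightarrow> int" where
  "weight \<alpha> = (\<Sum>i\<in>UNIV. \<alpha> i)"


section \<open>Squarefree monomial ideals and Alexander duality\<close>

definition xpow :: "('n \<Rightarrow> nat) \<Rightarrow> ('n, 'k::field) mpoly" where
  "xpow a = Poly_Mapping.single a 1"

definition cube_xpow :: "'n deg \<Rightarrow> ('n, 'k::field) mpoly" where
  "cube_xpow \<alpha> = xpow (\<lambda>i. nat (\<alpha> i))"

definition squarefree_monomial_ideal :: "('n, 'k::field) mpoly set \<Rightarrow> bool" where
  "squarefree_monomial_ideal I \<longleftrightarrow> (\<exists>A \<subseteq> cube. I = Idl\<^bsub>mpoly_ring\<^esub> (cube_xpow ` A))"

definition face_prime :: "'n deg \<Rightarrow> ('n, 'k::field) mpoly set" where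
  "face_prime \<alpha> = Idl\<^bsub>mpoly_ring\<^esub> ((\<lambda>i. cube_xpow (unit_vec i)) ` {i. \<alpha> i \<noteq> 0})"

text \<open>The empty intersection is the whole ring, so \<open>I = R\<close> has the empty decomposition.\<close>

definition minimal_primary_decomposition ::
    "'n deg set \<Rightarrow> ('n, 'k::field) mpoly set \<Rightarrow> bool" where
  "minimal_primary_decomposition A I \<longleftrightarrow>
     A \<subseteq> cube \<and> I = (\<Inter>\<alpha>\<in>A. face_prime \<alpha>) \<and>
     (\<forall>\<beta>\<in>A. I \<noteq> (\<Inter>\<alpha>\<in>A - {\<beta>}. face_prime \<alpha>))"

definition alexander_dual :: "('n, 'k::field) mpoly set \<Rightarrow> ('n, 'k) mpoly set" where
  "alexander_dual I =
     Idl\<^bsub>mpoly_ring\<^esub> (cube_xpow ` (THE A. minimal_primary_decomposition A I))"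


section \<open>Modules\<close>

definition module_homs ::
    "('a, 'x) ring_scheme \<Rightarrow> ('a, 'b, 'y) module_scheme \<Rightarrow> ('a, 'c, 'z) module_scheme \<Rightarrow>
     ('b \<Rightarrow> 'c) set" where
  "module_homs S M N = {f \<in> carrier M \<rightarrow> carrier N.
     (\<forall>x\<in>carrier M. \<forall>y\<in>carrier M. f (x \<oplus>\<^bsub>M\<^esub> y) = f x \<oplus>\<^bsub>N\<^esub> f y) \<and>
     (\<forall>a\<in>carrier S. \<forall>x\<in>carrier M. f (a \<odot>\<^bsub>M\<^esub> x) = a \<odot>\<^bsub>N\<^esub> f x)}"

definition direct_sum :: "'i set \<Rightarrow> ('i \<Rightarrow> ('a, 'b) module) \<Rightarrow> ('a, 'i \<Rightarrow> 'b) module" where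
  "direct_sum A V = \<lparr>
     carrier = (\<Pi>\<^sub>E i\<in>A. carrier (V i)), monoid.mult = (\<lambda>_ _. undefined), one = undefined,
     zero = (\<lambda>i\<in>A. \<zero>\<^bsub>V i\<^esub>), add = (\<lambda>x y. \<lambda>i\<in>A. x i \<oplus>\<^bsub>V i\<^esub> y i),
     module.smult = (\<lambda>c x. \<lambda>i\<in>A. c \<odot>\<^bsub>V i\<^esub> x i)\<rparr>"

definition is_basis ::
    "('a, 'x) ring_scheme \<Rightarrow> ('a, 'b, 'y) module_scheme \<Rightarrow> 'i set \<Rightarrow> ('i \<Rightarrow> 'b) \<Rightarrow> bool" where
  "is_basis K V B v \<longleftrightarrow> module K V \<and> finite B \<and> v \<in> B \<rightarrow> carrier V \<and>
     (\<forall>x\<in>carrier V. \<exists>!c. c \<in> (\<Pi>\<^sub>E b\<in>B. carrier K) \<and> x = (\<Oplus>\<^bsub>V\<^esub>b\<in>B. c b \<odot>\<^bsub>V\<^esub> v b))"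

text \<open>\<open>A\<close> is indexed by row, then column: its columns are the coordinates of the images of
  the basis vectors \<open>v b\<close> with respect to the basis \<open>w\<close>.\<close>

definition is_matrix_of ::
    "('a, 'x) ring_scheme \<Rightarrow> ('a, 'b, 'y) module_scheme \<Rightarrow> 'i set \<Rightarrow> ('i \<Rightarrow> 'b) \<Rightarrow>
     ('a, 'c, 'z) module_scheme \<Rightarrow> 'j set \<Rightarrow> ('j \<Rightarrow> 'c) \<Rightarrow>
     ('j \<Rightarrow> 'i \<Rightarrow> 'a) \<Rightarrow> ('b \<Rightarrow> 'c) \<Rightarrow> bool" where
  "is_matrix_of K V B v W C w A f \<longleftrightarrow> f \<in> module_homs K V W \<and>
     (\<forall>b\<in>B. f (v b) = (\<Oplus>\<^bsub>W\<^esub>c\<in>C. A c b \<odot>\<^bsub>W\<^esub> w c))"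

definition transpose_matrix :: "('i \<Rightarrow> 'j \<Rightarrow> 'a) \<Rightarrow> 'j \<Rightarrow> 'i \<Rightarrow> 'a" where
  "transpose_matrix A = (\<lambda>j i. A i j)"

text \<open>
  A \<open>\<int>\<^sup>n\<close>-graded module over the polynomial ring with an action of the partial derivatives:
  \<open>piece M a\<close> is the degree \<open>a\<close> part, \<open>deriv M i\<close> the action of \<open>\<partial>\<^sub>i\<close>.
\<close>

record ('a, 'b, 'n) graded_dmodule = "('a, 'b) module" +
  deriv :: "'n \<Rightarrow> 'b \<Rightarrow> 'b"
  piece :: "'n deg \<Rightarrow> 'b set"

definition submod :: "('a, 'b, 'n) graded_dmodule \<Rightarrow> 'b set \<Rightarrow> ('a, 'b, 'n) graded_dmodule" where
  "submod M N = M\<lparr>carrier := N, piece := (\<lambda>a. piece M a \<inter> N)\<rparr>"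

definition quotmod ::
    "('a, 'b, 'n) graded_dmodule \<Rightarrow> 'b set \<Rightarrow> ('a, 'b set, 'n) graded_dmodule" where
  "quotmod M N = \<lparr>
     carrier = a_rcosets\<^bsub>M\<^esub> N, monoid.mult = (\<lambda>_ _. undefined), one = undefined,
     zero = N, add = set_add M,
     module.smult = (\<lambda>p U. \<Union>x\<in>U. N +>\<^bsub>M\<^esub> (p \<odot>\<^bsub>M\<^esub> x)),
     deriv = (\<lambda>i U. \<Union>x\<in>U. N +>\<^bsub>M\<^esub> deriv M i x),
     piece = (\<lambda>a. (\<lambda>x. N +>\<^bsub>M\<^esub> x) ` piece M a)\<rparr>"


section \<open>Laurent polynomials and local cohomology\<close>

definition to_laurent :: "('n, 'k::field) mpoly \<Rightarrow> ('n, 'k) laurent" where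
  "to_laurent p = (\<Sum>a\<in>Poly_Mapping.keys p.
     Poly_Mapping.single (\<lambda>i. int (a i)) (Poly_Mapping.lookup p a))"

definition laurent_deriv :: "'n \<Rightarrow> ('n, 'k::field) laurent \<Rightarrow> ('n, 'k) laurent" where
  "laurent_deriv i g = (\<Sum>a\<in>Poly_Mapping.keys g.
     Poly_Mapping.single (a - unit_vec i) (of_int (a i) * Poly_Mapping.lookup g a))"

definition laurent_piece :: "'n deg \<Rightarrow> ('n, 'k::field) laurent set" where
  "laurent_piece a = {g. Poly_Mapping.keys g \<subseteq> {a}}"

text \<open>The localization of the polynomial ring at the monomial \<open>x\<^sup>a\<close>, as the subring of the
  Laurent polynomials \<open>g\<close> with \<open>(x\<^sup>a)\<^sup>t g \<in> R\<close> for some \<open>t\<close>.\<close>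

definition localization :: "('n \<Rightarrow> nat) \<Rightarrow> ('n, 'k::field) laurent set" where
  "localization a = {g. \<exists>t p. to_laurent (xpow a ^ t) * g = to_laurent p}"

definition laurent_module :: "(('n, 'k::field) mpoly, ('n, 'k) laurent, 'n) graded_dmodule" where
  "laurent_module = \<lparr>
     carrier = UNIV, monoid.mult = (*), one = 1, zero = 0, add = (+),
     module.smult = (\<lambda>p g. to_laurent p * g), deriv = laurent_deriv, piece = laurent_piece\<rparr>"

text \<open>
  The Cech complex of \<open>R\<close> on the monomials \<open>x\<^sup>g\<close>, \<open>g\<close> in the list \<open>gs\<close>.  An \<open>r\<close>-cochain is a
  family indexed by all sets \<open>S\<close> of naturals that vanishes unless \<open>S\<close> is an \<open>r\<close>-element set of
  positions in \<open>gs\<close>; its component at such an \<open>S\<close> lies in the localization of \<open>R\<close> at the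
  product of the monomials at the positions in \<open>S\<close>.
\<close>

definition cech :: "('n \<Rightarrow> nat) list \<Rightarrow> nat \<Rightarrow> (nat set \<Rightarrow> ('n, 'k::field) laurent) set" where
  "cech gs r = {c. \<forall>S. if S \<subseteq> {..<length gs} \<and> card S = r
     then c S \<in> localization (\<Sum>j\<in>S. gs ! j) else c S = 0}"

definition cech_diff ::
    "('n \<Rightarrow> nat) list \<Rightarrow> (nat set \<Rightarrow> ('n, 'k::field) laurent) \<Rightarrow>
     nat set \<Rightarrow> ('n, 'k) laurent" where
  "cech_diff gs c = (\<lambda>T. if T \<subseteq> {..<length gs}
     then \<Sum>j\<in>T. (-1) ^ card {i\<in>T. i < j} * c (T - {j}) else 0)"

definition cochain_module ::
    "(('n, 'k::field) mpoly, nat set \<Rightarrow> ('n, 'k) laurent, 'n) graded_dmodule" where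
  "cochain_module = \<lparr>
     carrier = UNIV, monoid.mult = (\<lambda>_ _. undefined), one = undefined,
     zero = (\<lambda>S. 0), add = (\<lambda>c d S. c S + d S),
     module.smult = (\<lambda>p c S. to_laurent p * c S),
     deriv = (\<lambda>i c S. laurent_deriv i (c S)),
     piece = (\<lambda>a. {c. \<forall>S. c S \<in> laurent_piece a})\<rparr>"

definition cocycles :: "('n \<Rightarrow> nat) list \<Rightarrow> nat \<Rightarrow> (nat set \<Rightarrow> ('n, 'k::field) laurent) set" where
  "cocycles gs r = {c \<in> cech gs r. cech_diff gs c = (\<lambda>_. 0)}"

definition coboundaries ::
    "('n \<Rightarrow> nat) list \<Rightarrow> nat \<Rightarrow> (nat set \<Rightarrow> ('n, 'k::field) laurent) set" where
  "coboundaries gs r = (case r of 0 \<Rightarrow> {\<lambda>_. 0} | Suc q \<Rightarrow> cech_diff gs ` cech gs q)"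

text \<open>\<open>H\<^sup>r\<^sub>I(R)\<close> for the ideal \<open>I\<close> generated by the monomials with exponents in \<open>gs\<close>.\<close>

definition local_cohomology ::
    "('n \<Rightarrow> nat) list \<Rightarrow> nat \<Rightarrow>
     (('n, 'k::field) mpoly, (nat set \<Rightarrow> ('n, 'k) laurent) set, 'n) graded_dmodule" where
  "local_cohomology gs r = quotmod (submod cochain_module (cocycles gs r)) (coboundaries gs r)"


section \<open>The hypercube and its complex\<close>

text \<open>
  \<open>E\<^sub>\<alpha> = *E(R/p\<^sub>\<alpha>)(1)\<close> is realised as the quotient of \<open>k[x\<^sub>1\<^sup>\<plusminus>, \<dots>, x\<^sub>n\<^sup>\<plusminus>]\<close> by the sum of the
  localizations at \<open>x\<^sup>1\<^sup>-\<^sup>\<epsilon>\<^sup>i\<close> (the product of all variables but \<open>x\<^sub>i\<close>), where \<open>\<alpha>\<^sub>i \<noteq> 0\<close>.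
  Its nonzero degrees are those \<open>a\<close> with \<open>a\<^sub>i \<le> -1\<close> whenever \<open>\<alpha>\<^sub>i \<noteq> 0\<close>, in accordance with the
  shift by \<open>1\<close>: the degrees of \<open>*E(R/p\<^sub>\<alpha>)\<close> satisfy \<open>a\<^sub>i \<le> 0\<close>.  The natural epimorphism
  \<open>E\<^sub>\<alpha> \<rightarrow> E\<^sub>\<alpha>\<^sub>+\<^sub>\<epsilon>\<^sub>i\<close> is the projection.
\<close>

definition inj_relations :: "('n::finite) deg \<Rightarrow> ('n, 'k::field) laurent set" where
  "inj_relations \<alpha> = {\<Sum>i\<in>{i. \<alpha> i \<noteq> 0}. g i | g.
     \<forall>i. g i \<in> localization (\<lambda>j. if j = i then 0 else 1)}"

definition inj_module ::
    "('n::finite) deg \<Rightarrow> (('n, 'k::field) mpoly, ('n, 'k) laurent set, 'n) graded_dmodule" where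
  "inj_module \<alpha> = quotmod laurent_module (inj_relations \<alpha>)"

definition inj_proj ::
    "('n::finite) deg \<Rightarrow> 'n \<Rightarrow> ('n, 'k::field) laurent set \<Rightarrow> ('n, 'k) laurent set" where
  "inj_proj \<alpha> i U = inj_relations (\<alpha> + unit_vec i) <+>\<^bsub>laurent_module\<^esub> U"

text \<open>
  In characteristic \<open>0\<close> the ring of differential operators is generated by \<open>R\<close> and the
  \<open>\<partial>\<^sub>i\<close>, so linearity over it means \<open>R\<close>-linearity and commutation with the \<open>\<partial>\<^sub>i\<close>; in positive
  characteristic the degree-preserving \<open>R\<close>-linear maps are used.  Maps are extensional, i.e.
  fixed to \<open>undefined\<close> outside the carrier.
\<close>

definition diff_homs ::
    "(('n, 'k::field) mpoly, 'b, 'n) graded_dmodule \<Rightarrow>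
     (('n, 'k) mpoly, 'c, 'n) graded_dmodule \<Rightarrow> ('b \<Rightarrow> 'c) set" where
  "diff_homs M N = {f \<in> module_homs mpoly_ring M N \<inter> extensional (carrier M).
     if CHAR('k) = 0 then \<forall>i. \<forall>x\<in>carrier M. f (deriv M i x) = deriv N i (f x)
     else \<forall>a. f ` piece M a \<subseteq> piece N a}"

definition hom_space ::
    "(('n, 'k::field) mpoly, 'b, 'n) graded_dmodule \<Rightarrow>
     (('n, 'k) mpoly, 'c, 'n) graded_dmodule \<Rightarrow> ('k, 'b \<Rightarrow> 'c) module" where
  "hom_space M N = \<lparr>
     carrier = diff_homs M N, monoid.mult = (\<lambda>_ _. undefined), one = undefined,
     zero = (\<lambda>x\<in>carrier M. \<zero>\<^bsub>N\<^esub>), add = (\<lambda>f g. \<lambda>x\<in>carrier M. f x \<oplus>\<^bsub>N\<^esub> g x),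
     module.smult = (\<lambda>c f. \<lambda>x\<in>carrier M. Poly_Mapping.single 0 c \<odot>\<^bsub>N\<^esub> f x)\<rparr>"

definition hypercube ::
    "(('n::finite, 'k::field) mpoly, 'b, 'n) graded_dmodule \<Rightarrow> 'n deg \<Rightarrow>
     ('k, 'b \<Rightarrow> ('n, 'k) laurent set) module" where
  "hypercube M \<alpha> = hom_space M (inj_module \<alpha>)"

definition hypercube_map ::
    "(('n::finite, 'k::field) mpoly, 'b, 'n) graded_dmodule \<Rightarrow> 'n deg \<Rightarrow> 'n \<Rightarrow>
     ('b \<Rightarrow> ('n, 'k) laurent set) \<Rightarrow> 'b \<Rightarrow> ('n, 'k) laurent set" where
  "hypercube_map M \<alpha> i f = (\<lambda>x\<in>carrier M. inj_proj \<alpha> i (f x))"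

definition cube_sign :: "('n::{finite,linorder}) \<Rightarrow> 'n deg \<Rightarrow> 'k::field" where
  "cube_sign i \<alpha> = (-1) ^ card {j. \<alpha> j \<noteq> 0 \<and> j < i}"

definition cube_level :: "nat \<Rightarrow> ('n::finite) deg set" where
  "cube_level p = {\<alpha> \<in> cube. weight \<alpha> = int CARD('n) - int p}"

definition cube_complex ::
    "(('n::finite, 'k::field) mpoly, 'b, 'n) graded_dmodule \<Rightarrow> nat \<Rightarrow>
     ('k, 'n deg \<Rightarrow> 'b \<Rightarrow> ('n, 'k) laurent set) module" where
  "cube_complex M p = direct_sum (cube_level p) (hypercube M)"

text \<open>The map from homological degree \<open>p + 1\<close> to homological degree \<open>p\<close>.\<close>

definition cube_diff ::
    "(('n::{finite,linorder}, 'k::field) mpoly, 'b, 'n) graded_dmodule \<Rightarrow> nat \<Rightarrow>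
     ('n deg \<Rightarrow> 'b \<Rightarrow> ('n, 'k) laurent set) \<Rightarrow> 'n deg \<Rightarrow> 'b \<Rightarrow> ('n, 'k) laurent set" where
  "cube_diff M p w = (\<lambda>\<beta>\<in>cube_level p. \<Oplus>\<^bsub>hypercube M \<beta>\<^esub>i\<in>{i. \<beta> i \<noteq> 0}.
     cube_sign i \<beta> \<odot>\<^bsub>hypercube M \<beta>\<^esub> hypercube_map M (\<beta> - unit_vec i) i (w (\<beta> - unit_vec i)))"


section \<open>Graded free complexes, minimal resolutions and linear strands\<close>

text \<open>
  \<open>L\<^sub>j\<close> is free on \<open>fc_basis L j\<close>, where the basis element \<open>b\<close> has degree \<open>fc_deg L j b\<close>; a
  vector is its coordinate function, zero outside the basis.  \<open>fc_diff L j\<close> maps \<open>L\<^sub>j\<^sub>+\<^sub>1\<close> to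
  \<open>L\<^sub>j\<close>.
\<close>

record (overloaded) ('b, 'n, 'k::zero) free_complex =
  fc_basis :: "nat \<Rightarrow> 'b set"
  fc_deg :: "nat \<Rightarrow> 'b \<Rightarrow> 'n deg"
  fc_diff :: "nat \<Rightarrow> ('b \<Rightarrow> ('n, 'k) mpoly) \<Rightarrow> 'b \<Rightarrow> ('n, 'k) mpoly"

definition fc_module ::
    "('b, 'n, 'k::field) free_complex \<Rightarrow> nat \<Rightarrow> (('n, 'k) mpoly, 'b \<Rightarrow> ('n, 'k) mpoly) module" where
  "fc_module L j = \<lparr>
     carrier = {v. \<forall>b. b \<notin> fc_basis L j \<longrightarrow> v b = 0},
     monoid.mult = (\<lambda>_ _. undefined), one = undefined,
     zero = (\<lambda>b. 0), add = (\<lambda>v w b. v b + w b), module.smult = (\<lambda>p v b. p * v b)\<rparr>"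

definition poly_module :: "(('n, 'k::field) mpoly, ('n, 'k) mpoly) module" where
  "poly_module = \<lparr>
     carrier = UNIV, monoid.mult = (*), one = 1, zero = 0, add = (+), module.smult = (*)\<rparr>"

definition poly_piece :: "'n deg \<Rightarrow> ('n, 'k::field) mpoly set" where
  "poly_piece \<gamma> = {p. \<forall>a\<in>Poly_Mapping.keys p. (\<lambda>i. int (a i)) = \<gamma>}"

definition fc_piece ::
    "('b, 'n, 'k::field) free_complex \<Rightarrow> nat \<Rightarrow> 'n deg \<Rightarrow> ('b \<Rightarrow> ('n, 'k) mpoly) set" where
  "fc_piece L j \<gamma> = {v \<in> carrier (fc_module L j). \<forall>b. v b \<in> poly_piece (\<gamma> - fc_deg L j b)}"

definition graded_free_complex :: "('b, 'n, 'k::field) free_complex \<Rightarrow> bool" where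
  "graded_free_complex L \<longleftrightarrow> (\<forall>j. finite (fc_basis L j) \<and>
     fc_diff L j \<in> module_homs mpoly_ring (fc_module L (Suc j)) (fc_module L j) \<and>
     (\<forall>\<gamma>. fc_diff L j ` fc_piece L (Suc j) \<gamma> \<subseteq> fc_piece L j \<gamma>) \<and>
     (\<forall>v\<in>carrier (fc_module L (Suc (Suc j))).
        fc_diff L j (fc_diff L (Suc j) v) = (\<lambda>_. 0)))"

definition minimal_free_resolution ::
    "('b, 'n, 'k::field) free_complex \<Rightarrow> (('b \<Rightarrow> ('n, 'k) mpoly) \<Rightarrow> ('n, 'k) mpoly) \<Rightarrow>
     ('n, 'k) mpoly set \<Rightarrow> bool" where
  "minimal_free_resolution L \<epsilon> J \<longleftrightarrow> graded_free_complex L \<and>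
     \<epsilon> \<in> module_homs mpoly_ring (fc_module L 0) poly_module \<and>
     (\<forall>\<gamma>. \<epsilon> ` fc_piece L 0 \<gamma> \<subseteq> poly_piece \<gamma>) \<and>
     \<epsilon> ` carrier (fc_module L 0) = J \<and>
     {v \<in> carrier (fc_module L 0). \<epsilon> v = 0} = fc_diff L 0 ` carrier (fc_module L 1) \<and>
     (\<forall>j. {v \<in> carrier (fc_module L (Suc j)). fc_diff L j v = (\<lambda>_. 0)} =
        fc_diff L (Suc j) ` carrier (fc_module L (Suc (Suc j)))) \<and>
     (\<forall>j. \<forall>v\<in>carrier (fc_module L (Suc j)). \<forall>b. fc_diff L j v b \<in> face_prime (\<lambda>_. 1))"

definition linear_strand ::
    "nat \<Rightarrow> ('b, 'n::finite, 'k::field) free_complex \<Rightarrow> ('b, 'n, 'k) free_complex" where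
  "linear_strand r L =
     (let B = (\<lambda>j. {b \<in> fc_basis L j. weight (fc_deg L j b) = int j + int r})
      in \<lparr>fc_basis = B, fc_deg = fc_deg L,
          fc_diff = (\<lambda>j v b. if b \<in> B j then fc_diff L j v b else 0)\<rparr>)"

text \<open>
  The scalar \<open>c\<close> in the coefficient \<open>c x\<^sup>\<beta>\<^sup>-\<^sup>\<alpha>\<close> of the basis element \<open>b\<close> of \<open>L\<^sub>j\<close>, of degree
  \<open>\<alpha>\<close>, in the image of the basis element \<open>b'\<close> of \<open>L\<^sub>j\<^sub>+\<^sub>1\<close>, of degree \<open>\<beta>\<close> (row \<open>b\<close>, column
  \<open>b'\<close>).  If \<open>\<alpha> \<le> \<beta>\<close> fails, that coefficient is \<open>0\<close> in a graded complex, hence so is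
  the entry despite the truncating \<open>nat\<close>.
\<close>

definition monomial_matrix ::
    "('b, 'n, 'k::field) free_complex \<Rightarrow> nat \<Rightarrow> 'b \<Rightarrow> 'b \<Rightarrow> 'k" where
  "monomial_matrix L j b b' =
     Poly_Mapping.lookup (fc_diff L j (\<lambda>c. if c = b' then 1 else 0) b)
       (\<lambda>i. nat (fc_deg L (Suc j) b' i - fc_deg L j b i))"

text \<open>The basis of the term of the strand corresponding to homological degree \<open>p\<close> of the
  hypercube complex, namely \<open>L\<^sub>n\<^sub>-\<^sub>r\<^sub>-\<^sub>p\<close>, which is zero if \<open>n - r - p\<close> is negative.\<close>

definition strand_basis :: "nat \<Rightarrow> ('b, 'n::finite, 'k::field) free_complex \<Rightarrow> nat \<Rightarrow> 'b set" where
  "strand_basis r L p = (if r + p \<le> CARD('n)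
     then fc_basis (linear_strand r L) (CARD('n) - r - p) else {})"

end

theory Submission imports Defs begin

text \<open>
  Write \<open>N\<close>, \<open>\<tau>\<close> for sets of variables and \<open>S\<close> for sets of positions in the list \<open>gs\<close> of
  generators.  In degree \<open>a\<close> the Cech complex only sees the set \<open>N\<close> of negative coordinates of
  \<open>a\<close>: a cochain of degree \<open>a\<close> is a scalar function on those \<open>S\<close> whose generators together
  involve every variable of \<open>N\<close> (lemma \<open>cech_iff\<close>).  Call this complex \<open>C\<^sub>N\<close>; it gets smaller
  when \<open>N\<close> grows.  A homomorphism from \<open>H\<^sup>r\<^sub>I(R)\<close> to \<open>E\<^sub>\<alpha>\<close> preserves degrees (in
  characteristic \<open>0\<close> because of the Euler operators \<open>x\<^sub>i\<partial>\<^sub>i\<close>) and commutes with monomials, so it is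
  one functional on \<open>H\<^sup>r(C\<^sub>N)\<close> for \<open>N = supp \<alpha>\<close> (lemmas \<open>hom_eq_hom_of\<close>,
  \<open>hom_of_in_diff_homs\<close>), and \<open>u\<^sub>\<alpha>\<^sub>,\<^sub>i\<close> is restriction of functionals along
  \<open>C\<^sub>N\<^sub>\<union>\<^sub>{\<^sub>i\<^sub>} \<subseteq> C\<^sub>N\<close>.

  It remains to identify \<open>H\<^sup>r(C\<^sub>N)\<close> with the scalar functions on the basis elements of degree
  \<open>N\<close> of \<open>L\<^sub>j\<close>, \<open>j = |N| - r\<close>, compatibly with these inclusions.  For a set \<open>\<tau>\<close> of variables
  let \<open>V\<^sub>\<tau>\<close> be the set of generators that involve no variable of \<open>\<tau>\<close>.  The complex of cochains
  on the subsets of \<open>V\<^sub>\<tau>\<close> is acyclic if \<open>V\<^sub>\<tau> \<noteq> {}\<close> and is \<open>k\<close> in degree \<open>0\<close> otherwise;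
  moreover \<open>V\<^sub>\<tau> = {}\<close> holds iff \<open>x\<^sup>\<tau> \<in> I\<^sup>\<or>\<close> (lemmas \<open>vertex_cover_genideal\<close> and
  \<open>alexander_dual_eq\<close>).  The degree \<open>\<tau>\<close> part of the resolution \<open>L\<close> resolves the degree \<open>\<tau>\<close>
  part of \<open>I\<^sup>\<or>\<close>, that is \<open>0\<close> or \<open>k\<close> in the same two cases.  The augmentation therefore glues
  both complexes to one exact complex
  \<open>\<dots> \<rightarrow> (L\<^sub>1)\<^sub>\<tau> \<rightarrow> (L\<^sub>0)\<^sub>\<tau> \<rightarrow> k\<^bsup>{\<emptyset>}\<^esup> \<rightarrow> \<dots>\<close>, for every \<open>\<tau>\<close>.

  Let \<open>\<tau>\<close> run through the subsets of \<open>N\<close>, with the Koszul differential in this direction.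
  This is a double complex with exact rows.  A set \<open>S\<close> lives at the \<open>\<tau>\<close> that avoid the
  variables of its generators, a basis element of degree \<open>\<gamma>\<close> at the \<open>\<tau> \<supseteq> supp \<gamma>\<close>; so each
  column is the Koszul complex of an interval of sets and is exact unless the interval is a
  single point.  These points are \<open>\<tau> = {}\<close> for the \<open>S\<close> that span \<open>C\<^sub>N\<close> and \<open>\<tau> = N\<close> for the
  basis elements of degree \<open>N\<close>.  Walking down the staircase from one corner to the other
  gives the identification; by minimality there is no differential between basis elements of the
  same degree.  A staircase over \<open>N \<union> {i}\<close> restricts to one over \<open>N\<close>, and its equation at the
  vertex \<open>N \<union> {i}\<close> expresses its corner values over \<open>N\<close> by those over \<open>N \<union> {i}\<close> through the
  monomial matrix and the Koszul sign, which is exactly the sign of the hypercube complex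
  (lemma \<open>corner_value_insert\<close>).  Dualizing transposes the matrix.
\<close>

section \<open>Koszul differential on set functions\<close>
definition koszul_sign :: "'a::linorder \<Rightarrow> 'a set \<Rightarrow> 'k::comm_ring_1" where
  "koszul_sign i T = (-1) ^ card {l \<in> T. l < i}"

definition koszul :: "('a::linorder set \<Rightarrow> 'k::comm_ring_1) \<Rightarrow> 'a set \<Rightarrow> 'k" where
  "koszul y T = (\<Sum>i\<in>T. koszul_sign i T * y (T - {i}))"

lemma koszul_sign_square [simp]: "koszul_sign i T * koszul_sign i T = 1"
  by (simp add: koszul_sign_def flip: power_add mult_2)

lemma koszul_sign_square_left [simp]: "koszul_sign i T * (koszul_sign i T * c) = c"
  by (metis koszul_sign_square mult.assoc mult_1)

lemma koszul_sign_swap: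
  assumes "finite T" "i \<in> T" "l \<in> T" "i \<noteq> l"
  shows "koszul_sign i T * koszul_sign l (T - {i}) = - (koszul_sign l T * koszul_sign i (T - {l}) :: 'k::comm_ring_1)"
proof -
  have *: "koszul_sign i T * koszul_sign l (T - {i}) = - (koszul_sign l T * koszul_sign i (T - {l}) :: 'k)"
    if "i < l" "i \<in> T" "l \<in> T" for i l
  proof -
    have 1: "{x \<in> T - {l}. x < i} = {x \<in> T. x < i}" using that by auto
    have 2: "{x \<in> T. x < l} = insert i {x \<in> T - {i}. x < l}" using that by auto
    have 3: "card {x \<in> T. x < l} = Suc (card {x \<in> T - {i}. x < l})"
      unfolding 2 using assms(1) by (subst card_insert_disjoint) auto
    show ?thesis unfolding koszul_sign_def 1 3 by simp
  qed
  show ?thesis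
  proof (cases "i < l")
    case True
    then show ?thesis using * assms by blast
  next
    case False
    then have "koszul_sign l T * koszul_sign i (T - {l}) = - (koszul_sign i T * koszul_sign l (T - {i}) :: 'k)"
      using * assms by auto
    then show ?thesis by simp
  qed
qed

lemma koszul_empty [simp]: "koszul y {} = 0"
  by (simp add: koszul_def)

lemma koszul_singleton [simp]: "koszul y {i} = koszul_sign i {i} * y {}"
  by (simp add: koszul_def)

lemma koszul_cong: "(\<And>i. i \<in> T \<Longrightarrow> y (T - {i}) = z (T - {i})) \<Longrightarrow> koszul y T = koszul z T"
  by (simp add: koszul_def)

lemma koszul_eq_0: "(\<And>i. i \<in> T \<Longrightarrow> y (T - {i}) = 0) \<Longrightarrow> koszul y T = 0"
  by (simp add: koszul_def)

lemma koszul_add: "koszul (\<lambda>S. y S + z S) T = koszul y T + koszul z T"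
  by (simp add: koszul_def distrib_left sum.distrib)

lemma koszul_scale: "koszul (\<lambda>S. c * y S) T = c * koszul y T"
  by (simp add: koszul_def sum_distrib_left mult.left_commute)

lemma koszul_diff: "koszul (\<lambda>S. y S - z S) T = koszul y T - koszul z T"
  by (simp add: koszul_def right_diff_distrib sum_subtractf)

lemma koszul_nonzero: "koszul y T \<noteq> 0 \<Longrightarrow> \<exists>i\<in>T. y (T - {i}) \<noteq> 0"
  using koszul_eq_0 by blast

lemma koszul_koszul:
  fixes y :: "'a::linorder set \<Rightarrow> 'k::comm_ring_1"
  assumes "finite T"
  shows "koszul (koszul y) T = 0"
proof -
  define f where "f = (\<lambda>(i, l). koszul_sign i T * koszul_sign l (T - {i}) * y (T - {i} - {l}) :: 'k)"
  let ?A = "{(i, l). i \<in> T \<and> l \<in> T \<and> i < l}" and ?B = "{(i, l). i \<in> T \<and> l \<in> T \<and> l < i}"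
  have fin: "finite ?A" "finite ?B"
    using assms by (auto intro: finite_subset[of _ "T \<times> T"])
  \<comment> \<open>Antisymmetry alone is not enough in characteristic two: pair \<open>(i, l)\<close> with \<open>(l, i)\<close>.\<close>
  have "koszul (koszul y) T = (\<Sum>i\<in>T. \<Sum>l\<in>T - {i}. f (i, l))"
    by (simp add: koszul_def sum_distrib_left f_def mult.assoc)
  also have "\<dots> = sum f (SIGMA i:T. T - {i})"
    using assms by (subst sum.Sigma) auto
  also have "(SIGMA i:T. T - {i}) = ?A \<union> ?B" by auto
  also have "sum f (?A \<union> ?B) = sum f ?A + sum f ?B"
    using fin by (intro sum.union_disjoint) auto
  also have "sum f ?B = sum (\<lambda>p. f (snd p, fst p)) ?A"
    by (intro sum.reindex_bij_witness[where i = "\<lambda>p. (snd p, fst p)" and j = "\<lambda>p. (snd p, fst p)"]) auto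
  also have "\<dots> = sum (\<lambda>p. - f p) ?A"
  proof (intro sum.cong refl, clarify)
    fix i l assume *: "i \<in> T" "l \<in> T" "i < l"
    have "T - {l} - {i} = T - {i} - {l}" by auto
    then show "f (snd (i, l), fst (i, l)) = - f (i, l)"
      using koszul_sign_swap[OF assms *(2,1), where 'k = 'k] * by (simp add: f_def)
  qed
  finally show ?thesis by (simp add: sum_negf)
qed

text \<open>
  The contraction: on functions supported in an interval of sets, inserting a fixed \<open>i\<close> that is
  free to move within the interval inverts the differential on cocycles.
\<close>
lemma koszul_contraction:
  fixes v :: "'a::linorder set \<Rightarrow> 'k::comm_ring_1"
  assumes fin: "finite \<tau>" and i: "i \<notin> b" "i \<in> t"
    and supp: "\<And>\<sigma>. v \<sigma> \<noteq> 0 \<Longrightarrow> b \<subseteq> \<sigma> \<and> \<sigma> \<subseteq> t"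
    and \<tau>: "b \<subseteq> \<tau>" "\<tau> \<subseteq> t" and closed: "i \<notin> \<tau> \<Longrightarrow> koszul v (insert i \<tau>) = 0"
  shows "koszul (\<lambda>\<sigma>. if b \<subseteq> \<sigma> \<and> \<sigma> \<subseteq> t \<and> i \<notin> \<sigma>
           then koszul_sign i (insert i \<sigma>) * v (insert i \<sigma>) else 0) \<tau> = v \<tau>"
    (is "koszul ?h \<tau> = _")
proof (cases "i \<in> \<tau>")
  case True
  then have "koszul ?h \<tau> = (\<Sum>l\<in>{i}. koszul_sign l \<tau> * ?h (\<tau> - {l}))"
    unfolding koszul_def using fin by (intro sum.mono_neutral_right) auto
  also have "\<dots> = v \<tau>"
    using True i \<tau> by (auto simp: insert_absorb)
  finally show ?thesis .
next
  case False
  let ?T = "insert i \<tau>"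
  have "koszul v ?T = koszul_sign i ?T * v \<tau> + (\<Sum>l\<in>\<tau>. koszul_sign l ?T * v (?T - {l}))"
    unfolding koszul_def using False fin by (subst sum.insert) auto
  then have "koszul_sign i ?T * v \<tau> + (\<Sum>l\<in>\<tau>. koszul_sign l ?T * v (?T - {l})) = 0"
    using closed[OF False] by simp
  then have "v \<tau> = - (\<Sum>l\<in>\<tau>. koszul_sign i ?T * koszul_sign l ?T * v (?T - {l}))"
    by (metis (no_types, lifting) koszul_sign_square_left mult.assoc mult_minus_right
        sum_distrib_left sum.cong eq_neg_iff_add_eq_0)
  also have "\<dots> = (\<Sum>l\<in>\<tau>. koszul_sign l \<tau> * ?h (\<tau> - {l}))"
    unfolding sum_negf[symmetric]
  proof (rule sum.cong[OF refl])
    fix l assume l: "l \<in> \<tau>"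
    have il: "i \<noteq> l" using l False by auto
    have eq: "insert i (\<tau> - {l}) = ?T - {l}" "?T - {i} = \<tau>" using il False by auto
    show "- (koszul_sign i ?T * koszul_sign l ?T * v (?T - {l})) = koszul_sign l \<tau> * ?h (\<tau> - {l})"
    proof (cases "b \<subseteq> \<tau> - {l}")
      case True
      have "koszul_sign i ?T * koszul_sign l \<tau> = - (koszul_sign l ?T * koszul_sign i (?T - {l}) :: 'k)"
        using koszul_sign_swap[of ?T i l] fin l il eq by (simp add: )
      moreover have "A * C = - (B * D)" if "A * B = - (C * D)" "B * B = 1" "C * C = 1" for A B C D :: 'k
      proof -
        have "A * C = A * (B * B) * C" using that by simp
        also have "\<dots> = (A * B) * (B * C)" by (simp only: mult.assoc)
        also have "\<dots> = - (C * D) * (B * C)" using that by simp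
        also have "\<dots> = - ((C * C) * (B * D))" by (simp add: ac_simps)
        finally show ?thesis using that by simp
      qed
      ultimately have "koszul_sign i ?T * koszul_sign l ?T = - (koszul_sign l \<tau> * koszul_sign i (?T - {l}) :: 'k)"
        by (metis koszul_sign_square)
      then have "- (koszul_sign i ?T * koszul_sign l ?T * v (?T - {l})) = koszul_sign l \<tau> * koszul_sign i (?T - {l}) * v (?T - {l})"
        by simp
      then show ?thesis
        using True \<tau> False l by (auto simp: eq mult.assoc)
    next
      case F: False
      then have "\<not> b \<subseteq> ?T - {l}" using i by auto
      then have "v (?T - {l}) = 0" using supp by blast
      then show ?thesis using F by (simp add: eq)
    qed
  qed
  finally show ?thesis by (simp add: koszul_def)
qed

section \<open>Double complexes that are exact away from two corners\<close>
text \<open>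
  A cell \<open>x\<close> of row degree \<open>dg x\<close> lives at the sets \<open>\<tau>\<close> with \<open>lo x \<subseteq> \<tau> \<subseteq> hi x\<close>, and \<open>d\<close> is
  the row differential on scalar functions of cells.  Cells of nonnegative degree have no lower
  bound, so the only \<open>\<tau> \<subseteq> N\<close> at which a column of theirs can be a single point is \<open>{}\<close>; cells of
  negative degree have no upper bound, so there it is \<open>N\<close>.  The clause \<open>lo y \<noteq> lo x\<close> is minimality
  of the negative part.  A cell with \<open>\<tau> \<subseteq> hi z\<close> that is not live at \<open>\<tau>\<close> receives nothing from live
  cells, which is why the equations may be required at all such cells.
\<close>
locale corner_complex =
  fixes Cells :: "'x set" and dg :: "'x \<Rightarrow> int"
    and lo hi :: "'x \<Rightarrow> 'n::{finite,linorder} set"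
    and d :: "('x \<Rightarrow> 'k::field) \<Rightarrow> 'x \<Rightarrow> 'k"
  assumes d_add: "d (\<lambda>x. f x + g x) y = d f y + d g y"
    and d_scale: "d (\<lambda>x. c * f x) y = c * d f y"
    and d_local: "d f y \<noteq> 0 \<Longrightarrow> y \<in> Cells \<and> (\<exists>x\<in>Cells. f x \<noteq> 0 \<and> dg y = dg x + 1 \<and>
      lo y \<subseteq> lo x \<and> hi y \<subseteq> hi x \<and> (dg y < 0 \<longrightarrow> lo y \<noteq> lo x))"
    and lo_nonneg: "x \<in> Cells \<Longrightarrow> 0 \<le> dg x \<Longrightarrow> lo x = {}"
    and hi_neg: "x \<in> Cells \<Longrightarrow> dg x < 0 \<Longrightarrow> hi x = UNIV"
    and d_square: "\<lbrakk>\<And>x. f x \<noteq> 0 \<Longrightarrow> x \<in> Cells \<and> lo x \<subseteq> \<tau> \<and> \<tau> \<subseteq> hi x; z \<in> Cells; \<tau> \<subseteq> hi z\<rbrakk> \<Longrightarrow> d (d f) z = 0"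
    and exact: "\<lbrakk>\<And>x. f x \<noteq> 0 \<Longrightarrow> x \<in> Cells \<and> lo x \<subseteq> \<tau> \<and> \<tau> \<subseteq> hi x \<and> dg x = q;
        \<And>z. z \<in> Cells \<Longrightarrow> \<tau> \<subseteq> hi z \<Longrightarrow> d f z = 0\<rbrakk>
      \<Longrightarrow> \<exists>g. (\<forall>x. g x \<noteq> 0 \<longrightarrow> x \<in> Cells \<and> lo x \<subseteq> \<tau> \<and> \<tau> \<subseteq> hi x \<and> dg x = q - 1) \<and>
            (\<forall>z\<in>Cells. \<tau> \<subseteq> hi z \<longrightarrow> d g z = f z)"
begin

definition live :: "'n set \<Rightarrow> 'x \<Rightarrow> bool" where
  "live \<tau> x \<longleftrightarrow> x \<in> Cells \<and> lo x \<subseteq> \<tau> \<and> \<tau> \<subseteq> hi x"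

definition homogeneous :: "int \<Rightarrow> ('n set \<Rightarrow> 'x \<Rightarrow> 'k) \<Rightarrow> bool" where
  "homogeneous s w \<longleftrightarrow> (\<forall>\<tau> x. w \<tau> x \<noteq> 0 \<longrightarrow> live \<tau> x \<and> dg x + int (card \<tau>) = s)"

lemma homogeneousD: "homogeneous s w \<Longrightarrow> w \<tau> x \<noteq> 0 \<Longrightarrow> live \<tau> x \<and> dg x + int (card \<tau>) = s"
  by (simp add: homogeneous_def)

lemma d_zero [simp]: "d (\<lambda>x. 0) y = 0"
  using d_scale[of 0 "\<lambda>_. 0" y] by simp

lemma d_diff: "d (\<lambda>x. f x - g x) y = d f y - d g y"
  using d_add[of f "\<lambda>x. - 1 * g x" y] d_scale[of "- 1" g y] by simp

lemma d_cong:
  assumes "\<And>x. x \<in> Cells \<Longrightarrow> hi y \<subseteq> hi x \<Longrightarrow> f x = g x"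
  shows "d f y = d g y"
proof (rule ccontr)
  assume "d f y \<noteq> d g y"
  then have "d (\<lambda>x. f x - g x) y \<noteq> 0" by (simp add: d_diff)
  then show False using d_local[of "\<lambda>x. f x - g x" y] assms by auto
qed

lemma d_sum: "finite A \<Longrightarrow> d (\<lambda>x. \<Sum>i\<in>A. f i x) y = (\<Sum>i\<in>A. d (f i) y)"
  by (induction rule: finite_induct) (simp_all add: d_add)

lemma d_koszul: "d (\<lambda>x. koszul (\<lambda>\<sigma>. w \<sigma> x) (\<tau> :: 'n set)) y = koszul (\<lambda>\<sigma>. d (w \<sigma>) y) \<tau>"
  unfolding koszul_def by (simp add: d_sum d_scale)

lemma koszul_koszul_UNIV: "koszul (koszul y) (\<tau> :: 'n set) = 0"
  by (rule koszul_koszul) simp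

lemma koszul_live:
  assumes "homogeneous s w" "koszul (\<lambda>\<sigma>. w \<sigma> x) \<tau> \<noteq> 0" "\<tau> \<subseteq> hi x"
  shows "live \<tau> x \<and> dg x + int (card \<tau>) = s + 1"
proof -
  obtain i where i: "i \<in> \<tau>" "w (\<tau> - {i}) x \<noteq> 0"
    using koszul_nonzero[OF assms(2)] by auto
  have "card \<tau> = Suc (card (\<tau> - {i}))"
    using i card_Suc_Diff1[of \<tau> i] by simp
  then show ?thesis
    using homogeneousD[OF assms(1) i(2)] assms(3) by (auto simp: live_def)
qed

lemma d_live:
  assumes "homogeneous s w" "d (w \<tau>) x \<noteq> 0" "\<tau> \<subseteq> hi x"
  shows "live \<tau> x \<and> dg x + int (card \<tau>) = s + 1"
  using d_local[OF assms(2)] homogeneousD[OF assms(1)] assms(3) by (force simp: live_def)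

lemma d_square_homogeneous:
  assumes "homogeneous s w" "z \<in> Cells" "\<tau> \<subseteq> hi z"
  shows "d (d (w \<tau>)) z = 0"
  using d_square[of "w \<tau>" \<tau> z] assms homogeneousD[OF assms(1)] by (auto simp: live_def)

text \<open>
  Exact rows suffice to solve for a primitive layer by layer, by increasing size of \<open>\<tau>\<close>.  Both
  signs \<open>u = 1\<close> and \<open>u = -1\<close> are needed: the first for staircases, the second for primitives in
  the total complex.
\<close>
lemma solve_upwards:
  assumes w: "homogeneous (s + 1) w"
    and compat: "\<And>\<tau> x. \<tau> \<subseteq> N \<Longrightarrow> x \<in> Cells \<Longrightarrow> \<tau> \<subseteq> hi x \<Longrightarrow> d (w \<tau>) x = - u * koszul (\<lambda>\<sigma>. w \<sigma> x) \<tau>"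
  shows "\<exists>y. homogeneous s y \<and> (\<forall>\<tau>\<subseteq>N. \<forall>x\<in>Cells. \<tau> \<subseteq> hi x \<longrightarrow>
    d (y \<tau>) x = u * koszul (\<lambda>\<sigma>. y \<sigma> x) \<tau> + w \<tau> x)"
proof -
  have "\<exists>y. homogeneous s y \<and> (\<forall>\<tau>\<subseteq>N. card \<tau> < k \<longrightarrow> (\<forall>x\<in>Cells. \<tau> \<subseteq> hi x \<longrightarrow>
    d (y \<tau>) x = u * koszul (\<lambda>\<sigma>. y \<sigma> x) \<tau> + w \<tau> x))" for k
  proof (induction k)
    case 0
    show ?case by (rule exI[of _ "\<lambda>_ _. 0"]) (simp add: homogeneous_def)
  next
    case (Suc k)
    then obtain y where y: "homogeneous s y" and yeq: "\<And>\<tau> x. \<tau> \<subseteq> N \<Longrightarrow> card \<tau> < k \<Longrightarrow> x \<in> Cells \<Longrightarrow> \<tau> \<subseteq> hi x \<Longrightarrow>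
       d (y \<tau>) x = u * koszul (\<lambda>\<sigma>. y \<sigma> x) \<tau> + w \<tau> x"
      by blast
    define F where "F \<tau> x = (if x \<in> Cells \<and> \<tau> \<subseteq> hi x then u * koszul (\<lambda>\<sigma>. y \<sigma> x) \<tau> + w \<tau> x else 0)" for \<tau> x
    have "\<exists>g. (\<forall>x. g x \<noteq> 0 \<longrightarrow> live \<tau> x \<and> dg x = s + 1 - int k - 1) \<and>
        (\<forall>z\<in>Cells. \<tau> \<subseteq> hi z \<longrightarrow> d g z = F \<tau> z)" if \<tau>: "\<tau> \<subseteq> N" "card \<tau> = k" for \<tau>
      unfolding live_def conj_assoc
    proof (rule exact)
      fix x assume nz: "F \<tau> x \<noteq> 0"
      then have "x \<in> Cells" "\<tau> \<subseteq> hi x" "koszul (\<lambda>\<sigma>. y \<sigma> x) \<tau> \<noteq> 0 \<or> w \<tau> x \<noteq> 0"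
        by (auto simp: F_def split: if_splits)
      then have "live \<tau> x \<and> dg x + int (card \<tau>) = s + 1"
        using koszul_live[OF y] homogeneousD[OF w] by blast
      then show "x \<in> Cells \<and> lo x \<subseteq> \<tau> \<and> \<tau> \<subseteq> hi x \<and> dg x = s + 1 - int k"
        using \<tau> by (auto simp: live_def)
    next
      fix z assume z: "z \<in> Cells" "\<tau> \<subseteq> hi z"
      have "d (F \<tau>) z = d (\<lambda>x. u * koszul (\<lambda>\<sigma>. y \<sigma> x) \<tau> + w \<tau> x) z"
        by (rule d_cong) (use z in \<open>auto simp: F_def\<close>)
      also have "\<dots> = u * koszul (\<lambda>\<sigma>. d (y \<sigma>) z) \<tau> + d (w \<tau>) z"
        by (simp add: d_add d_scale d_koszul)
      also have "koszul (\<lambda>\<sigma>. d (y \<sigma>) z) \<tau> = koszul (\<lambda>\<sigma>. u * koszul (\<lambda>\<rho>. y \<rho> z) \<sigma> + w \<sigma> z) \<tau>"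
      proof (rule koszul_cong)
        fix i assume i: "i \<in> \<tau>"
        have "card (\<tau> - {i}) < k" using i \<tau> card_Diff1_less[of \<tau> i] by simp
        then show "d (y (\<tau> - {i})) z = u * koszul (\<lambda>\<rho>. y \<rho> z) (\<tau> - {i}) + w (\<tau> - {i}) z"
          using yeq[of "\<tau> - {i}" z] z \<tau> by auto
      qed
      also have "\<dots> = koszul (\<lambda>\<sigma>. w \<sigma> z) \<tau>"
        by (simp add: koszul_add koszul_scale koszul_koszul_UNIV)
      finally show "d (F \<tau>) z = 0"
        using compat[of \<tau> z] z \<tau> by simp
    qed
    then obtain g where g: "\<And>\<tau> x. \<tau> \<subseteq> N \<Longrightarrow> card \<tau> = k \<Longrightarrow> g \<tau> x \<noteq> 0 \<Longrightarrow> live \<tau> x \<and> dg x = s + 1 - int k - 1"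
      "\<And>\<tau> z. \<tau> \<subseteq> N \<Longrightarrow> card \<tau> = k \<Longrightarrow> z \<in> Cells \<Longrightarrow> \<tau> \<subseteq> hi z \<Longrightarrow> d (g \<tau>) z = F \<tau> z"
      by metis
    define y' where "y' \<tau> = (if \<tau> \<subseteq> N \<and> card \<tau> = k then g \<tau> else y \<tau>)" for \<tau>
    have hom: "homogeneous s y'"
      unfolding homogeneous_def
    proof (intro allI impI)
      fix \<tau> x assume nz: "y' \<tau> x \<noteq> 0"
      show "live \<tau> x \<and> dg x + int (card \<tau>) = s"
      proof (cases "\<tau> \<subseteq> N \<and> card \<tau> = k")
        case True
        then show ?thesis using g(1)[of \<tau> x] nz by (auto simp: y'_def)
      next
        case False
        then have "y' \<tau> = y \<tau>" by (simp only: y'_def if_False)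
        then show ?thesis using homogeneousD[OF y, of \<tau> x] nz by simp
      qed
    qed
    have "d (y' \<tau>) x = u * koszul (\<lambda>\<sigma>. y' \<sigma> x) \<tau> + w \<tau> x"
      if \<tau>: "\<tau> \<subseteq> N" "card \<tau> < Suc k" and x: "x \<in> Cells" "\<tau> \<subseteq> hi x" for \<tau> x
    proof -
      have "card (\<tau> - {i}) < k" if "i \<in> \<tau>" for i
        using card_Diff1_less[of \<tau> i] that \<tau>(2) by simp
      then have "koszul (\<lambda>\<sigma>. y' \<sigma> x) \<tau> = koszul (\<lambda>\<sigma>. y \<sigma> x) \<tau>"
        by (intro koszul_cong) (auto simp: y'_def)
      then show ?thesis
        using yeq[of \<tau> x] g(2)[of \<tau> x] \<tau> x by (cases "card \<tau> = k") (auto simp: y'_def F_def)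
    qed
    then show ?case using hom by blast
  qed
  from this[of "Suc (card N)"] show ?thesis
    by (metis card_mono finite less_Suc_eq_le)
qed

text \<open>
  The mirror image: exact columns allow one to solve by decreasing size of \<open>\<tau>\<close>.  At \<open>\<tau> = N\<close> the
  columns of cells with lower bound \<open>N\<close> are not exact, so \<open>w\<close> has to vanish there, and nothing is
  claimed at the other corner \<open>\<tau> = {}\<close>.
\<close>
lemma solve_downwards:
  assumes w: "homogeneous s w"
    and compat: "\<And>\<tau> x. \<tau> \<subseteq> N \<Longrightarrow> \<tau> \<noteq> {} \<Longrightarrow> x \<in> Cells \<Longrightarrow> \<tau> \<subseteq> hi x \<Longrightarrow> koszul (\<lambda>\<sigma>. w \<sigma> x) \<tau> = u * d (w \<tau>) x"
    and corner: "\<And>x. x \<in> Cells \<Longrightarrow> dg x < 0 \<Longrightarrow> lo x = N \<Longrightarrow> w N x = 0"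
  shows "\<exists>z. homogeneous (s - 1) z \<and> (\<forall>x. z N x = 0) \<and>
    (\<forall>\<tau>\<subseteq>N. \<tau> \<noteq> {} \<longrightarrow> (\<forall>x\<in>Cells. \<tau> \<subseteq> hi x \<longrightarrow> koszul (\<lambda>\<sigma>. z \<sigma> x) \<tau> + u * d (z \<tau>) x = w \<tau> x))"
proof -
  have "\<exists>z. homogeneous (s - 1) z \<and> (\<forall>x. z N x = 0) \<and>
    (\<forall>\<tau>\<subseteq>N. \<tau> \<noteq> {} \<longrightarrow> card N < card \<tau> + k \<longrightarrow> (\<forall>x\<in>Cells. \<tau> \<subseteq> hi x \<longrightarrow> koszul (\<lambda>\<sigma>. z \<sigma> x) \<tau> + u * d (z \<tau>) x = w \<tau> x))" for k
  proof (induction k)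
    case 0
    have "\<not> card N < card \<tau>" if "\<tau> \<subseteq> N" for \<tau> using that card_mono[of N \<tau>] by simp
    then have "homogeneous (s - 1) (\<lambda>_ _. 0) \<and> (\<forall>x. (\<lambda>_ _. 0 :: 'k) N x = 0) \<and>
      (\<forall>\<tau>\<subseteq>N. \<tau> \<noteq> {} \<longrightarrow> \<not> card N < card \<tau>)"
      by (simp add: homogeneous_def)
    then show ?case by (metis add_0_right)
  next
    case (Suc k)
    then obtain z where z: "homogeneous (s - 1) z" and zN: "\<And>x. z N x = 0" and zeq: "\<And>\<tau> x. \<tau> \<subseteq> N \<Longrightarrow> \<tau> \<noteq> {} \<Longrightarrow> card N < card \<tau> + k \<Longrightarrow> x \<in> Cells \<Longrightarrow> \<tau> \<subseteq> hi x \<Longrightarrow>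
       koszul (\<lambda>\<sigma>. z \<sigma> x) \<tau> + u * d (z \<tau>) x = w \<tau> x"
      by metis
    show ?case
    proof (cases "k < card N")
      case False
      have "card N < card \<tau> + k" if "\<tau> \<subseteq> N" "\<tau> \<noteq> {}" for \<tau>
        proof -
        have "0 < card \<tau>" using that card_gt_0_iff[of \<tau>] finite[of \<tau>] by blast
        then show ?thesis using False by simp
      qed
      then show ?thesis using z zN zeq by (intro exI[of _ z]) auto
    next
      case True
      define p where "p = card N - k"
      have p: "0 < p" "p \<le> card N" "\<And>m. card N < m + k \<longleftrightarrow> p < m" "\<And>m. card N < m + Suc k \<longleftrightarrow> p \<le> m"
        using True by (auto simp: p_def)
      define v where "v x \<sigma> = (if x \<in> Cells \<and> \<sigma> \<subseteq> N \<and> \<sigma> \<subseteq> hi x \<and> card \<sigma> = p then w \<sigma> x - u * d (z \<sigma>) x else 0)" for \<sigma> x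
      have v_supp: "live \<sigma> x \<and> dg x + int (card \<sigma>) = s \<and> \<sigma> \<subseteq> N \<and> card \<sigma> = p" if "v x \<sigma> \<noteq> 0" for x \<sigma>
      proof -
        have *: "\<sigma> \<subseteq> hi x" "\<sigma> \<subseteq> N" "card \<sigma> = p" and "w \<sigma> x \<noteq> 0 \<or> d (z \<sigma>) x \<noteq> 0"
          using that by (auto simp: v_def split: if_splits)
        then show ?thesis using homogeneousD[OF w, of \<sigma> x] d_live[OF z, of \<sigma> x] by auto
      qed
      \<comment> \<open>the direction in which the column of \<open>x\<close> is contracted\<close>
      define c where "c x = (SOME i. i \<in> hi x \<inter> N \<and> i \<notin> lo x)" for x
      have c: "c x \<in> hi x \<inter> N" "c x \<notin> lo x" if "lo x \<subset> hi x \<inter> N" for x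
      proof -
        have "\<exists>i. i \<in> hi x \<inter> N \<and> i \<notin> lo x" using that by auto
        then have "c x \<in> hi x \<inter> N \<and> c x \<notin> lo x" unfolding c_def by (rule someI_ex)
        then show "c x \<in> hi x \<inter> N" "c x \<notin> lo x" by auto
      qed
      define h where "h x \<sigma> = (if lo x \<subseteq> \<sigma> \<and> \<sigma> \<subseteq> hi x \<inter> N \<and> c x \<notin> \<sigma>
         then koszul_sign (c x) (insert (c x) \<sigma>) * v x (insert (c x) \<sigma>) else 0)" for \<sigma> x
      define z' where "z' \<sigma> x = (if card \<sigma> + 1 = p then (if lo x \<subset> hi x \<inter> N then h x \<sigma> else 0) else z \<sigma> x)" for \<sigma> x
      have hom: "homogeneous (s - 1) z'"
        unfolding homogeneous_def
      proof (intro allI impI)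
        fix \<sigma> x assume nz: "z' \<sigma> x \<noteq> 0"
        show "live \<sigma> x \<and> dg x + int (card \<sigma>) = s - 1"
        proof (cases "card \<sigma> + 1 = p")
          case True
          then have *: "lo x \<subseteq> \<sigma>" "\<sigma> \<subseteq> hi x" "v x (insert (c x) \<sigma>) \<noteq> 0" "c x \<notin> \<sigma>"
            using nz by (auto simp: z'_def h_def split: if_splits)
          then show ?thesis using v_supp[OF *(3)] by (auto simp: live_def)
        next
          case False
          then show ?thesis using homogeneousD[OF z] nz by (auto simp: z'_def)
        qed
      qed
      have z'N: "z' N x = 0" for x
        using zN p(2) by (simp add: z'_def)
      have z'_same: "z' \<sigma> = z \<sigma>" if "p \<le> card \<sigma>" for \<sigma>
        using that by (simp add: z'_def fun_eq_iff)
      have eq: "koszul (\<lambda>\<sigma>. z' \<sigma> x) \<tau> + u * d (z' \<tau>) x = w \<tau> x"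
        if \<tau>: "\<tau> \<subseteq> N" "\<tau> \<noteq> {}" "p \<le> card \<tau>" and x: "x \<in> Cells" "\<tau> \<subseteq> hi x" for \<tau> x
      proof (cases "p = card \<tau>")
        case False
        then have "p < card \<tau>" using \<tau> by simp
        moreover have "p \<le> card (\<tau> - {i})" if "i \<in> \<tau>" for i
          using that False \<tau> by (simp add: card_Diff_singleton)
        then have "koszul (\<lambda>\<sigma>. z' \<sigma> x) \<tau> = koszul (\<lambda>\<sigma>. z \<sigma> x) \<tau>"
          by (intro koszul_cong) (simp add: z'_same)
        moreover have "koszul (\<lambda>\<sigma>. z \<sigma> x) \<tau> + u * d (z \<tau>) x = w \<tau> x"
          by (rule zeq; use \<tau> x \<open>p < card \<tau>\<close> p(3)[of "card \<tau>"] in blast)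
        ultimately show ?thesis using \<tau> by (simp add: z'_same)
      next
        case card: True
        have card1: "card (\<tau> - {i}) + 1 = p" if "i \<in> \<tau>" for i
          using that card by (metis Suc_eq_plus1 card_Suc_Diff1 finite)
        have dz: "d (z' \<tau>) x = d (z \<tau>) x" using card by (simp add: z'_same)
        show ?thesis
        proof (cases "lo x \<subseteq> \<tau>")
          case False
          then have "koszul (\<lambda>\<sigma>. z' \<sigma> x) \<tau> = 0" "w \<tau> x = 0" "d (z' \<tau>) x = 0"
            using koszul_live[OF hom, of x \<tau>] d_live[OF hom, of \<tau> x] homogeneousD[OF w, of \<tau> x] x
            by (auto simp: live_def)
          then show ?thesis by simp
        next
          case lob: True
          show ?thesis
          proof (cases "lo x \<subset> hi x \<inter> N")
            case True
            have "koszul (\<lambda>\<sigma>. z' \<sigma> x) \<tau> = koszul (h x) \<tau>"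
              by (rule koszul_cong) (use card1 True in \<open>simp add: z'_def\<close>)
            also have "\<dots> = v x \<tau>"
              unfolding h_def
            proof (rule koszul_contraction)
              show "finite \<tau>" "c x \<notin> lo x" "c x \<in> hi x \<inter> N" "lo x \<subseteq> \<tau>" "\<tau> \<subseteq> hi x \<inter> N"
                using c[OF True] lob x \<tau> by auto
              show "lo x \<subseteq> \<sigma> \<and> \<sigma> \<subseteq> hi x \<inter> N" if "v x \<sigma> \<noteq> 0" for \<sigma>
                using v_supp[OF that] by (auto simp: live_def)
              assume out: "c x \<notin> \<tau>"
              let ?T = "insert (c x) \<tau>"
              have T: "?T \<subseteq> N" "?T \<subseteq> hi x" "?T \<noteq> {}" "card ?T = Suc p"
                using c[OF True] \<tau> x out card by auto
              have cT: "card (?T - {i}) = p" if "i \<in> ?T" for i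
                using that T(4) by (metis card_Diff_singleton diff_Suc_1)
              have "koszul (v x) ?T = koszul (\<lambda>\<sigma>. w \<sigma> x - u * d (z \<sigma>) x) ?T"
                by (rule koszul_cong) (use T cT x in \<open>auto simp: v_def\<close>)
              also have "\<dots> = u * d (w ?T) x - u * d (\<lambda>y. koszul (\<lambda>\<sigma>. z \<sigma> y) ?T) x"
                using compat[of ?T x] T x by (simp add: koszul_diff koszul_scale d_koszul)
              also have "d (w ?T) x = d (\<lambda>y. koszul (\<lambda>\<sigma>. z \<sigma> y) ?T + u * d (z ?T) y) x"
                by (intro d_cong zeq[symmetric]; use T p(3)[of "Suc p"] in force)
              also have "\<dots> = d (\<lambda>y. koszul (\<lambda>\<sigma>. z \<sigma> y) ?T) x"
                using d_square_homogeneous[OF z] T x by (simp add: d_add d_scale)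
              finally show "koszul (v x) ?T = 0" by simp
            qed
            also have "\<dots> = w \<tau> x - u * d (z \<tau>) x" using \<tau> x card by (simp add: v_def)
            finally show ?thesis using dz by simp
          next
            case False
            \<comment> \<open>The column is a single point; since \<open>\<tau> \<noteq> {}\<close> it is the corner \<open>\<tau> = N\<close>.\<close>
            then have tb: "\<tau> = lo x" "hi x \<inter> N = lo x" using lob x \<tau> by auto
            have neg: "dg x < 0" using lo_nonneg[OF x(1)] tb \<tau> by force
            then have N: "lo x = N" using hi_neg[OF x(1)] tb by auto
            have "d (z \<tau>) x = 0"
            proof -
              have "z \<tau> = (\<lambda>_. 0)" using zN tb N by (simp add: fun_eq_iff)
              then show ?thesis by simp
            qed
            moreover have "koszul (\<lambda>\<sigma>. z' \<sigma> x) \<tau> = 0"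
              by (rule koszul_eq_0) (use card1 False in \<open>auto simp: z'_def\<close>)
            ultimately show ?thesis using dz corner[OF x(1) neg N] N tb by simp
          qed
        qed
      qed
      show ?thesis
      proof (intro exI[of _ z'] conjI allI impI ballI)
        fix \<tau> x assume "\<tau> \<subseteq> N" "\<tau> \<noteq> {}" "card N < card \<tau> + Suc k" "x \<in> Cells" "\<tau> \<subseteq> hi x"
        then show "koszul (\<lambda>\<sigma>. z' \<sigma> x) \<tau> + u * d (z' \<tau>) x = w \<tau> x"
          by (intro eq; use p(4)[of "card \<tau>"] in blast)
      qed (rule hom z'N)+
    qed
  qed
  from this[of "Suc (card N)"] show ?thesis
    by (auto simp: less_Suc_eq_le)
qed

text \<open>
  The cochains at the corner \<open>\<tau> = {}\<close>: their cells are those whose column over the subsets of \<open>N\<close>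
  is the single point \<open>{}\<close>.
\<close>
definition cocycle :: "'n set \<Rightarrow> nat \<Rightarrow> ('x \<Rightarrow> 'k) \<Rightarrow> bool" where
  "cocycle N r c \<longleftrightarrow> (\<forall>x. c x \<noteq> 0 \<longrightarrow> x \<in> Cells \<and> dg x = int r \<and> N \<inter> hi x = {}) \<and> (\<forall>x\<in>Cells. d c x = 0)"

text \<open>
  A staircase starts at the cochain \<open>c\<close> and ends in its values at \<open>\<tau> = N\<close> on the cells with lower
  bound \<open>N\<close>.  These corner values are the image of \<open>c\<close> under the identification of the cohomologies
  of the two corners.
\<close>
definition staircase :: "'n set \<Rightarrow> nat \<Rightarrow> ('x \<Rightarrow> 'k) \<Rightarrow> ('n set \<Rightarrow> 'x \<Rightarrow> 'k) \<Rightarrow> bool" where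
  "staircase N r c y \<longleftrightarrow> homogeneous (int r - 1) y \<and> (\<forall>\<tau>\<subseteq>N. \<forall>x\<in>Cells. \<tau> \<subseteq> hi x \<longrightarrow>
     d (y \<tau>) x = koszul (\<lambda>\<sigma>. y \<sigma> x) \<tau> + (if \<tau> = {} then c x else 0))"

lemma staircaseD:
  "staircase N r c y \<Longrightarrow> \<tau> \<subseteq> N \<Longrightarrow> x \<in> Cells \<Longrightarrow> \<tau> \<subseteq> hi x \<Longrightarrow>
     d (y \<tau>) x = koszul (\<lambda>\<sigma>. y \<sigma> x) \<tau> + (if \<tau> = {} then c x else 0)"
  by (simp add: staircase_def)

text \<open>
  A cochain of the corner, placed at \<open>\<tau> = {}\<close>, is closed for the Koszul differential because no
  \<open>i \<in> N\<close> can be added to \<open>{}\<close> within its column.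
\<close>
lemma koszul_at_empty:
  assumes "\<And>i. i \<in> N \<Longrightarrow> i \<in> hi x \<Longrightarrow> c = 0" "\<tau> \<subseteq> N" "\<tau> \<subseteq> hi x"
  shows "koszul (\<lambda>\<sigma>. if \<sigma> = {} then c else 0) \<tau> = (0 :: 'k)"
proof (rule koszul_eq_0)
  fix i assume "i \<in> \<tau>"
  then show "(if \<tau> - {i} = {} then c else 0) = 0" using assms by auto
qed

lemma staircase_exists:
  assumes "cocycle N r c"
  shows "\<exists>y. staircase N r c y"
proof -
  let ?w = "\<lambda>\<tau> x. if \<tau> = {} then c x else 0"
  have supp: "x \<in> Cells \<and> dg x = int r \<and> N \<inter> hi x = {}" if "c x \<noteq> 0" for x
    using assms that by (auto simp: cocycle_def)
  have hom: "homogeneous (int r - 1 + 1) ?w"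
    using supp lo_nonneg by (auto simp: homogeneous_def live_def)
  have "\<exists>y. homogeneous (int r - 1) y \<and> (\<forall>\<tau>\<subseteq>N. \<forall>x\<in>Cells. \<tau> \<subseteq> hi x \<longrightarrow>
    d (y \<tau>) x = 1 * koszul (\<lambda>\<sigma>. y \<sigma> x) \<tau> + ?w \<tau> x)"
  proof (rule solve_upwards[OF hom])
    fix \<tau> x assume \<tau>: "\<tau> \<subseteq> N" "x \<in> Cells" "\<tau> \<subseteq> hi x"
    have "koszul (\<lambda>\<sigma>. ?w \<sigma> x) \<tau> = 0"
      by (rule koszul_at_empty[of N x]) (use \<tau> supp[of x] in auto)
    moreover have "d (?w \<tau>) x = 0"
      using assms \<tau> by (cases "\<tau> = {}") (auto simp: cocycle_def)
    ultimately show "d (?w \<tau>) x = - 1 * koszul (\<lambda>\<sigma>. ?w \<sigma> x) \<tau>" by simp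
  qed
  then show ?thesis by (simp add: staircase_def)
qed

text \<open>
  The corner values are well defined: subtracting the cochain \<open>e\<close> makes the staircase a cocycle of
  the total complex.  A primitive of it exists because the rows are exact, and neither of the two
  differentials of the primitive reaches a cell with lower bound \<open>N\<close> at \<open>\<tau> = N\<close>.
\<close>
lemma staircase_coboundary:
  assumes y: "staircase N r c y"
    and e: "\<And>x. e x \<noteq> 0 \<Longrightarrow> x \<in> Cells \<and> 0 \<le> dg x \<and> dg x = int r - 1 \<and> N \<inter> hi x = {}"
    and c: "\<And>x. x \<in> Cells \<Longrightarrow> d e x = c x"
    and b: "b \<in> Cells" "dg b < 0" "lo b = N"
  shows "y N b = 0"
proof -
  let ?w = "\<lambda>\<tau> x. y \<tau> x - (if \<tau> = {} then e x else 0)"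
  have hom: "homogeneous (int r - 2 + 1) ?w"
    unfolding homogeneous_def
  proof (intro allI impI)
    fix \<tau> x assume "?w \<tau> x \<noteq> 0"
    then have "y \<tau> x \<noteq> 0 \<or> (\<tau> = {} \<and> e x \<noteq> 0)" by (auto split: if_splits)
    then show "live \<tau> x \<and> dg x + int (card \<tau>) = int r - 2 + 1"
      using homogeneousD[of "int r - 1" y \<tau> x] y e[of x] lo_nonneg[of x] by (auto simp: staircase_def live_def)
  qed
  have dw: "d (?w \<tau>) x = d (y \<tau>) x - (if \<tau> = {} then d e x else 0)" for \<tau> x
    by (cases "\<tau> = {}") (simp_all add: d_diff)
  have "\<exists>z. homogeneous (int r - 2) z \<and> (\<forall>\<tau>\<subseteq>N. \<forall>x\<in>Cells. \<tau> \<subseteq> hi x \<longrightarrow>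
    d (z \<tau>) x = - 1 * koszul (\<lambda>\<sigma>. z \<sigma> x) \<tau> + ?w \<tau> x)"
  proof (rule solve_upwards[OF hom])
    fix \<tau> x assume \<tau>: "\<tau> \<subseteq> N" "x \<in> Cells" "\<tau> \<subseteq> hi x"
    have "koszul (\<lambda>\<sigma>. if \<sigma> = {} then e x else 0) \<tau> = 0"
      by (rule koszul_at_empty[of N x]) (use \<tau> e[of x] in auto)
    then show "d (?w \<tau>) x = - (- 1) * koszul (\<lambda>\<sigma>. ?w \<sigma> x) \<tau>"
      using staircaseD[OF y \<tau>] c[OF \<tau>(2)] by (simp add: dw koszul_diff)
  qed
  then obtain z where z: "homogeneous (int r - 2) z"
    "\<And>\<tau> x. \<tau> \<subseteq> N \<Longrightarrow> x \<in> Cells \<Longrightarrow> \<tau> \<subseteq> hi x \<Longrightarrow> d (z \<tau>) x = - 1 * koszul (\<lambda>\<sigma>. z \<sigma> x) \<tau> + ?w \<tau> x"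
    by metis
  have "koszul (\<lambda>\<sigma>. z \<sigma> b) N = 0"
  proof (rule koszul_eq_0, rule ccontr)
    fix i assume "i \<in> N" "z (N - {i}) b \<noteq> 0"
    then show False using homogeneousD[OF z(1), of "N - {i}" b] b by (auto simp: live_def)
  qed
  moreover have "d (z N) b = 0"
  proof (rule ccontr)
    assume "d (z N) b \<noteq> 0"
    from d_local[OF this] obtain x where "z N x \<noteq> 0" "lo b \<subseteq> lo x" "lo b \<noteq> lo x"
      using b by auto
    then show False using homogeneousD[OF z(1), of N x] b by (auto simp: live_def)
  qed
  moreover have "e b = 0" using e[of b] b by auto
  ultimately show ?thesis using z(2)[of N b] b hi_neg[of b] by auto
qed

text \<open>
  Injectivity.  If the corner values vanish, the columns allow one to write the staircase as a
  total boundary away from \<open>\<tau> = {}\<close>; what is left at \<open>{}\<close> is a cochain \<open>e\<close> of the corner with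
  \<open>d e = c\<close>.
\<close>
lemma coboundary_if_corner_vanishes:
  assumes y: "staircase N r c y"
    and corner: "\<And>b. b \<in> Cells \<Longrightarrow> dg b < 0 \<Longrightarrow> lo b = N \<Longrightarrow> y N b = 0"
  shows "\<exists>e. (\<forall>x. e x \<noteq> 0 \<longrightarrow> x \<in> Cells \<and> 0 \<le> dg x \<and> dg x = int r - 1 \<and> N \<inter> hi x = {}) \<and>
    (\<forall>x\<in>Cells. d e x = c x)"
proof -
  have hom: "homogeneous (int r - 1) y" using y by (simp add: staircase_def)
  have "\<exists>z. homogeneous (int r - 1 - 1) z \<and> (\<forall>x. z N x = 0) \<and>
    (\<forall>\<tau>\<subseteq>N. \<tau> \<noteq> {} \<longrightarrow> (\<forall>x\<in>Cells. \<tau> \<subseteq> hi x \<longrightarrow> koszul (\<lambda>\<sigma>. z \<sigma> x) \<tau> + 1 * d (z \<tau>) x = y \<tau> x))"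
    by (rule solve_downwards[OF hom]) (use staircaseD[OF y] corner in simp_all)
  then obtain z where z: "homogeneous (int r - 2) z"
    and zeq: "\<And>\<tau> x. \<tau> \<subseteq> N \<Longrightarrow> \<tau> \<noteq> {} \<Longrightarrow> x \<in> Cells \<Longrightarrow> \<tau> \<subseteq> hi x \<Longrightarrow> koszul (\<lambda>\<sigma>. z \<sigma> x) \<tau> + d (z \<tau>) x = y \<tau> x"
    by auto
  define e where "e x = (if x \<in> Cells then y {} x - d (z {}) x else 0)" for x
  have de: "d e x = c x" if x: "x \<in> Cells" for x
  proof -
    have "d e x = d (\<lambda>x. y {} x - d (z {}) x) x"
      by (rule d_cong) (simp add: e_def)
    then show ?thesis
      using staircaseD[OF y _ x, of "{}"] d_square_homogeneous[OF z x, of "{}"] by (simp add: d_diff)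
  qed
  have supp: "x \<in> Cells \<and> live {} x \<and> dg x = int r - 1" if "e x \<noteq> 0" for x
  proof -
    have "x \<in> Cells" "y {} x \<noteq> 0 \<or> d (z {}) x \<noteq> 0"
      using that by (auto simp: e_def split: if_splits)
    then show ?thesis
      using homogeneousD[OF hom, of "{}" x] d_live[OF z, of "{}" x] by auto
  qed
  have empty: "N \<inter> hi x = {}" if nz: "e x \<noteq> 0" for x
  proof (rule ccontr)
    assume "N \<inter> hi x \<noteq> {}"
    then obtain i where i: "{i} \<subseteq> N" "{i} \<subseteq> hi x" by auto
    have x: "x \<in> Cells" using supp nz by auto
    have "koszul (\<lambda>\<sigma>. y \<sigma> x) {i} = d (y {i}) x"
      using staircaseD[OF y i(1) x i(2)] by simp
    also have "\<dots> = d (\<lambda>x. koszul (\<lambda>\<sigma>. z \<sigma> x) {i} + d (z {i}) x) x"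
      by (rule d_cong, rule zeq[symmetric]) (use i in auto)
    also have "\<dots> = koszul (\<lambda>\<sigma>. d (z \<sigma>) x) {i}"
      using d_square_homogeneous[OF z x i(2)] by (simp only: d_add d_koszul add_0_right)
    finally have "koszul_sign i {i} * (koszul_sign i {i} * y {} x) = koszul_sign i {i} * (koszul_sign i {i} * d (z {}) x)"
      by (simp only: koszul_singleton)
    then have "y {} x = d (z {}) x" by (simp only: koszul_sign_square_left)
    then show False using nz by (simp add: e_def split: if_splits)
  qed
  have nonneg: "0 \<le> dg x" if nz: "e x \<noteq> 0" for x
  proof (rule ccontr)
    assume neg: "\<not> 0 \<le> dg x"
    have x: "x \<in> Cells" "lo x = {}" using supp[OF nz] by (auto simp: live_def)
    have N: "N = {}" using empty[OF nz] hi_neg[OF x(1)] neg by auto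
    have "y {} x = 0" using corner[of x] x neg N by simp
    moreover have "d (z {}) x = 0"
    proof (rule ccontr)
      assume "d (z {}) x \<noteq> 0"
      from d_local[OF this] obtain x' where "z {} x' \<noteq> 0" "lo x \<noteq> lo x'" using neg by auto
      then show False using homogeneousD[OF z, of "{}" x'] x by (auto simp: live_def)
    qed
    ultimately show False using nz by (simp add: e_def split: if_splits)
  qed
  show ?thesis
    by (rule exI[of _ e]) (use de supp empty nonneg in blast)
qed

text \<open>
  Surjectivity: a staircase can be built backwards from prescribed corner values \<open>t\<close>, and its row
  differential at \<open>\<tau> = {}\<close> is the cochain it starts from.
\<close>
lemma corner_surjective:
  assumes t: "\<And>x. t x \<noteq> 0 \<Longrightarrow> x \<in> Cells \<and> dg x < 0 \<and> lo x = N \<and> dg x + int (card N) = int r - 1"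
  shows "\<exists>c y. cocycle N r c \<and> staircase N r c y \<and> (\<forall>x. y N x = t x)"
proof -
  define w where "w \<tau> x = (if \<tau> = N \<and> x \<in> Cells \<and> N \<subseteq> hi x then d t x else 0)" for \<tau> x
  have tN: "homogeneous (int r - 1) (\<lambda>\<tau> x. if \<tau> = N then t x else 0)"
    using t hi_neg by (auto simp: homogeneous_def live_def)
  have hom: "homogeneous (int r) w"
    unfolding homogeneous_def
  proof (intro allI impI)
    fix \<tau> x assume "w \<tau> x \<noteq> 0"
    then have "\<tau> = N" "N \<subseteq> hi x" "d t x \<noteq> 0" by (auto simp: w_def split: if_splits)
    then show "live \<tau> x \<and> dg x + int (card \<tau>) = int r"
      using d_live[OF tN, of N x] by simp
  qed
  have dw: "d (w N) x = 0" if "x \<in> Cells" "N \<subseteq> hi x" for x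
  proof -
    have "d (w N) x = d (d t) x" by (rule d_cong) (use that in \<open>auto simp: w_def\<close>)
    also have "\<dots> = 0" using d_square_homogeneous[OF tN that] by simp
    finally show ?thesis .
  qed
  have "\<exists>z. homogeneous (int r - 1) z \<and> (\<forall>x. z N x = 0) \<and>
    (\<forall>\<tau>\<subseteq>N. \<tau> \<noteq> {} \<longrightarrow> (\<forall>x\<in>Cells. \<tau> \<subseteq> hi x \<longrightarrow> koszul (\<lambda>\<sigma>. z \<sigma> x) \<tau> + - 1 * d (z \<tau>) x = w \<tau> x))"
  proof (rule solve_downwards[OF hom])
    fix \<tau> x assume \<tau>: "\<tau> \<subseteq> N" "\<tau> \<noteq> {}" "x \<in> Cells" "\<tau> \<subseteq> hi x"
    have "koszul (\<lambda>\<sigma>. w \<sigma> x) \<tau> = 0"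
      by (rule koszul_eq_0) (use \<tau> in \<open>auto simp: w_def\<close>)
    moreover have "d (w \<tau>) x = 0"
    proof (cases "\<tau> = N")
      case True
      then show ?thesis using dw \<tau> by simp
    next
      case False
      then have "w \<tau> = (\<lambda>_. 0)" by (simp add: w_def fun_eq_iff)
      then show ?thesis by simp
    qed
    ultimately show "koszul (\<lambda>\<sigma>. w \<sigma> x) \<tau> = - 1 * d (w \<tau>) x" by simp
  next
    fix x assume x: "x \<in> Cells" "dg x < 0" "lo x = N"
    have "d t x = 0"
    proof (rule ccontr)
      assume "d t x \<noteq> 0"
      from d_local[OF this] obtain x' where "t x' \<noteq> 0" "lo x \<noteq> lo x'" using x by auto
      then show False using t x by auto
    qed
    then show "w N x = 0" by (simp add: w_def)
  qed
  then obtain z where z: "homogeneous (int r - 1) z" and zN: "\<And>x. z N x = 0"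
    and zeq: "\<And>\<tau> x. \<tau> \<subseteq> N \<Longrightarrow> \<tau> \<noteq> {} \<Longrightarrow> x \<in> Cells \<Longrightarrow> \<tau> \<subseteq> hi x \<Longrightarrow> koszul (\<lambda>\<sigma>. z \<sigma> x) \<tau> + - 1 * d (z \<tau>) x = w \<tau> x"
    by metis
  define y where "y \<tau> x = (if \<tau> = N then t x else z \<tau> x)" for \<tau> x
  have y: "homogeneous (int r - 1) y"
    using tN z by (auto simp: homogeneous_def y_def)
  have yeq: "d (y \<tau>) x = koszul (\<lambda>\<sigma>. y \<sigma> x) \<tau>" if \<tau>: "\<tau> \<subseteq> N" "\<tau> \<noteq> {}" "x \<in> Cells" "\<tau> \<subseteq> hi x" for \<tau> x
  proof -
    have "koszul (\<lambda>\<sigma>. y \<sigma> x) \<tau> = koszul (\<lambda>\<sigma>. z \<sigma> x) \<tau>"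
      by (rule koszul_cong) (use \<tau> in \<open>auto simp: y_def\<close>)
    also have "\<dots> = d (z \<tau>) x + w \<tau> x" using zeq[OF \<tau>] by (simp add: algebra_simps)
    also have "\<dots> = d (y \<tau>) x"
    proof (cases "\<tau> = N")
      case True
      have "z N = (\<lambda>_. 0)" "y N = t" using zN by (simp_all add: y_def fun_eq_iff)
      then show ?thesis using True \<tau> by (simp add: w_def)
    next
      case False
      then have "y \<tau> = z \<tau>" by (simp add: y_def fun_eq_iff)
      then show ?thesis using False by (simp add: w_def)
    qed
    finally show ?thesis by simp
  qed
  define c where "c x = (if x \<in> Cells then d (y {}) x else 0)" for x
  have "staircase N r c y"
    unfolding staircase_def using y yeq by (auto simp: c_def)
  moreover have "cocycle N r c"
    unfolding cocycle_def
  proof (intro conjI allI impI ballI)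
    fix x assume nz: "c x \<noteq> 0"
    then have x: "x \<in> Cells" and dnz: "d (y {}) x \<noteq> 0" by (auto simp: c_def split: if_splits)
    show "x \<in> Cells" by fact
    show "dg x = int r" using d_live[OF y dnz] by simp
    show "N \<inter> hi x = {}"
    proof (rule ccontr)
      assume "N \<inter> hi x \<noteq> {}"
      then obtain i where i: "{i} \<subseteq> N" "{i} \<subseteq> hi x" by auto
      have "koszul (\<lambda>\<sigma>. d (y \<sigma>) x) {i} = d (\<lambda>x. koszul (\<lambda>\<sigma>. y \<sigma> x) {i}) x"
        by (simp only: d_koszul)
      also have "\<dots> = d (d (y {i})) x"
        by (rule d_cong, rule yeq[symmetric]) (use i in auto)
      also have "\<dots> = 0" by (rule d_square_homogeneous[OF y x i(2)])
      finally have "koszul_sign i {i} * (koszul_sign i {i} * d (y {}) x) = 0"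
        by (simp only: koszul_singleton mult_zero_right)
      then show False using dnz by (simp only: koszul_sign_square_left)
    qed
  next
    fix x assume x: "x \<in> Cells"
    have "d c x = d (d (y {})) x" by (rule d_cong) (simp add: c_def)
    then show "d c x = 0" using d_square_homogeneous[OF y x, of "{}"] by simp
  qed
  ultimately show ?thesis by (metis y_def)
qed

lemma staircase_restrict:
  assumes "staircase N r c y" "N' \<subseteq> N"
  shows "staircase N' r c y"
  using assms by (auto simp: staircase_def)

lemma staircase_diff:
  assumes "staircase N r c y" "staircase N r c' y'"
  shows "staircase N r (\<lambda>x. c x - c' x) (\<lambda>\<tau> x. y \<tau> x - y' \<tau> x)"
proof -
  have "homogeneous (int r - 1) (\<lambda>\<tau> x. y \<tau> x - y' \<tau> x)"
    using assms unfolding staircase_def homogeneous_def by (metis diff_0_right)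
  then show ?thesis
    using assms by (simp add: staircase_def d_diff koszul_diff)
qed

lemma staircase_add:
  assumes "staircase N r c y" "staircase N r c' y'"
  shows "staircase N r (\<lambda>x. c x + c' x) (\<lambda>\<tau> x. y \<tau> x + y' \<tau> x)"
proof -
  have "homogeneous (int r - 1) (\<lambda>\<tau> x. y \<tau> x + y' \<tau> x)"
    using assms unfolding staircase_def homogeneous_def by (metis add_0_right)
  then show ?thesis
    using assms by (simp add: staircase_def d_add koszul_add)
qed

lemma staircase_scale:
  assumes "staircase N r c y"
  shows "staircase N r (\<lambda>x. a * c x) (\<lambda>\<tau> x. a * y \<tau> x)"
  using assms by (simp add: staircase_def d_scale koszul_scale homogeneous_def distrib_left)

lemma corner_unique:
  assumes "staircase N r c y" "staircase N r c y'" "b \<in> Cells" "dg b < 0" "lo b = N"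
  shows "y N b = y' N b"
  using staircase_coboundary[OF staircase_diff[OF assms(1,2)], of "\<lambda>_. 0" b] assms by simp

end

section \<open>Monomial ideals and Alexander duality\<close>
lemma lookup_mult_single_shift:
  fixes p :: "'a::cancel_comm_monoid_add \<Rightarrow>\<^sub>0 'k::comm_semiring_0"
  shows "Poly_Mapping.lookup (p * Poly_Mapping.single e c) (q + e) = Poly_Mapping.lookup p q * c"
proof -
  have "Poly_Mapping.lookup (Poly_Mapping.single e c * p) (e + q)
      = (\<Sum>l. (c when e = l) * (\<Sum>q'. Poly_Mapping.lookup p q' when e + q = l + q'))"
    by (simp add: lookup_mult lookup_single)
  also have "\<dots> = (\<Sum>l\<in>{e}. (c when e = l) * (\<Sum>q'. Poly_Mapping.lookup p q' when e + q = l + q'))"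
    by (rule Sum_any.expand_superset) (auto simp: when_def split: if_splits)
  also have "\<dots> = c * Poly_Mapping.lookup p q" by simp
  finally show ?thesis by (simp add: ac_simps)
qed

lemma lookup_single_mult_le:
  fixes p :: "('n::finite, 'k::field) mpoly"
  assumes "e \<le> a"
  shows "Poly_Mapping.lookup (p * Poly_Mapping.single e c) a = Poly_Mapping.lookup p (a - e) * c"
proof -
  have "a - e + e = a" using assms by (auto simp: fun_eq_iff le_fun_def)
  then show ?thesis using lookup_mult_single_shift[of p e c "a - e"] by simp
qed

lemma lookup_single_mult_not_le:
  fixes p :: "('n::finite, 'k::field) mpoly"
  assumes "\<not> e \<le> a"
  shows "Poly_Mapping.lookup (p * Poly_Mapping.single e c) a = 0"
proof -
  have "a \<noteq> b + e" for b using assms by (auto simp: le_fun_def)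
  then show ?thesis
    using keys_mult[of p "Poly_Mapping.single e c"] by (force simp: in_keys_iff lookup_single split: if_splits)
qed

definition monomial_multiples :: "('n \<Rightarrow> nat) set \<Rightarrow> ('n, 'k::field) mpoly set" where
  "monomial_multiples E = {p. \<forall>a\<in>Poly_Mapping.keys p. \<exists>e\<in>E. e \<le> a}"

lemma mpoly_ring_simps [simp]:
  "carrier mpoly_ring = UNIV" "\<zero>\<^bsub>mpoly_ring\<^esub> = 0" "x \<oplus>\<^bsub>mpoly_ring\<^esub> y = x + y"
  "x \<otimes>\<^bsub>mpoly_ring\<^esub> y = x * y" "\<one>\<^bsub>mpoly_ring\<^esub> = 1"
  by (simp_all add: ring_of_type_algebra_def)

lemma ideal_monomial_multiples:
  "ideal (monomial_multiples E :: ('n, 'k::field) mpoly set) mpoly_ring"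
proof (rule idealI)
  show "ring (mpoly_ring :: ('n, 'k) mpoly ring)" by (rule ring_from_type_algebra)
  show "subgroup (monomial_multiples E) (add_monoid (mpoly_ring :: ('n, 'k) mpoly ring))"
  proof (rule group.subgroupI)
    show "Group.group (add_monoid (mpoly_ring :: ('n, 'k) mpoly ring))"
      using abelian_group.a_group ring.is_abelian_group ring_from_type_algebra by blast
    show "monomial_multiples E \<subseteq> carrier (add_monoid (mpoly_ring :: ('n, 'k) mpoly ring))" by simp
    show "monomial_multiples E \<noteq> ({} :: ('n, 'k) mpoly set)"
      by (auto simp: monomial_multiples_def intro: exI[of _ 0])
  next
    fix p :: "('n, 'k) mpoly" assume p: "p \<in> monomial_multiples E"
    have "Group.group (add_monoid (mpoly_ring :: ('n, 'k) mpoly ring))"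
      using abelian_group.a_group ring.is_abelian_group ring_from_type_algebra by blast
    then have "inv\<^bsub>add_monoid mpoly_ring\<^esub> p = - p"
      by (rule group.inv_equality) simp_all
    then show "inv\<^bsub>add_monoid mpoly_ring\<^esub> p \<in> monomial_multiples E"
      using p by (simp add: monomial_multiples_def in_keys_iff)
  next
    fix p q :: "('n, 'k) mpoly" assume "p \<in> monomial_multiples E" "q \<in> monomial_multiples E"
    then show "p \<otimes>\<^bsub>add_monoid mpoly_ring\<^esub> q \<in> monomial_multiples E"
      using keys_add[of p q] by (auto simp: monomial_multiples_def)
  qed
next
  fix a x :: "('n, 'k) mpoly" assume a: "a \<in> monomial_multiples E"
  have *: "x * a \<in> monomial_multiples E"
    unfolding monomial_multiples_def
  proof safe
    fix c assume "c \<in> Poly_Mapping.keys (x * a)"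
    then obtain u v where uv: "c = u + v" "v \<in> Poly_Mapping.keys a" using keys_mult[of x a] by auto
    then obtain e where "e \<in> E" "e \<le> v" using a by (auto simp: monomial_multiples_def)
    then show "\<exists>e\<in>E. e \<le> c" using uv by (auto simp: le_fun_def intro!: bexI[of _ e] trans_le_add2)
  qed
  then show "x \<otimes>\<^bsub>mpoly_ring\<^esub> a \<in> monomial_multiples E" by simp
  show "a \<otimes>\<^bsub>mpoly_ring\<^esub> x \<in> monomial_multiples E" using * by (simp add: mult.commute)
qed

lemma poly_mapping_sum_single: "(\<Sum>a\<in>Poly_Mapping.keys p. Poly_Mapping.single a (Poly_Mapping.lookup p a)) = p"
  by (rule poly_mapping_eqI) (simp add: lookup_sum lookup_single when_def in_keys_iff sum.delta)

lemma genideal_monomials: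
  fixes E :: "('n::finite \<Rightarrow> nat) set"
  shows "Idl\<^bsub>mpoly_ring\<^esub> (xpow ` E) = (monomial_multiples E :: ('n, 'k::field) mpoly set)"
proof
  show "Idl\<^bsub>mpoly_ring\<^esub> (xpow ` E) \<subseteq> (monomial_multiples E :: ('n, 'k) mpoly set)"
  proof -
    have "xpow ` E \<subseteq> (monomial_multiples E :: ('n, 'k) mpoly set)"
      by (auto simp: monomial_multiples_def xpow_def)
    then show ?thesis
      using ideal_monomial_multiples[of E, where 'k = 'k] unfolding genideal_def by blast
  qed
  show "(monomial_multiples E :: ('n, 'k) mpoly set) \<subseteq> Idl\<^bsub>mpoly_ring\<^esub> (xpow ` E)"
    unfolding genideal_def
  proof safe
    fix p :: "('n, 'k) mpoly" and J :: "('n, 'k) mpoly set"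
    assume p: "p \<in> monomial_multiples E" and J: "ideal J mpoly_ring" "xpow ` E \<subseteq> J"
    interpret ideal J mpoly_ring by fact
    have "Poly_Mapping.single a c \<in> J" if a: "a \<in> Poly_Mapping.keys p" for a c
    proof -
      obtain e where e: "e \<in> E" "e \<le> a" using p a by (auto simp: monomial_multiples_def)
      have "a - e + e = a" using e by (auto simp: fun_eq_iff le_fun_def)
      then have "Poly_Mapping.single a c = Poly_Mapping.single (a - e) c * (xpow e :: ('n, 'k) mpoly)"
        by (simp add: xpow_def mult_single)
      then show ?thesis using I_l_closed[of "xpow e" "Poly_Mapping.single (a - e) c"] e J by auto
    qed
    moreover have "sum f A \<in> J" if "finite A" "\<And>a. a \<in> A \<Longrightarrow> f a \<in> J" for A and f :: "('n \<Rightarrow> nat) \<Rightarrow> ('n, 'k) mpoly"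
      using that by (induction A rule: finite_induct)
        (use additive_subgroup.zero_closed[OF is_additive_subgroup] additive_subgroup.a_closed[OF is_additive_subgroup] in simp_all)
    ultimately have "(\<Sum>a\<in>Poly_Mapping.keys p. Poly_Mapping.single a (Poly_Mapping.lookup p a)) \<in> J"
      by simp
    then show "p \<in> J" by (simp only: poly_mapping_sum_single)
  qed
qed

definition support :: "('n \<Rightarrow> nat) \<Rightarrow> 'n set" where "support a = {i. 0 < a i}"

definition indicator_deg :: "'n set \<Rightarrow> 'n deg" where
  "indicator_deg N = (\<lambda>i. if i \<in> N then 1 else 0)"

definition face :: "'n deg \<Rightarrow> 'n set" where "face \<alpha> = {i. \<alpha> i \<noteq> 0}"

lemma face_indicator [simp]: "face (indicator_deg N) = N"
  by (auto simp: face_def indicator_deg_def)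

lemma indicator_face: "\<alpha> \<in> cube \<Longrightarrow> indicator_deg (face \<alpha>) = \<alpha>"
  by (auto simp: face_def indicator_deg_def cube_def fun_eq_iff) 

lemma indicator_in_cube [simp]: "indicator_deg N \<in> cube"
  by (auto simp: indicator_deg_def cube_def)

lemma cube_xpow_le_iff: "\<alpha> \<in> cube \<Longrightarrow> (\<lambda>i. nat (\<alpha> i)) \<le> a \<longleftrightarrow> face \<alpha> \<subseteq> support a"
  unfolding le_fun_def subset_iff face_def support_def cube_def mem_Collect_eq
proof (intro iff_allI)
  fix i assume "\<forall>i. \<alpha> i = 0 \<or> \<alpha> i = 1"
  then show "nat (\<alpha> i) \<le> a i \<longleftrightarrow> (\<alpha> i \<noteq> 0 \<longrightarrow> 0 < a i)" by (cases "\<alpha> i = 0") auto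
qed

lemma genideal_cube_monomials:
  assumes "A \<subseteq> cube"
  shows "Idl\<^bsub>mpoly_ring\<^esub> (cube_xpow ` A) =
    {p :: ('n::finite, 'k::field) mpoly. \<forall>a\<in>Poly_Mapping.keys p. \<exists>\<alpha>\<in>A. face \<alpha> \<subseteq> support a}"
proof -
  have "cube_xpow ` A = (xpow ` (\<lambda>\<alpha> i. nat (\<alpha> i)) ` A :: ('n, 'k) mpoly set)"
    by (auto simp: cube_xpow_def)
  then show ?thesis
    using assms by (auto simp: genideal_monomials monomial_multiples_def cube_xpow_le_iff subset_iff)
qed

lemma face_prime_eq:
  "face_prime \<alpha> = {p :: ('n::finite, 'k::field) mpoly. \<forall>a\<in>Poly_Mapping.keys p. face \<alpha> \<inter> support a \<noteq> {}}"
proof -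
  have "(\<lambda>i. cube_xpow (unit_vec i)) ` {i. \<alpha> i \<noteq> 0} = (cube_xpow ` unit_vec ` face \<alpha> :: ('n, 'k) mpoly set)"
    by (auto simp: face_def)
  moreover have "face (unit_vec i) = {i}" for i :: 'n by (auto simp: face_def unit_vec_def)
  moreover have "unit_vec ` face \<alpha> \<subseteq> cube" by (auto simp: unit_vec_def cube_def)
  ultimately show ?thesis
    unfolding face_prime_def by (auto simp: genideal_cube_monomials)
qed

text \<open>
  The sets \<open>N\<close> of variables that meet the support of every monomial of \<open>I\<close>, expressed without
  choosing generators.
\<close>
definition vertex_cover :: "('n, 'k::field) mpoly set \<Rightarrow> 'n set \<Rightarrow> bool" where
  "vertex_cover I N \<longleftrightarrow> I \<subseteq> face_prime (indicator_deg N)"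

lemma face_prime_mono: "face \<alpha> \<subseteq> face \<beta> \<Longrightarrow> face_prime \<alpha> \<subseteq> (face_prime \<beta> :: ('n::finite, 'k::field) mpoly set)"
  unfolding face_prime_eq by blast

lemma vertex_cover_face: "\<alpha> \<in> cube \<Longrightarrow> vertex_cover I (face \<alpha>) \<longleftrightarrow> I \<subseteq> face_prime \<alpha>"
  by (simp add: vertex_cover_def indicator_face)

lemma vertex_cover_genideal:
  "vertex_cover (Idl\<^bsub>mpoly_ring\<^esub> (xpow ` E) :: ('n::finite, 'k::field) mpoly set) N \<longleftrightarrow> (\<forall>e\<in>E. N \<inter> support e \<noteq> {})"
proof
  assume *: "vertex_cover (Idl\<^bsub>mpoly_ring\<^esub> (xpow ` E) :: ('n, 'k) mpoly set) N"
  show "\<forall>e\<in>E. N \<inter> support e \<noteq> {}"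
  proof
    fix e assume "e \<in> E"
    then have "xpow e \<in> (monomial_multiples E :: ('n, 'k) mpoly set)"
      by (auto simp: monomial_multiples_def xpow_def)
    then have "xpow e \<in> (face_prime (indicator_deg N) :: ('n, 'k) mpoly set)"
      using * by (auto simp: vertex_cover_def genideal_monomials)
    then show "N \<inter> support e \<noteq> {}" by (simp add: face_prime_eq xpow_def)
  qed
next
  assume *: "\<forall>e\<in>E. N \<inter> support e \<noteq> {}"
  have "N \<inter> support a \<noteq> {}" if "e \<in> E" "e \<le> a" for e a
    using * that unfolding support_def le_fun_def by (fastforce intro: less_le_trans)
  then show "vertex_cover (Idl\<^bsub>mpoly_ring\<^esub> (xpow ` E) :: ('n, 'k) mpoly set) N"
    by (auto simp: vertex_cover_def genideal_monomials monomial_multiples_def face_prime_eq)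
qed

text \<open>
  Otherwise the product of all variables outside \<open>N\<close> lies in every \<open>face_prime \<alpha>\<close>, hence in \<open>I\<close>, but
  not in the prime of \<open>N\<close>.
\<close>
lemma intersection_of_face_primes_covers:
  fixes I :: "('n::finite, 'k::field) mpoly set"
  assumes A: "A \<subseteq> cube" and I: "I = (\<Inter>\<alpha>\<in>A. face_prime \<alpha>)" and N: "vertex_cover I N"
  shows "\<exists>\<alpha>\<in>A. face \<alpha> \<subseteq> N"
proof (rule ccontr)
  assume no: "\<not> (\<exists>\<alpha>\<in>A. face \<alpha> \<subseteq> N)"
  let ?a = "\<lambda>i. if i \<in> N then 0 else 1 :: nat"
  have supp: "support ?a = - N" by (auto simp: support_def)
  have "xpow ?a \<in> I"
    unfolding I using no by (auto simp: face_prime_eq xpow_def supp)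
  then have "xpow ?a \<in> (face_prime (indicator_deg N) :: ('n, 'k) mpoly set)"
    using N by (auto simp: vertex_cover_def)
  then show False by (simp add: face_prime_eq xpow_def supp)
qed

text \<open>
  If a monomial \<open>x\<^sup>a\<close> of \<open>p\<close> is divisible by no squarefree generator of \<open>I\<close>, then every generator
  involves a variable outside \<open>support a\<close>, so this complement is a vertex cover whose prime does
  not contain \<open>p\<close>.
\<close>
lemma squarefree_intersection:
  fixes I :: "('n::finite, 'k::field) mpoly set"
  assumes "squarefree_monomial_ideal I" and p: "\<And>N. vertex_cover I N \<Longrightarrow> p \<in> face_prime (indicator_deg N)"
  shows "p \<in> I"
proof -
  obtain A where A: "A \<subseteq> cube" "I = Idl\<^bsub>mpoly_ring\<^esub> (cube_xpow ` A)"
    using assms(1) by (auto simp: squarefree_monomial_ideal_def)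
  have I: "I = {p. \<forall>a\<in>Poly_Mapping.keys p. \<exists>\<alpha>\<in>A. face \<alpha> \<subseteq> support a}"
    using A genideal_cube_monomials by blast
  show ?thesis
    unfolding I
  proof (safe, rule ccontr)
    fix a assume a: "a \<in> Poly_Mapping.keys p" and no: "\<not> (\<exists>\<alpha>\<in>A. face \<alpha> \<subseteq> support a)"
    have "vertex_cover I (- support a)"
      unfolding vertex_cover_def I face_prime_eq face_indicator using no by blast
    from p[OF this] a show False by (auto simp: face_prime_eq)
  qed
qed

definition minimal_covers :: "('n, 'k::field) mpoly set \<Rightarrow> 'n deg set" where
  "minimal_covers I = {\<alpha> \<in> cube. vertex_cover I (face \<alpha>) \<and> (\<forall>N. vertex_cover I N \<longrightarrow> N \<subseteq> face \<alpha> \<longrightarrow> N = face \<alpha>)}"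

lemma minimal_cover_below:
  assumes "vertex_cover I (N :: 'n::finite set)"
  shows "\<exists>\<alpha>\<in>minimal_covers I. face \<alpha> \<subseteq> N"
proof -
  have "\<exists>m\<in>{S. vertex_cover I S}. m \<subseteq> N \<and> (\<forall>b\<in>{S. vertex_cover I S}. b \<subseteq> m \<longrightarrow> m = b)"
    by (rule finite_has_minimal2) (use assms in auto)
  then obtain m where "vertex_cover I m" "m \<subseteq> N" "\<And>b. vertex_cover I b \<Longrightarrow> b \<subseteq> m \<Longrightarrow> b = m"
    by blast
  then show ?thesis
    by (intro bexI[of _ "indicator_deg m"]) (auto simp: minimal_covers_def)
qed

text \<open>
  The primes of an irredundant decomposition are forced to be the minimal covers: every cover lies
  above one of them, and irredundancy makes them an antichain.
\<close>
lemma the_minimal_primary_decomposition: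
  fixes I :: "('n::finite, 'k::field) mpoly set"
  assumes I: "squarefree_monomial_ideal I"
  shows "(THE A. minimal_primary_decomposition A I) = minimal_covers I"
proof (rule the_equality)
  have eq: "I = (\<Inter>\<alpha>\<in>minimal_covers I. face_prime \<alpha>)"
  proof
    show "I \<subseteq> (\<Inter>\<alpha>\<in>minimal_covers I. face_prime \<alpha>)"
      by (auto simp: minimal_covers_def vertex_cover_face)
    show "(\<Inter>\<alpha>\<in>minimal_covers I. face_prime \<alpha>) \<subseteq> I"
    proof
      fix p :: "('n, 'k) mpoly" assume p: "p \<in> (\<Inter>\<alpha>\<in>minimal_covers I. face_prime \<alpha>)"
      show "p \<in> I"
      proof (rule squarefree_intersection[OF I])
        fix N assume "vertex_cover I N"
        then obtain \<alpha> where "\<alpha> \<in> minimal_covers I" "face \<alpha> \<subseteq> N" using minimal_cover_below by blast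
        then show "p \<in> face_prime (indicator_deg N)"
          using p face_prime_mono[of \<alpha> "indicator_deg N"] by auto
      qed
    qed
  qed
  show "minimal_primary_decomposition (minimal_covers I) I"
    unfolding minimal_primary_decomposition_def
  proof (intro conjI ballI)
    show "minimal_covers I \<subseteq> cube" by (auto simp: minimal_covers_def)
    show "I = (\<Inter>\<alpha>\<in>minimal_covers I. face_prime \<alpha>)" by (rule eq)
    fix \<beta> assume \<beta>: "\<beta> \<in> minimal_covers I"
    show "I \<noteq> (\<Inter>\<alpha>\<in>minimal_covers I - {\<beta>}. face_prime \<alpha>)"
    proof
      assume *: "I = (\<Inter>\<alpha>\<in>minimal_covers I - {\<beta>}. face_prime \<alpha>)"
      obtain \<alpha> where \<alpha>: "\<alpha> \<in> minimal_covers I" "\<alpha> \<noteq> \<beta>" "face \<alpha> \<subseteq> face \<beta>"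
        using intersection_of_face_primes_covers[OF _ *, of "face \<beta>"] \<beta>
        by (auto simp: minimal_covers_def)
      then have "face \<alpha> = face \<beta>" using \<beta> by (auto simp: minimal_covers_def)
      then have "\<alpha> = \<beta>" using \<alpha> \<beta> indicator_face[of \<alpha>] indicator_face[of \<beta>]
        by (auto simp: minimal_covers_def)
      then show False using \<alpha> by simp
    qed
  qed
next
  fix A assume A: "minimal_primary_decomposition A I"
  then have Ac: "A \<subseteq> cube" and IA: "I = (\<Inter>\<alpha>\<in>A. face_prime \<alpha>)"
    and irr: "\<And>\<beta>. \<beta> \<in> A \<Longrightarrow> I \<noteq> (\<Inter>\<alpha>\<in>A - {\<beta>}. face_prime \<alpha>)"
    by (auto simp: minimal_primary_decomposition_def)
  have cov: "vertex_cover I (face \<alpha>)" if "\<alpha> \<in> A" for \<alpha>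
    using that Ac IA vertex_cover_face[of \<alpha> I] by auto
  have anti: "\<alpha> = \<beta>" if ab: "\<alpha> \<in> A" "\<beta> \<in> A" "face \<alpha> \<subseteq> face \<beta>" for \<alpha> \<beta>
  proof (rule ccontr)
    assume ne: "\<alpha> \<noteq> \<beta>"
    have "(\<Inter>\<alpha>\<in>A. face_prime \<alpha>) = (\<Inter>\<alpha>\<in>A - {\<beta>}. face_prime \<alpha> :: ('n, 'k) mpoly set)"
      using ab ne face_prime_mono[OF ab(3), where 'k = 'k] by blast
    then show False using irr[OF ab(2)] IA by simp
  qed
  show "A = minimal_covers I"
  proof (intro equalityI subsetI)
    fix \<alpha> assume \<alpha>: "\<alpha> \<in> A"
    have "N = face \<alpha>" if N: "vertex_cover I N" "N \<subseteq> face \<alpha>" for N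
    proof -
      obtain \<beta> where "\<beta> \<in> A" "face \<beta> \<subseteq> N"
        using intersection_of_face_primes_covers[OF Ac IA N(1)] by blast
      then show ?thesis using anti[of \<beta> \<alpha>] \<alpha> N by auto
    qed
    then show "\<alpha> \<in> minimal_covers I" using \<alpha> Ac cov by (auto simp: minimal_covers_def)
  next
    fix \<alpha> assume \<alpha>: "\<alpha> \<in> minimal_covers I"
    then have "vertex_cover I (face \<alpha>)" by (simp add: minimal_covers_def)
    then obtain \<beta> where \<beta>: "\<beta> \<in> A" "face \<beta> \<subseteq> face \<alpha>"
      using intersection_of_face_primes_covers[OF Ac IA] by blast
    then have "face \<beta> = face \<alpha>" using \<alpha> cov by (auto simp: minimal_covers_def)
    then have "\<beta> = \<alpha>" using \<alpha> \<beta> Ac indicator_face[of \<alpha>] indicator_face[of \<beta>]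
      by (auto simp: minimal_covers_def)
    then show "\<alpha> \<in> A" using \<beta> by simp
  qed
qed

lemma alexander_dual_eq:
  fixes I :: "('n::finite, 'k::field) mpoly set"
  assumes "squarefree_monomial_ideal I"
  shows "alexander_dual I = {p. \<forall>a\<in>Poly_Mapping.keys p. vertex_cover I (support a)}"
proof -
  have up: "vertex_cover I N" if "vertex_cover I M" "M \<subseteq> N" for M N
    using that face_prime_mono[of "indicator_deg M" "indicator_deg N", where 'k = 'k]
    by (auto simp: vertex_cover_def)
  have "(\<exists>\<alpha>\<in>minimal_covers I. face \<alpha> \<subseteq> N) \<longleftrightarrow> vertex_cover I N" for N
    using minimal_cover_below[of I N] up by (auto simp: minimal_covers_def)
  moreover have "minimal_covers I \<subseteq> cube" by (auto simp: minimal_covers_def)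
  ultimately show ?thesis
    using assms by (simp add: alexander_dual_def the_minimal_primary_decomposition genideal_cube_monomials)
qed

section \<open>Minimal resolutions as families of scalar matrices\<close>
lemma sum_times_delta:
  fixes f :: "'a \<Rightarrow> 'k::semiring_1"
  assumes "finite S" "b \<in> S"
  shows "(\<Sum>c\<in>S. f c * (if c = b then 1 else 0)) = f b"
proof -
  have "(\<Sum>c\<in>S. f c * (if c = b then 1 else 0)) = (\<Sum>c\<in>S. if c = b then f b else 0)"
    by (rule sum.cong) auto
  then show ?thesis using assms by (simp add: sum.delta)
qed

text \<open>
  A minimal \<open>\<int>\<^sup>n\<close>-graded resolution of a monomial ideal, in terms of scalars.  In degree \<open>\<gamma>\<close> the
  free module \<open>L\<^sub>j\<close> has one coordinate for each basis element of degree at most \<open>\<gamma>\<close>, and the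
  differentials act by the same scalar matrices \<open>A j\<close> in all degrees.  The ideal contains
  \<open>x\<^sup>\<gamma>\<close>, \<open>\<gamma> \<ge> 0\<close>, iff \<open>cov\<close> holds for the support of \<open>\<gamma>\<close>; that this depends only on the support
  is what makes the ideal squarefree.
\<close>
locale scalar_resolution =
  fixes B :: "nat \<Rightarrow> 'b set" and \<delta> :: "nat \<Rightarrow> 'b \<Rightarrow> ('n::finite) deg"
    and A :: "nat \<Rightarrow> 'b \<Rightarrow> 'b \<Rightarrow> 'k::field" and aug :: "'b \<Rightarrow> 'k" and cov :: "'n set \<Rightarrow> bool"
  assumes finite_basis [simp]: "finite (B j)"
    and matrix_deg: "\<lbrakk>b \<in> B j; b' \<in> B (Suc j); A j b b' \<noteq> 0\<rbrakk> \<Longrightarrow> \<delta> j b \<le> \<delta> (Suc j) b' \<and> \<delta> j b \<noteq> \<delta> (Suc j) b'"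
    and aug_deg: "\<lbrakk>b \<in> B 0; aug b \<noteq> 0\<rbrakk> \<Longrightarrow> 0 \<le> \<delta> 0 b"
    and matrix_square: "\<lbrakk>b \<in> B j; b'' \<in> B (Suc (Suc j))\<rbrakk> \<Longrightarrow> (\<Sum>b'\<in>B (Suc j). A j b b' * A (Suc j) b' b'') = 0"
    and aug_matrix: "b' \<in> B (Suc 0) \<Longrightarrow> (\<Sum>b\<in>B 0. aug b * A 0 b b') = 0"
    and aug_cov: "\<lbrakk>\<And>b. f b \<noteq> 0 \<Longrightarrow> b \<in> B 0 \<and> \<delta> 0 b \<le> \<gamma>; (\<Sum>b\<in>B 0. aug b * f b) \<noteq> 0\<rbrakk> \<Longrightarrow> cov {i. 0 < \<gamma> i}"
    and cov_aug: "\<lbrakk>0 \<le> \<gamma>; cov {i. 0 < \<gamma> i}\<rbrakk> \<Longrightarrow>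
      \<exists>f. (\<forall>b. f b \<noteq> 0 \<longrightarrow> b \<in> B 0 \<and> \<delta> 0 b \<le> \<gamma>) \<and> (\<Sum>b\<in>B 0. aug b * f b) = 1"
    and exact_0: "\<lbrakk>\<And>b. f b \<noteq> 0 \<Longrightarrow> b \<in> B 0 \<and> \<delta> 0 b \<le> \<gamma>; (\<Sum>b\<in>B 0. aug b * f b) = 0\<rbrakk> \<Longrightarrow>
      \<exists>g. (\<forall>b. g b \<noteq> 0 \<longrightarrow> b \<in> B (Suc 0) \<and> \<delta> (Suc 0) b \<le> \<gamma>) \<and> (\<forall>b\<in>B 0. (\<Sum>b'\<in>B (Suc 0). A 0 b b' * g b') = f b)"
    and exact_Suc: "\<lbrakk>\<And>b. f b \<noteq> 0 \<Longrightarrow> b \<in> B (Suc j) \<and> \<delta> (Suc j) b \<le> \<gamma>;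
        \<And>b. b \<in> B j \<Longrightarrow> (\<Sum>b'\<in>B (Suc j). A j b b' * f b') = 0\<rbrakk> \<Longrightarrow>
      \<exists>g. (\<forall>b. g b \<noteq> 0 \<longrightarrow> b \<in> B (Suc (Suc j)) \<and> \<delta> (Suc (Suc j)) b \<le> \<gamma>) \<and>
        (\<forall>b\<in>B (Suc j). (\<Sum>b'\<in>B (Suc (Suc j)). A (Suc j) b b' * g b') = f b)"
begin

text \<open>
  Minimality in the form in which it is used: a boundary of degree \<open>\<delta> j b\<close> has coordinate \<open>0\<close> at
  \<open>b\<close>.
\<close>
lemma boundary_misses_top_degree:
  assumes "b \<in> B j" and g: "\<And>b'. g b' \<noteq> 0 \<Longrightarrow> b' \<in> B (Suc j) \<and> \<delta> (Suc j) b' \<le> \<delta> j b"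
  shows "(\<Sum>b'\<in>B (Suc j). A j b b' * g b') = 0"
proof (rule sum.neutral, rule ballI, rule ccontr)
  fix b' assume b': "b' \<in> B (Suc j)" and nz: "A j b b' * g b' \<noteq> 0"
  then have "\<delta> j b \<le> \<delta> (Suc j) b'" "\<delta> j b \<noteq> \<delta> (Suc j) b'" "\<delta> (Suc j) b' \<le> \<delta> j b"
    using matrix_deg[OF assms(1) b'] g by auto
  then show False by auto
qed

text \<open>
  Induction on \<open>j\<close>.  Suppose that \<open>\<gamma> = \<delta> j b\<close> has \<open>\<gamma> i \<ge> 2\<close>.  The basis elements in the
  boundary of \<open>b\<close> have degree at most \<open>1\<close> at \<open>i\<close> (for \<open>j = 0\<close>: \<open>x\<^sup>\<gamma>\<close> and \<open>x\<^sup>\<gamma>\<close> divided by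
  \<open>x\<^sub>i\<close> have the same support), so this boundary already lives in degree \<open>\<gamma> - \<epsilon>\<^sub>i\<close>, where it is
  the boundary of some \<open>u\<close>; the coordinate of \<open>u\<close> at \<open>b\<close> is \<open>0\<close>.  Hence \<open>b - u\<close> is a cycle,
  thus a boundary, with coordinate \<open>1\<close> at \<open>b\<close>, contradicting minimality.  If \<open>\<gamma> i < 0\<close>, then the
  boundary of \<open>b\<close> is \<open>0\<close> and \<open>u = 0\<close> will do.
\<close>
lemma degrees_squarefree: "b \<in> B j \<Longrightarrow> \<delta> j b i = 0 \<or> \<delta> j b i = 1"
proof (induction j arbitrary: b)
  case 0
  let ?\<gamma> = "\<delta> 0 b" and ?e = "\<lambda>c. if c = b then 1 else 0 :: 'k"
  have aug_e: "(\<Sum>c\<in>B 0. aug c * ?e c) = aug b" using 0 by (simp add: sum_times_delta)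
  show ?case
  proof (rule ccontr)
    assume bad: "\<not> (?\<gamma> i = 0 \<or> ?\<gamma> i = 1)"
    have "\<exists>u. (\<forall>c. u c \<noteq> 0 \<longrightarrow> c \<in> B 0 \<and> \<delta> 0 c \<le> ?\<gamma>) \<and> u b = 0 \<and> (\<Sum>c\<in>B 0. aug c * u c) = aug b"
    proof (cases "aug b = 0")
      case True
      then show ?thesis by (intro exI[of _ "\<lambda>_. 0"]) simp
    next
      case False
      have nonneg: "0 \<le> ?\<gamma>" using aug_deg[OF 0 False] .
      then have i: "2 \<le> ?\<gamma> i" using bad by (auto simp: le_fun_def dest: spec[of _ i])
      let ?\<gamma>' = "?\<gamma>(i := ?\<gamma> i - 1)"
      have nonneg': "0 \<le> ?\<gamma>'" using nonneg i by (auto simp: le_fun_def)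
      have "cov {i. 0 < ?\<gamma> i}"
        by (rule aug_cov[of ?e]) (use 0 False aug_e in \<open>auto split: if_splits\<close>)
      also have "{i. 0 < ?\<gamma> i} = {l. 0 < ?\<gamma>' l}" using i by auto
      finally obtain u where u: "\<And>c. u c \<noteq> 0 \<Longrightarrow> c \<in> B 0 \<and> \<delta> 0 c \<le> ?\<gamma>'" "(\<Sum>c\<in>B 0. aug c * u c) = 1"
        using cov_aug[OF nonneg'] by blast
      have "?\<gamma>' \<le> ?\<gamma>" "\<not> ?\<gamma> \<le> ?\<gamma>'" by (auto simp: le_fun_def intro: exI[of _ i])
      then have "c \<in> B 0 \<and> \<delta> 0 c \<le> ?\<gamma>" "u b = 0" if "u c \<noteq> 0" for c using u(1) that order_trans by blast+
      moreover have "u b = 0" using u(1)[of b] \<open>\<not> ?\<gamma> \<le> ?\<gamma>'\<close> by blast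
      moreover have "(\<Sum>c\<in>B 0. aug c * (aug b * u c)) = aug b"
      proof -
        have "(\<Sum>c\<in>B 0. aug c * (aug b * u c)) = aug b * (\<Sum>c\<in>B 0. aug c * u c)"
          by (simp add: sum_distrib_left mult.left_commute)
        then show ?thesis using u(2) by simp
      qed
      ultimately show ?thesis by (intro exI[of _ "\<lambda>c. aug b * u c"]) auto
    qed
    then obtain u where u: "\<And>c. u c \<noteq> 0 \<Longrightarrow> c \<in> B 0 \<and> \<delta> 0 c \<le> ?\<gamma>" "u b = 0" "(\<Sum>c\<in>B 0. aug c * u c) = aug b"
      by blast
    let ?f = "\<lambda>c. ?e c - u c"
    have "\<exists>g. (\<forall>c. g c \<noteq> 0 \<longrightarrow> c \<in> B (Suc 0) \<and> \<delta> (Suc 0) c \<le> ?\<gamma>) \<and>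
       (\<forall>c\<in>B 0. (\<Sum>b'\<in>B (Suc 0). A 0 c b' * g b') = ?f c)"
    proof (rule exact_0)
      show "c \<in> B 0 \<and> \<delta> 0 c \<le> ?\<gamma>" if "?f c \<noteq> 0" for c
        using that u(1)[of c] 0 by (auto split: if_splits)
      show "(\<Sum>c\<in>B 0. aug c * ?f c) = 0"
        using aug_e u(3) by (simp add: right_diff_distrib sum_subtractf)
    qed
    then show False using boundary_misses_top_degree[OF 0] 0 u(2) by force
  qed
next
  case (Suc j)
  let ?\<gamma> = "\<delta> (Suc j) b" and ?e = "\<lambda>c. if c = b then 1 else 0 :: 'k"
  let ?D = "\<lambda>j f c. \<Sum>b'\<in>B (Suc j). A j c b' * f b'"
  have De: "?D j ?e c = A j c b" for c using Suc.prems by (simp add: sum_times_delta)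
  show ?case
  proof (rule ccontr)
    assume bad: "\<not> (?\<gamma> i = 0 \<or> ?\<gamma> i = 1)"
    have "\<exists>u. (\<forall>c. u c \<noteq> 0 \<longrightarrow> c \<in> B (Suc j) \<and> \<delta> (Suc j) c \<le> ?\<gamma>) \<and> u b = 0 \<and> (\<forall>c\<in>B j. ?D j u c = A j c b)"
    proof (cases "?\<gamma> i < 0")
      case True
      have "A j c b = 0" if "c \<in> B j" for c
      proof (rule ccontr)
        assume "A j c b \<noteq> 0"
        then have "\<delta> j c i \<le> ?\<gamma> i" using matrix_deg[OF that Suc.prems] by (auto simp: le_fun_def)
        then show False using Suc.IH[OF that] True by auto
      qed
      then show ?thesis by (intro exI[of _ "\<lambda>_. 0"]) simp
    next
      case False
      let ?\<gamma>' = "?\<gamma>(i := ?\<gamma> i - 1)"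
      let ?h = "\<lambda>c. if c \<in> B j then A j c b else 0"
      have h: "c \<in> B j \<and> \<delta> j c \<le> ?\<gamma>'" if "?h c \<noteq> 0" for c
        using that Suc.IH[of c] matrix_deg[of c j b] Suc.prems bad False by (auto simp: le_fun_def split: if_splits)
      have "\<exists>u. (\<forall>c. u c \<noteq> 0 \<longrightarrow> c \<in> B (Suc j) \<and> \<delta> (Suc j) c \<le> ?\<gamma>') \<and> (\<forall>c\<in>B j. ?D j u c = ?h c)"
      proof (cases j)
        case 0
        show ?thesis
          unfolding 0
          by (rule exact_0) (use h aug_matrix[of b] Suc.prems 0 in \<open>auto split: if_splits\<close>)
      next
        case (Suc l)
        show ?thesis
          unfolding Suc
          by (rule exact_Suc) (use h matrix_square[of _ l b] Suc.prems Suc in \<open>auto split: if_splits\<close>)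
      qed
      then obtain u where u: "\<And>c. u c \<noteq> 0 \<Longrightarrow> c \<in> B (Suc j) \<and> \<delta> (Suc j) c \<le> ?\<gamma>'" "\<And>c. c \<in> B j \<Longrightarrow> ?D j u c = ?h c"
        by blast
      have "?\<gamma>' \<le> ?\<gamma>" "\<not> ?\<gamma> \<le> ?\<gamma>'" by (auto simp: le_fun_def intro: exI[of _ i])
      then have "\<delta> (Suc j) c \<le> ?\<gamma>" if "u c \<noteq> 0" for c using u(1)[OF that] order_trans by blast
      moreover have "u b = 0" using u(1)[of b] \<open>\<not> ?\<gamma> \<le> ?\<gamma>'\<close> by blast
      moreover have "?D j u c = A j c b" if "c \<in> B j" for c using u(2)[OF that] that by simp
      ultimately show ?thesis using u(1) by (intro exI[of _ u]) blast
    qed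
    then obtain u where u: "\<And>c. u c \<noteq> 0 \<Longrightarrow> c \<in> B (Suc j) \<and> \<delta> (Suc j) c \<le> ?\<gamma>" "u b = 0" "\<And>c. c \<in> B j \<Longrightarrow> ?D j u c = A j c b"
      by blast
    let ?f = "\<lambda>c. ?e c - u c"
    have "\<exists>g. (\<forall>c. g c \<noteq> 0 \<longrightarrow> c \<in> B (Suc (Suc j)) \<and> \<delta> (Suc (Suc j)) c \<le> ?\<gamma>) \<and>
       (\<forall>c\<in>B (Suc j). ?D (Suc j) g c = ?f c)"
    proof (rule exact_Suc)
      show "c \<in> B (Suc j) \<and> \<delta> (Suc j) c \<le> ?\<gamma>" if "?f c \<noteq> 0" for c
        using that u(1)[of c] Suc.prems by (auto split: if_splits)
      show "?D j ?f c = 0" if "c \<in> B j" for c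
        using De u(3)[OF that] by (simp add: right_diff_distrib sum_subtractf)
    qed
    then show False using boundary_misses_top_degree[OF Suc.prems] Suc.prems u(2) by force
  qed
qed

lemma degree_in_cube: "b \<in> B j \<Longrightarrow> \<delta> j b \<in> cube"
  using degrees_squarefree by (auto simp: cube_def)

end

section \<open>Graded free resolutions read degree by degree\<close>

lemma poly_piece_eq:
  "p \<in> poly_piece \<gamma> \<Longrightarrow> p = (if 0 \<le> \<gamma> then Poly_Mapping.single (\<lambda>i. nat (\<gamma> i)) (Poly_Mapping.lookup p (\<lambda>i. nat (\<gamma> i))) else 0)"
proof -
  assume p: "p \<in> poly_piece \<gamma>"
  have a: "0 \<le> \<gamma> \<and> a = (\<lambda>i. nat (\<gamma> i))" if "a \<in> Poly_Mapping.keys p" for a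
  proof -
    have "(\<lambda>i. int (a i)) = \<gamma>" using p that by (auto simp: poly_piece_def)
    then show ?thesis by (auto simp: le_fun_def)
  qed
  show ?thesis
  proof (rule poly_mapping_eqI)
    fix k
    show "Poly_Mapping.lookup p k = Poly_Mapping.lookup (if 0 \<le> \<gamma> then Poly_Mapping.single (\<lambda>i. nat (\<gamma> i)) (Poly_Mapping.lookup p (\<lambda>i. nat (\<gamma> i))) else 0) k"
      using a[of k] a[of "\<lambda>i. nat (\<gamma> i)"] by (auto simp: lookup_single when_def in_keys_iff)
  qed
qed

definition unit_vector :: "'b \<Rightarrow> 'b \<Rightarrow> ('n, 'k::field) mpoly" where
  "unit_vector b = (\<lambda>c. if c = b then 1 else 0)"

text \<open>
  The scalar coordinates of the degree \<open>\<gamma>\<close> component of a vector.  Working with them avoids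
  decomposing vectors into homogeneous components.
\<close>
definition coefficient :: "('b, 'n, 'k::field) free_complex \<Rightarrow> nat \<Rightarrow> 'n deg \<Rightarrow> ('b \<Rightarrow> ('n, 'k) mpoly) \<Rightarrow> 'b \<Rightarrow> 'k" where
  "coefficient L j \<gamma> u b = (if b \<in> fc_basis L j \<and> fc_deg L j b \<le> \<gamma>
     then Poly_Mapping.lookup (u b) (\<lambda>i. nat (\<gamma> i - fc_deg L j b i)) else 0)"

definition homogeneous_vector :: "('b, 'n, 'k::field) free_complex \<Rightarrow> nat \<Rightarrow> 'n deg \<Rightarrow> ('b \<Rightarrow> 'k) \<Rightarrow> 'b \<Rightarrow> ('n, 'k) mpoly" where
  "homogeneous_vector L j \<gamma> f b = (if b \<in> fc_basis L j \<and> fc_deg L j b \<le> \<gamma>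
     then Poly_Mapping.single (\<lambda>i. nat (\<gamma> i - fc_deg L j b i)) (f b) else 0)"

lemma fc_carrier: "v \<in> carrier (fc_module L j) \<longleftrightarrow> (\<forall>b. b \<notin> fc_basis L j \<longrightarrow> v b = 0)"
  by (simp add: fc_module_def)

lemma homogeneous_vector_carrier [simp]: "homogeneous_vector L j \<gamma> f \<in> carrier (fc_module L j)"
  by (simp add: fc_carrier homogeneous_vector_def)

lemma unit_vector_carrier: "b \<in> fc_basis L j \<Longrightarrow> unit_vector b \<in> carrier (fc_module L j)"
  by (auto simp: fc_carrier unit_vector_def)

lemma coefficient_homogeneous_vector:
  assumes "\<And>b. f b \<noteq> 0 \<Longrightarrow> b \<in> fc_basis L j \<and> fc_deg L j b \<le> \<gamma>"
  shows "coefficient L j \<gamma>' (homogeneous_vector L j \<gamma> f) b = (if \<gamma>' = \<gamma> then f b else 0)"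
proof (cases "b \<in> fc_basis L j \<and> fc_deg L j b \<le> \<gamma> \<and> fc_deg L j b \<le> \<gamma>'")
  case True
  have "(\<lambda>i. nat (\<gamma> i - fc_deg L j b i)) = (\<lambda>i. nat (\<gamma>' i - fc_deg L j b i)) \<longleftrightarrow> \<gamma>' = \<gamma>"
  proof
    assume *: "(\<lambda>i. nat (\<gamma> i - fc_deg L j b i)) = (\<lambda>i. nat (\<gamma>' i - fc_deg L j b i))"
    show "\<gamma>' = \<gamma>"
    proof
      fix i
      show "\<gamma>' i = \<gamma> i" using True fun_cong[OF *, of i] by (auto simp: le_fun_def dest!: spec[of _ i])
    qed
  qed simp
  then show ?thesis
    using True by (simp add: coefficient_def homogeneous_vector_def lookup_single when_def)
next
  case False
  then have "\<not> (b \<in> fc_basis L j \<and> fc_deg L j b \<le> \<gamma>) \<or> \<not> fc_deg L j b \<le> \<gamma>'" by blast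
  then show ?thesis
    using assms[of b] by (auto simp: coefficient_def homogeneous_vector_def)
qed

lemma coefficient_zero [simp]: "coefficient L j \<gamma> (\<lambda>_. 0) b = 0"
  by (simp add: coefficient_def)

lemma coefficient_unit_vector:
  "b' \<in> fc_basis L j \<Longrightarrow> coefficient L j (fc_deg L j b') (unit_vector b') b = (if b = b' then 1 else 0)"
  by (auto simp: coefficient_def unit_vector_def lookup_one zero_fun_def)

lemma zero_if_coefficients_zero:
  fixes v :: "'b \<Rightarrow> ('n, 'k::field) mpoly"
  assumes "v \<in> carrier (fc_module L j)" "\<And>\<gamma> b. coefficient L j \<gamma> v b = 0"
  shows "v = (\<lambda>_. 0)"
proof
  fix b
  show "v b = 0"
  proof (cases "b \<in> fc_basis L j")
    case True
    show ?thesis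
    proof (rule poly_mapping_eqI)
      fix a :: "'n \<Rightarrow> nat"
      show "Poly_Mapping.lookup (v b) a = Poly_Mapping.lookup 0 a"
        using assms(2)[of "\<lambda>i. int (a i) + fc_deg L j b i" b] True
        by (simp add: coefficient_def le_fun_def)
    qed
  qed (use assms(1) in \<open>simp add: fc_carrier\<close>)
qed

lemma linear_on_free_module:
  fixes F :: "('b \<Rightarrow> ('n, 'k::field) mpoly) \<Rightarrow> ('n, 'k) mpoly"
  assumes fin: "finite (fc_basis L j)"
    and add: "\<And>u v. u \<in> carrier (fc_module L j) \<Longrightarrow> v \<in> carrier (fc_module L j) \<Longrightarrow> F (\<lambda>b. u b + v b) = F u + F v"
    and scale: "\<And>p u. u \<in> carrier (fc_module L j) \<Longrightarrow> F (\<lambda>b. p * u b) = p * F u"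
    and u: "u \<in> carrier (fc_module L j)"
  shows "F u = (\<Sum>b\<in>fc_basis L j. u b * F (unit_vector b))"
proof -
  have z: "F (\<lambda>_. 0) = 0" using scale[of "\<lambda>_. 0" 0] by (simp add: fc_carrier)
  have "F (\<lambda>b. if b \<in> S then u b else 0) = (\<Sum>b\<in>S. u b * F (unit_vector b))" if "S \<subseteq> fc_basis L j" for S
    using finite_subset[OF that fin] that
  proof (induction S rule: finite_induct)
    case empty
    then show ?case using z by simp
  next
    case (insert x S)
    have "(\<lambda>b. if b \<in> insert x S then u b else 0) = (\<lambda>b. u x * unit_vector x b + (if b \<in> S then u b else 0))"
      using insert by (auto simp: fun_eq_iff unit_vector_def)
    moreover have "(\<lambda>b. u x * unit_vector x b) \<in> carrier (fc_module L j)" "(\<lambda>b. if b \<in> S then u b else 0) \<in> carrier (fc_module L j)"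
      using insert by (auto simp: fc_carrier unit_vector_def)
    ultimately have "F (\<lambda>b. if b \<in> insert x S then u b else 0) = F (\<lambda>b. u x * unit_vector x b) + F (\<lambda>b. if b \<in> S then u b else 0)"
      by (simp only: add)
    also have "F (\<lambda>b. u x * unit_vector x b) = u x * F (unit_vector x)"
      using insert by (intro scale unit_vector_carrier) simp
    finally show ?case using insert by simp
  qed
  from this[of "fc_basis L j"] have "F (\<lambda>b. if b \<in> fc_basis L j then u b else 0) = (\<Sum>b\<in>fc_basis L j. u b * F (unit_vector b))"
    by simp
  moreover have "(\<lambda>b. if b \<in> fc_basis L j then u b else 0) = u"
    using u by (auto simp: fc_carrier fun_eq_iff)
  ultimately show ?thesis by simp
qed

text \<open>
  A graded linear map acts on the scalar coordinates of each degree by one matrix.  Stated for maps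
  to the free module on one generator of degree \<open>\<eta>\<close>, which covers each component of a differential as
  well as the augmentation.
\<close>
lemma lookup_graded_linear:
  fixes F :: "('b \<Rightarrow> ('n::finite, 'k::field) mpoly) \<Rightarrow> ('n, 'k) mpoly"
  assumes F: "F u = (\<Sum>b\<in>fc_basis L j. u b * F (unit_vector b))"
    and piece: "\<And>b. b \<in> fc_basis L j \<Longrightarrow> F (unit_vector b) \<in> poly_piece (fc_deg L j b - \<eta>)"
    and le: "\<eta> \<le> \<gamma>"
  shows "Poly_Mapping.lookup (F u) (\<lambda>i. nat (\<gamma> i - \<eta> i)) =
    (\<Sum>b\<in>fc_basis L j. Poly_Mapping.lookup (F (unit_vector b)) (\<lambda>i. nat (fc_deg L j b i - \<eta> i)) * coefficient L j \<gamma> u b)"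
  unfolding F lookup_sum
proof (rule sum.cong[OF refl])
  fix b assume b: "b \<in> fc_basis L j"
  let ?c = "Poly_Mapping.lookup (F (unit_vector b)) (\<lambda>i. nat (fc_deg L j b i - \<eta> i))"
  let ?a = "\<lambda>i. nat (\<gamma> i - \<eta> i)" and ?e = "\<lambda>i. nat (fc_deg L j b i - \<eta> i)"
  have eq: "F (unit_vector b) = (if \<eta> \<le> fc_deg L j b then Poly_Mapping.single ?e ?c else 0)"
  proof -
    have "(0 \<le> fc_deg L j b - \<eta>) = (\<eta> \<le> fc_deg L j b)" by (simp add: le_fun_def fun_diff_def)
    then show ?thesis using poly_piece_eq[OF piece[OF b]] by (simp only: fun_diff_def)
  qed
  show "Poly_Mapping.lookup (u b * F (unit_vector b)) ?a = ?c * coefficient L j \<gamma> u b"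
  proof (cases "\<eta> \<le> fc_deg L j b")
    case False
    then show ?thesis using eq by simp
  next
    case True
    then have F1: "F (unit_vector b) = Poly_Mapping.single ?e ?c" using eq by simp
    have *: "?e \<le> ?a \<longleftrightarrow> fc_deg L j b \<le> \<gamma>"
      unfolding le_fun_def
    proof (rule iff_allI)
      fix i
      show "nat (fc_deg L j b i - \<eta> i) \<le> nat (\<gamma> i - \<eta> i) \<longleftrightarrow> fc_deg L j b i \<le> \<gamma> i"
        using True le by (auto simp: le_fun_def dest!: spec[of _ i])
    qed
    show ?thesis
    proof (cases "fc_deg L j b \<le> \<gamma>")
      case leg: True
      have "?a - ?e = (\<lambda>i. nat (\<gamma> i - fc_deg L j b i))"
      proof
        fix i
        show "(?a - ?e) i = nat (\<gamma> i - fc_deg L j b i)"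
          using True le leg by (auto simp: le_fun_def dest!: spec[of _ i])
      qed
      then have "Poly_Mapping.lookup (u b * Poly_Mapping.single ?e ?c) ?a = ?c * coefficient L j \<gamma> u b"
        using lookup_single_mult_le[of ?e ?a "u b" ?c] * leg b by (simp add: coefficient_def mult.commute)
      then show ?thesis by (simp only: F1[symmetric])
    next
      case False
      then have "Poly_Mapping.lookup (u b * Poly_Mapping.single ?e ?c) ?a = 0"
        using lookup_single_mult_not_le[of ?e ?a "u b" ?c] * by simp
      then show ?thesis using False by (simp add: F1[symmetric] coefficient_def)
    qed
  qed
qed

context
  fixes L :: "('b, 'n::finite, 'k::field) free_complex" and \<epsilon> J
  assumes res: "minimal_free_resolution L \<epsilon> J"
begin

lemma graded_complex: "graded_free_complex L"
  using res unfolding minimal_free_resolution_def by blast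

lemma fin_basis: "finite (fc_basis L j)"
  using graded_complex unfolding graded_free_complex_def by blast

lemma fc_diff_hom: "fc_diff L j \<in> module_homs mpoly_ring (fc_module L (Suc j)) (fc_module L j)"
  using graded_complex unfolding graded_free_complex_def by blast

lemma fc_diff_piece: "v \<in> fc_piece L (Suc j) \<gamma> \<Longrightarrow> fc_diff L j v \<in> fc_piece L j \<gamma>"
  using graded_complex unfolding graded_free_complex_def by (simp add: image_subset_iff)

lemma fc_diff_square: "v \<in> carrier (fc_module L (Suc (Suc j))) \<Longrightarrow> fc_diff L j (fc_diff L (Suc j) v) = (\<lambda>_. 0)"
  using graded_complex unfolding graded_free_complex_def by blast

lemma aug_hom: "\<epsilon> \<in> module_homs mpoly_ring (fc_module L 0) poly_module"
  using res unfolding minimal_free_resolution_def by (elim conjE)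

lemma aug_piece: "v \<in> fc_piece L 0 \<gamma> \<Longrightarrow> \<epsilon> v \<in> poly_piece \<gamma>"
  using res unfolding minimal_free_resolution_def by (elim conjE) (simp add: image_subset_iff)

lemma aug_image: "\<epsilon> ` carrier (fc_module L 0) = J"
  using res unfolding minimal_free_resolution_def by (elim conjE)

lemma aug_kernel: "{v \<in> carrier (fc_module L 0). \<epsilon> v = 0} = fc_diff L 0 ` carrier (fc_module L (Suc 0))"
  using res unfolding minimal_free_resolution_def One_nat_def by (elim conjE)

lemma fc_diff_kernel:
  "{v \<in> carrier (fc_module L (Suc j)). fc_diff L j v = (\<lambda>_. 0)} = fc_diff L (Suc j) ` carrier (fc_module L (Suc (Suc j)))"
  using res unfolding minimal_free_resolution_def by (elim conjE) (erule spec)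

lemma fc_diff_minimal: "v \<in> carrier (fc_module L (Suc j)) \<Longrightarrow> fc_diff L j v b \<in> face_prime (\<lambda>_. 1)"
  using res unfolding minimal_free_resolution_def by (elim conjE) (simp only: ball_simps)

lemma fc_diff_carrier: "u \<in> carrier (fc_module L (Suc j)) \<Longrightarrow> fc_diff L j u \<in> carrier (fc_module L j)"
  using fc_diff_hom unfolding module_homs_def by blast

lemma unit_vector_piece: "b \<in> fc_basis L j \<Longrightarrow> unit_vector b \<in> fc_piece L j (fc_deg L j b)"
  unfolding fc_piece_def mem_Collect_eq
  by (intro conjI unit_vector_carrier) (auto simp: poly_piece_def unit_vector_def zero_fun_def fun_diff_def)

lemma fc_diff_unit_piece:
  "b' \<in> fc_basis L (Suc j) \<Longrightarrow> fc_diff L j (unit_vector b') b \<in> poly_piece (fc_deg L (Suc j) b' - fc_deg L j b)"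
  using fc_diff_piece[OF unit_vector_piece[of b' "Suc j"]] by (simp add: fc_piece_def)

lemma aug_unit_piece: "b \<in> fc_basis L 0 \<Longrightarrow> \<epsilon> (unit_vector b) \<in> poly_piece (fc_deg L 0 b)"
  by (intro aug_piece unit_vector_piece)

lemma coefficient_fc_diff:
  assumes u: "u \<in> carrier (fc_module L (Suc j))" and b: "b \<in> fc_basis L j" "fc_deg L j b \<le> \<gamma>"
  shows "coefficient L j \<gamma> (fc_diff L j u) b = (\<Sum>b'\<in>fc_basis L (Suc j). monomial_matrix L j b b' * coefficient L (Suc j) \<gamma> u b')"
proof -
  have "fc_diff L j u b = (\<Sum>b'\<in>fc_basis L (Suc j). u b' * fc_diff L j (unit_vector b') b)"
  proof (rule linear_on_free_module[OF fin_basis _ _ u, where F = "\<lambda>u. fc_diff L j u b"])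
    fix v w assume "v \<in> carrier (fc_module L (Suc j))" "w \<in> carrier (fc_module L (Suc j))"
    then have "fc_diff L j (v \<oplus>\<^bsub>fc_module L (Suc j)\<^esub> w) = fc_diff L j v \<oplus>\<^bsub>fc_module L j\<^esub> fc_diff L j w"
      using fc_diff_hom[of j] by (auto simp: module_homs_def)
    then show "fc_diff L j (\<lambda>b. v b + w b) b = fc_diff L j v b + fc_diff L j w b"
      by (simp add: fc_module_def)
  next
    fix p v assume "v \<in> carrier (fc_module L (Suc j))"
    then have "fc_diff L j (p \<odot>\<^bsub>fc_module L (Suc j)\<^esub> v) = p \<odot>\<^bsub>fc_module L j\<^esub> fc_diff L j v"
      using fc_diff_hom[of j] by (auto simp: module_homs_def)
    then show "fc_diff L j (\<lambda>b. p * v b) b = p * fc_diff L j v b"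
      by (simp add: fc_module_def)
  qed
  from lookup_graded_linear[where F = "\<lambda>u. fc_diff L j u b", OF this fc_diff_unit_piece b(2)]
  show ?thesis
    using b by (simp add: coefficient_def[of L j] monomial_matrix_def unit_vector_def)
qed

definition augmentation :: "'b \<Rightarrow> 'k" where
  "augmentation b = Poly_Mapping.lookup (\<epsilon> (unit_vector b)) (\<lambda>i. nat (fc_deg L 0 b i))"

lemma lookup_aug:
  assumes u: "u \<in> carrier (fc_module L 0)" and \<gamma>: "0 \<le> \<gamma>"
  shows "Poly_Mapping.lookup (\<epsilon> u) (\<lambda>i. nat (\<gamma> i)) = (\<Sum>b\<in>fc_basis L 0. augmentation b * coefficient L 0 \<gamma> u b)"
proof -
  have "\<epsilon> u = (\<Sum>b'\<in>fc_basis L 0. u b' * \<epsilon> (unit_vector b'))"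
  proof (rule linear_on_free_module[OF fin_basis _ _ u])
    fix v w assume "v \<in> carrier (fc_module L 0)" "w \<in> carrier (fc_module L 0)"
    then have "\<epsilon> (v \<oplus>\<^bsub>fc_module L 0\<^esub> w) = \<epsilon> v \<oplus>\<^bsub>poly_module\<^esub> \<epsilon> w"
      using aug_hom by (auto simp: module_homs_def)
    then show "\<epsilon> (\<lambda>b. v b + w b) = \<epsilon> v + \<epsilon> w"
      by (simp add: fc_module_def poly_module_def)
  next
    fix p v assume "v \<in> carrier (fc_module L 0)"
    then have "\<epsilon> (p \<odot>\<^bsub>fc_module L 0\<^esub> v) = p \<odot>\<^bsub>poly_module\<^esub> \<epsilon> v"
      using aug_hom by (auto simp: module_homs_def)
    then show "\<epsilon> (\<lambda>b. p * v b) = p * \<epsilon> v"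
      by (simp add: fc_module_def poly_module_def)
  qed
  from lookup_graded_linear[where F = \<epsilon> and \<eta> = 0, OF this _ \<gamma>]
  show ?thesis using aug_unit_piece by (simp add: augmentation_def)
qed

lemma monomial_matrix_deg:
  assumes b: "b' \<in> fc_basis L (Suc j)" and nz: "monomial_matrix L j b b' \<noteq> 0"
  shows "fc_deg L j b \<le> fc_deg L (Suc j) b' \<and> fc_deg L j b \<noteq> fc_deg L (Suc j) b'"
proof -
  let ?p = "fc_diff L j (unit_vector b') b"
  have key: "(\<lambda>i. nat (fc_deg L (Suc j) b' i - fc_deg L j b i)) \<in> Poly_Mapping.keys ?p"
    using nz by (simp add: monomial_matrix_def unit_vector_def in_keys_iff)
  then have "?p \<noteq> 0" by auto
  then have le: "0 \<le> fc_deg L (Suc j) b' - fc_deg L j b"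
    using poly_piece_eq[OF fc_diff_unit_piece[OF b]] by metis
  have "?p \<in> face_prime (\<lambda>_. 1)"
    using fc_diff_minimal unit_vector_carrier[OF b] by blast
  then have "face (\<lambda>_. 1) \<inter> support (\<lambda>i. nat (fc_deg L (Suc j) b' i - fc_deg L j b i)) \<noteq> {}"
    using key unfolding face_prime_eq by blast
  then show ?thesis using le by (auto simp: support_def le_fun_def)
qed

lemma sum_unit: "b' \<in> fc_basis L j \<Longrightarrow> (\<Sum>b\<in>fc_basis L j. h b * (if b = b' then 1 else 0)) = (h b' :: 'k)"
  using fin_basis[of j] by (simp add: sum_times_delta)

text \<open>
  Exactness is transferred by taking a homogeneous vector with the given scalars, lifting it in the
  resolution and keeping only the coordinates of the same degree.
\<close>
lemma scalar_resolution_of_minimal: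
  assumes J: "J = {p. \<forall>a\<in>Poly_Mapping.keys p. cov (support a)}"
  shows "scalar_resolution (fc_basis L) (fc_deg L) (monomial_matrix L) augmentation cov"
proof
  show "finite (fc_basis L j)" for j by (rule fin_basis)
  show "fc_deg L j b \<le> fc_deg L (Suc j) b' \<and> fc_deg L j b \<noteq> fc_deg L (Suc j) b'"
    if "b' \<in> fc_basis L (Suc j)" "monomial_matrix L j b b' \<noteq> 0" for j b b'
    using monomial_matrix_deg that by blast
  show aug_nonneg: "0 \<le> fc_deg L 0 b" if "b \<in> fc_basis L 0" "augmentation b \<noteq> 0" for b
  proof -
    have "\<epsilon> (unit_vector b) \<noteq> 0" using that by (auto simp: augmentation_def)
    then show ?thesis using poly_piece_eq[OF aug_unit_piece[OF that(1)]] by metis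
  qed
  show "(\<Sum>b'\<in>fc_basis L (Suc j). monomial_matrix L j b b' * monomial_matrix L (Suc j) b' b'') = 0"
    if b: "b \<in> fc_basis L j" and b'': "b'' \<in> fc_basis L (Suc (Suc j))" for j b b''
  proof (cases "fc_deg L j b \<le> fc_deg L (Suc (Suc j)) b''")
    case True
    let ?\<gamma> = "fc_deg L (Suc (Suc j)) b''"
    let ?u = "fc_diff L (Suc j) (unit_vector b'')"
    have u: "?u \<in> carrier (fc_module L (Suc j))" using fc_diff_carrier unit_vector_carrier[OF b''] by blast
    have "fc_diff L j ?u = (\<lambda>_. 0)"
      using fc_diff_square unit_vector_carrier[OF b''] by blast
    then have "0 = (\<Sum>b'\<in>fc_basis L (Suc j). monomial_matrix L j b b' * coefficient L (Suc j) ?\<gamma> ?u b')"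
      using coefficient_fc_diff[OF u b True] by simp
    also have "\<dots> = (\<Sum>b'\<in>fc_basis L (Suc j). monomial_matrix L j b b' * monomial_matrix L (Suc j) b' b'')"
    proof (rule sum.cong[OF refl])
      fix b' assume b': "b' \<in> fc_basis L (Suc j)"
      show "monomial_matrix L j b b' * coefficient L (Suc j) ?\<gamma> ?u b' = monomial_matrix L j b b' * monomial_matrix L (Suc j) b' b''"
      proof (cases "fc_deg L (Suc j) b' \<le> ?\<gamma>")
        case True
        then show ?thesis
          using coefficient_fc_diff[OF unit_vector_carrier[OF b''] b' True] b''
          by (simp add: coefficient_unit_vector sum_unit)
      next
        case False
        then show ?thesis using monomial_matrix_deg[OF b'', of b'] by (auto simp: coefficient_def)
      qed
    qed
    finally show ?thesis by simp
  next
    case False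
    have "monomial_matrix L j b b' * monomial_matrix L (Suc j) b' b'' = 0" if b': "b' \<in> fc_basis L (Suc j)" for b'
      using monomial_matrix_deg[OF b', of b] monomial_matrix_deg[OF b'', of b'] False by (auto dest: order_trans)
    then show ?thesis by (intro sum.neutral) blast
  qed
  show "(\<Sum>b\<in>fc_basis L 0. augmentation b * monomial_matrix L 0 b b') = 0"
    if b': "b' \<in> fc_basis L (Suc 0)" for b'
  proof (cases "0 \<le> fc_deg L (Suc 0) b'")
    case True
    let ?\<gamma> = "fc_deg L (Suc 0) b'"
    let ?u = "fc_diff L 0 (unit_vector b')"
    have u: "?u \<in> carrier (fc_module L 0)" using fc_diff_carrier unit_vector_carrier[OF b'] by blast
    have "\<epsilon> ?u = 0"
      using unit_vector_carrier[OF b'] aug_kernel by blast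
    then have "0 = (\<Sum>b\<in>fc_basis L 0. augmentation b * coefficient L 0 ?\<gamma> ?u b)"
      using lookup_aug[OF u True] by simp
    also have "\<dots> = (\<Sum>b\<in>fc_basis L 0. augmentation b * monomial_matrix L 0 b b')"
    proof (rule sum.cong[OF refl])
      fix b assume b: "b \<in> fc_basis L 0"
      show "augmentation b * coefficient L 0 ?\<gamma> ?u b = augmentation b * monomial_matrix L 0 b b'"
      proof (cases "fc_deg L 0 b \<le> ?\<gamma>")
        case True
        then show ?thesis
          using coefficient_fc_diff[OF unit_vector_carrier[OF b'] b True] b'
          by (simp add: coefficient_unit_vector sum_unit)
      next
        case False
        then show ?thesis using monomial_matrix_deg[OF b', of b] by (auto simp: coefficient_def)
      qed
    qed
    finally show ?thesis by simp
  next
    case False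
    have "augmentation b * monomial_matrix L 0 b b' = 0" if b: "b \<in> fc_basis L 0" for b
      using monomial_matrix_deg[OF b', of b] aug_nonneg[OF b] False by (auto dest: order_trans)
    then show ?thesis by (intro sum.neutral) blast
  qed
  have supp_eq: "support (\<lambda>i. nat (\<gamma> i)) = {i. 0 < \<gamma> i}" for \<gamma> :: "'n deg"
    by (auto simp: support_def)
  show "cov {i. 0 < \<gamma> i}"
    if f: "\<And>b. f b \<noteq> 0 \<Longrightarrow> b \<in> fc_basis L 0 \<and> fc_deg L 0 b \<le> \<gamma>"
      and nz: "(\<Sum>b\<in>fc_basis L 0. augmentation b * f b) \<noteq> 0" for f \<gamma>
  proof -
    obtain b where b: "b \<in> fc_basis L 0" "augmentation b * f b \<noteq> 0"
      using nz by (meson sum.not_neutral_contains_not_neutral)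
    then have "0 \<le> fc_deg L 0 b" "fc_deg L 0 b \<le> \<gamma>" using aug_nonneg f by auto
    then have \<gamma>: "0 \<le> \<gamma>" by (rule order_trans)
    let ?u = "homogeneous_vector L 0 \<gamma> f"
    have "Poly_Mapping.lookup (\<epsilon> ?u) (\<lambda>i. nat (\<gamma> i)) = (\<Sum>b\<in>fc_basis L 0. augmentation b * f b)"
      by (simp add: lookup_aug[OF _ \<gamma>] coefficient_homogeneous_vector[OF f])
    then have "(\<lambda>i. nat (\<gamma> i)) \<in> Poly_Mapping.keys (\<epsilon> ?u)" using nz by (simp add: in_keys_iff)
    moreover have "\<epsilon> ?u \<in> J" using aug_image by auto
    ultimately show ?thesis unfolding J by (auto simp flip: supp_eq)
  qed
  show "\<exists>f. (\<forall>b. f b \<noteq> 0 \<longrightarrow> b \<in> fc_basis L 0 \<and> fc_deg L 0 b \<le> \<gamma>) \<and> (\<Sum>b\<in>fc_basis L 0. augmentation b * f b) = 1"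
    if \<gamma>: "0 \<le> \<gamma>" and cov: "cov {i. 0 < \<gamma> i}" for \<gamma>
  proof -
    have "Poly_Mapping.single (\<lambda>i. nat (\<gamma> i)) 1 \<in> J" unfolding J using cov by (simp add: supp_eq)
    then have "Poly_Mapping.single (\<lambda>i. nat (\<gamma> i)) 1 \<in> \<epsilon> ` carrier (fc_module L 0)"
      by (simp only: aug_image)
    then obtain u where u: "u \<in> carrier (fc_module L 0)" "\<epsilon> u = Poly_Mapping.single (\<lambda>i. nat (\<gamma> i)) 1"
      by (elim imageE) simp
    have "(\<Sum>b\<in>fc_basis L 0. augmentation b * coefficient L 0 \<gamma> u b) = 1"
      using lookup_aug[OF u(1) \<gamma>] by (simp add: u(2))
    moreover have "\<forall>b. coefficient L 0 \<gamma> u b \<noteq> 0 \<longrightarrow> b \<in> fc_basis L 0 \<and> fc_deg L 0 b \<le> \<gamma>"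
      by (simp add: coefficient_def)
    ultimately show ?thesis by blast
  qed
  have boundary: "(\<Sum>b'\<in>fc_basis L (Suc j). monomial_matrix L j b b' * coefficient L (Suc j) \<gamma> w b') = coefficient L j \<gamma> (fc_diff L j w) b"
    if w: "w \<in> carrier (fc_module L (Suc j))" and b: "b \<in> fc_basis L j" for j \<gamma> w b
  proof (cases "fc_deg L j b \<le> \<gamma>")
    case True
    then show ?thesis using coefficient_fc_diff[OF w b True] by simp
  next
    case False
    have "monomial_matrix L j b b' * coefficient L (Suc j) \<gamma> w b' = 0" if "b' \<in> fc_basis L (Suc j)" for b'
      using monomial_matrix_deg[OF that, of b] False by (auto simp: coefficient_def dest: order_trans)
    then have "(\<Sum>b'\<in>fc_basis L (Suc j). monomial_matrix L j b b' * coefficient L (Suc j) \<gamma> w b') = 0"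
      by (rule sum.neutral[OF ballI])
    then show ?thesis using False by (simp add: coefficient_def[of L j])
  qed
  have lift: "\<exists>g. (\<forall>b. g b \<noteq> 0 \<longrightarrow> b \<in> fc_basis L (Suc j) \<and> fc_deg L (Suc j) b \<le> \<gamma>) \<and>
       (\<forall>b\<in>fc_basis L j. (\<Sum>b'\<in>fc_basis L (Suc j). monomial_matrix L j b b' * g b') = f b)"
    if f: "\<And>b. f b \<noteq> 0 \<Longrightarrow> b \<in> fc_basis L j \<and> fc_deg L j b \<le> \<gamma>"
      and w: "w \<in> carrier (fc_module L (Suc j))" "fc_diff L j w = homogeneous_vector L j \<gamma> f" for j f \<gamma> w
  proof (intro exI[of _ "coefficient L (Suc j) \<gamma> w"] conjI allI impI ballI)
    fix b assume "coefficient L (Suc j) \<gamma> w b \<noteq> 0"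
    then show "b \<in> fc_basis L (Suc j)" "fc_deg L (Suc j) b \<le> \<gamma>" by (auto simp: coefficient_def split: if_splits)
  next
    fix b assume "b \<in> fc_basis L j"
    then show "(\<Sum>b'\<in>fc_basis L (Suc j). monomial_matrix L j b b' * coefficient L (Suc j) \<gamma> w b') = f b"
      by (simp add: boundary[OF w(1)] w(2) coefficient_homogeneous_vector[OF f])
  qed
  show "\<exists>g. (\<forall>b. g b \<noteq> 0 \<longrightarrow> b \<in> fc_basis L (Suc 0) \<and> fc_deg L (Suc 0) b \<le> \<gamma>) \<and>
       (\<forall>b\<in>fc_basis L 0. (\<Sum>b'\<in>fc_basis L (Suc 0). monomial_matrix L 0 b b' * g b') = f b)"
    if f: "\<And>b. f b \<noteq> 0 \<Longrightarrow> b \<in> fc_basis L 0 \<and> fc_deg L 0 b \<le> \<gamma>"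
      and z: "(\<Sum>b\<in>fc_basis L 0. augmentation b * f b) = 0" for f \<gamma>
  proof -
    let ?u = "homogeneous_vector L 0 \<gamma> f"
    have "\<epsilon> ?u = 0"
    proof (rule poly_mapping_eqI)
      fix a :: "'n \<Rightarrow> nat"
      have "Poly_Mapping.lookup (\<epsilon> ?u) (\<lambda>i. nat (int (a i))) = 0"
      proof (subst lookup_aug)
        show "0 \<le> (\<lambda>i. int (a i))" by (simp add: le_fun_def)
        show "(\<Sum>b\<in>fc_basis L 0. augmentation b * coefficient L 0 (\<lambda>i. int (a i)) ?u b) = 0"
          by (cases "(\<lambda>i. int (a i)) = \<gamma>") (use z in \<open>simp_all add: coefficient_homogeneous_vector[OF f]\<close>)
      qed simp
      then show "Poly_Mapping.lookup (\<epsilon> ?u) a = Poly_Mapping.lookup 0 a" by simp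
    qed
    then have "?u \<in> fc_diff L 0 ` carrier (fc_module L (Suc 0))"
      using homogeneous_vector_carrier[of L 0 \<gamma> f] aug_kernel by blast
    then obtain w where "w \<in> carrier (fc_module L (Suc 0))" "fc_diff L 0 w = ?u" by auto
    then show ?thesis using lift[OF f] by blast
  qed
  show "\<exists>g. (\<forall>b. g b \<noteq> 0 \<longrightarrow> b \<in> fc_basis L (Suc (Suc j)) \<and> fc_deg L (Suc (Suc j)) b \<le> \<gamma>) \<and>
       (\<forall>b\<in>fc_basis L (Suc j). (\<Sum>b'\<in>fc_basis L (Suc (Suc j)). monomial_matrix L (Suc j) b b' * g b') = f b)"
    if f: "\<And>b. f b \<noteq> 0 \<Longrightarrow> b \<in> fc_basis L (Suc j) \<and> fc_deg L (Suc j) b \<le> \<gamma>"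
      and z: "\<And>b. b \<in> fc_basis L j \<Longrightarrow> (\<Sum>b'\<in>fc_basis L (Suc j). monomial_matrix L j b b' * f b') = 0" for f j \<gamma>
  proof -
    let ?u = "homogeneous_vector L (Suc j) \<gamma> f"
    have "fc_diff L j ?u = (\<lambda>_. 0)"
    proof (rule zero_if_coefficients_zero)
      show "fc_diff L j ?u \<in> carrier (fc_module L j)" by (rule fc_diff_carrier) simp
      fix \<gamma>' b
      show "coefficient L j \<gamma>' (fc_diff L j ?u) b = 0"
      proof (cases "b \<in> fc_basis L j")
        case True
        then show ?thesis
          using z[OF True] by (cases "\<gamma>' = \<gamma>") (simp_all add: boundary[symmetric] coefficient_homogeneous_vector[OF f])
      qed (simp add: coefficient_def)
    qed
    then have "?u \<in> fc_diff L (Suc j) ` carrier (fc_module L (Suc (Suc j)))"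
      using homogeneous_vector_carrier[of L "Suc j" \<gamma> f] fc_diff_kernel[of j] by blast
    then obtain w where "w \<in> carrier (fc_module L (Suc (Suc j)))" "fc_diff L (Suc j) w = ?u" by auto
    then show ?thesis using lift[OF f] by blast
  qed
qed

end

section \<open>Gluing the resolution to cochains on sets of generators\<close>
text \<open>
  In the intended use \<open>vs t\<close> is the set of variables of the \<open>t\<close>-th of \<open>m\<close> generators, and these
  are the cochains of the Cech complex in the degrees with set \<open>N\<close> of negative coordinates.
\<close>
definition cochain :: "nat \<Rightarrow> (nat \<Rightarrow> 'n set) \<Rightarrow> 'n set \<Rightarrow> nat \<Rightarrow> (nat set \<Rightarrow> 'k::field) \<Rightarrow> bool" where
  "cochain m vs N r c \<longleftrightarrow> (\<forall>S. c S \<noteq> 0 \<longrightarrow> S \<subseteq> {..<m} \<and> card S = r \<and> N \<subseteq> \<Union> (vs ` S))"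

definition closed_cochain :: "nat \<Rightarrow> (nat \<Rightarrow> 'n set) \<Rightarrow> 'n set \<Rightarrow> nat \<Rightarrow> (nat set \<Rightarrow> 'k::field) \<Rightarrow> bool" where
  "closed_cochain m vs N r c \<longleftrightarrow> cochain m vs N r c \<and> (\<forall>T\<subseteq>{..<m}. koszul c T = 0)"

definition exact_cochain :: "nat \<Rightarrow> (nat \<Rightarrow> 'n set) \<Rightarrow> 'n set \<Rightarrow> nat \<Rightarrow> (nat set \<Rightarrow> 'k::field) \<Rightarrow> bool" where
  "exact_cochain m vs N r c \<longleftrightarrow> (case r of 0 \<Rightarrow> c = (\<lambda>_. 0)
     | Suc q \<Rightarrow> \<exists>e. cochain m vs N q e \<and> c = (\<lambda>T. if T \<subseteq> {..<m} then koszul e T else 0))"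

text \<open>
  The hypothesis says that the set \<open>V\<^sub>\<tau>\<close> of generators without a variable in \<open>\<tau>\<close> is empty exactly
  if the resolved ideal is nonzero in degree \<open>\<tau>\<close>.
\<close>
locale gluing = scalar_resolution B \<delta> A aug cov
  for B :: "nat \<Rightarrow> 'b set" and \<delta> :: "nat \<Rightarrow> 'b \<Rightarrow> ('n::{finite,linorder}) deg"
    and A :: "nat \<Rightarrow> 'b \<Rightarrow> 'b \<Rightarrow> 'k::field" and aug cov +
  fixes m :: nat and vs :: "nat \<Rightarrow> 'n set"
  assumes cov_iff: "cov N \<longleftrightarrow> (\<forall>t<m. N \<inter> vs t \<noteq> {})"
begin

text \<open>
  The cells are the sets \<open>S\<close> of generators, in degree \<open>card S \<ge> 0\<close>, and the basis elements \<open>b\<close> of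
  \<open>L\<^sub>j\<close>, in degree \<open>-1 - j\<close>; the two parts are glued by the augmentation \<open>L\<^sub>0 \<rightarrow> k\<^bsup>{\<emptyset>}\<^esup>\<close>.  The
  index \<open>j\<close> is kept because different \<open>L\<^sub>j\<close> may use the same basis elements.
\<close>
definition cells :: "(nat set + nat \<times> 'b) set" where
  "cells = Inl ` {S. S \<subseteq> {..<m}} \<union> Inr ` {(j, b). b \<in> B j}"

definition cell_deg :: "nat set + nat \<times> 'b \<Rightarrow> int" where
  "cell_deg x = (case x of Inl S \<Rightarrow> int (card S) | Inr (j, b) \<Rightarrow> - 1 - int j)"

definition cell_lo :: "nat set + nat \<times> 'b \<Rightarrow> 'n set" where
  "cell_lo x = (case x of Inl S \<Rightarrow> {} | Inr (j, b) \<Rightarrow> face (\<delta> j b))"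

definition cell_hi :: "nat set + nat \<times> 'b \<Rightarrow> 'n set" where
  "cell_hi x = (case x of Inl S \<Rightarrow> - \<Union> (vs ` S) | Inr _ \<Rightarrow> UNIV)"

definition cell_diff :: "(nat set + nat \<times> 'b \<Rightarrow> 'k) \<Rightarrow> nat set + nat \<times> 'b \<Rightarrow> 'k" where
  "cell_diff f x = (case x of
     Inl T \<Rightarrow> if T \<subseteq> {..<m} then koszul (\<lambda>S. f (Inl S)) T + (if T = {} then \<Sum>b\<in>B 0. aug b * f (Inr (0, b)) else 0) else 0
   | Inr (j, b) \<Rightarrow> if b \<in> B j then \<Sum>b'\<in>B (Suc j). A j b b' * f (Inr (Suc j, b')) else 0)"

lemma cell_simps [simp]:
  "Inl S \<in> cells \<longleftrightarrow> S \<subseteq> {..<m}" "Inr (j, b) \<in> cells \<longleftrightarrow> b \<in> B j"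
  "cell_deg (Inl S) = int (card S)" "cell_deg (Inr (j, b)) = - 1 - int j"
  "cell_lo (Inl S) = {}" "cell_lo (Inr (j, b)) = face (\<delta> j b)"
  "cell_hi (Inl S) = - \<Union> (vs ` S)" "cell_hi (Inr p) = UNIV"
  "cell_diff f (Inl T) = (if T \<subseteq> {..<m} then koszul (\<lambda>S. f (Inl S)) T + (if T = {} then \<Sum>b\<in>B 0. aug b * f (Inr (0, b)) else 0) else 0)"
  "cell_diff f (Inr (j, b)) = (if b \<in> B j then \<Sum>b'\<in>B (Suc j). A j b b' * f (Inr (Suc j, b')) else 0)"
  by (auto simp: cells_def cell_deg_def cell_lo_def cell_hi_def cell_diff_def)

lemma cell_cases [case_names cochain basis]:
  fixes x :: "nat set + nat \<times> 'b"
  obtains S where "x = Inl S" | j b where "x = Inr (j, b)"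
  by (metis sumE surj_pair)

lemma degree_le_iff: "b \<in> B j \<Longrightarrow> \<gamma> \<in> cube \<Longrightarrow> \<delta> j b \<le> \<gamma> \<longleftrightarrow> face (\<delta> j b) \<subseteq> face \<gamma>"
  unfolding le_fun_def face_def subset_iff mem_Collect_eq
proof (rule iff_allI)
  fix i assume "b \<in> B j" "\<gamma> \<in> cube"
  then show "\<delta> j b i \<le> \<gamma> i \<longleftrightarrow> (\<delta> j b i \<noteq> 0 \<longrightarrow> \<gamma> i \<noteq> 0)"
    using degrees_squarefree[of b j i] by (auto simp: cube_def dest!: spec[of _ i])
qed

lemma face_inj: "\<alpha> \<in> cube \<Longrightarrow> \<beta> \<in> cube \<Longrightarrow> face \<alpha> = face \<beta> \<Longrightarrow> \<alpha> = \<beta>"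
  by (metis indicator_face)

lemma face_matrix:
  "\<lbrakk>b \<in> B j; b' \<in> B (Suc j); A j b b' \<noteq> 0\<rbrakk> \<Longrightarrow> face (\<delta> j b) \<subset> face (\<delta> (Suc j) b')"
  using matrix_deg[of b j b'] degree_le_iff[of b j "\<delta> (Suc j) b'"]
    face_inj[OF degree_in_cube[of b j] degree_in_cube[of b' "Suc j"]] degree_in_cube[of b' "Suc j"] by blast

lemma positive_indicator: "{i. 0 < indicator_deg N i} = N" "0 \<le> indicator_deg N"
  by (auto simp: indicator_deg_def le_fun_def)

lemma sum_nonzero: "sum f S \<noteq> (0::'k) \<Longrightarrow> \<exists>x\<in>S. f x \<noteq> 0"
  by (erule sum.not_neutral_contains_not_neutral) blast

text \<open>
  The simplex on a nonempty vertex set is acyclic, by contraction to a vertex \<open>v\<close>.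
\<close>
lemma cochain_exact:
  fixes f :: "nat set \<Rightarrow> 'k"
  assumes v: "v \<in> V" and V: "finite V" and supp: "\<And>S. f S \<noteq> 0 \<Longrightarrow> S \<subseteq> V \<and> card S = q"
    and closed: "\<And>T. T \<subseteq> V \<Longrightarrow> T \<noteq> {} \<Longrightarrow> koszul f T = 0"
  shows "\<exists>g. (\<forall>S. g S \<noteq> 0 \<longrightarrow> S \<subseteq> V \<and> Suc (card S) = q) \<and> (\<forall>T\<subseteq>V. koszul g T = f T)"
proof (intro exI conjI allI impI)
  let ?g = "\<lambda>S. if {} \<subseteq> S \<and> S \<subseteq> V \<and> v \<notin> S then koszul_sign v (insert v S) * f (insert v S) else 0"
  fix T
  { assume "T \<subseteq> V"
    then show "koszul ?g T = f T"
      using v V supp closed[of "insert v T"] by (intro koszul_contraction) (auto intro: finite_subset) }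
  { assume nz: "?g T \<noteq> 0"
    then have "f (insert v T) \<noteq> 0" "T \<subseteq> V" "v \<notin> T" by (auto split: if_splits)
    then show "T \<subseteq> V" "Suc (card T) = q"
      using supp[of "insert v T"] finite_subset[OF _ V] by auto }
qed

text \<open>
  The square of the row differential vanishes only at a fixed \<open>\<tau>\<close>: the composite
  \<open>L\<^sub>0 \<rightarrow> k\<^bsup>{\<emptyset>}\<^esup> \<rightarrow> k\<^bsup>V\<^esup>\<close> is zero there because the augmentation is nonzero only if
  \<open>V = V\<^sub>\<tau>\<close> is empty.
\<close>
sublocale double: corner_complex cells cell_deg cell_lo cell_hi cell_diff
proof
  fix f g :: "nat set + nat \<times> 'b \<Rightarrow> 'k" and y
  show "cell_diff (\<lambda>x. f x + g x) y = cell_diff f y + cell_diff g y"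
    by (cases y rule: cell_cases) (simp_all add: koszul_add distrib_left sum.distrib)
next
  fix f :: "nat set + nat \<times> 'b \<Rightarrow> 'k" and c y
  show "cell_diff (\<lambda>x. c * f x) y = c * cell_diff f y"
    by (cases y rule: cell_cases) (simp_all add: koszul_scale distrib_left mult.left_commute sum_distrib_left)
next
  fix f :: "nat set + nat \<times> 'b \<Rightarrow> 'k" and y assume nz: "cell_diff f y \<noteq> 0"
  show "y \<in> cells \<and> (\<exists>x\<in>cells. f x \<noteq> 0 \<and> cell_deg y = cell_deg x + 1 \<and> cell_lo y \<subseteq> cell_lo x \<and> cell_hi y \<subseteq> cell_hi x \<and>
     (cell_deg y < 0 \<longrightarrow> cell_lo y \<noteq> cell_lo x))"
  proof (cases y rule: cell_cases)
    case (cochain T)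
    have T: "T \<subseteq> {..<m}" using nz cochain by (auto split: if_splits)
    show ?thesis
    proof (cases "T = {}")
      case True
      then have "(\<Sum>b\<in>B 0. aug b * f (Inr (0, b))) \<noteq> 0" using nz cochain by simp
      then obtain b where "b \<in> B 0" "f (Inr (0, b)) \<noteq> 0" using sum_nonzero by fastforce
      then show ?thesis using cochain True by (intro conjI bexI[of _ "Inr (0, b)"]) auto
    next
      case False
      then obtain i where i: "i \<in> T" "f (Inl (T - {i})) \<noteq> 0"
        using nz cochain T koszul_nonzero[of "\<lambda>S. f (Inl S)" T] by auto
      have "card T = Suc (card (T - {i}))"
        using i finite_subset[OF T] by (metis card_Suc_Diff1 finite_lessThan)
      then show ?thesis using cochain i T by (intro conjI bexI[of _ "Inl (T - {i})"]) auto
    qed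
  next
    case (basis j b)
    have b: "b \<in> B j" using nz basis by (auto split: if_splits)
    then have "(\<Sum>b'\<in>B (Suc j). A j b b' * f (Inr (Suc j, b'))) \<noteq> 0" using nz basis by simp
    from sum_nonzero[OF this] obtain b' where b': "b' \<in> B (Suc j)" "A j b b' \<noteq> 0" "f (Inr (Suc j, b')) \<noteq> 0" by auto
    then show ?thesis using basis b face_matrix[OF b b'(1,2)] by (intro conjI bexI[of _ "Inr (Suc j, b')"]) auto
  qed
next
  fix x assume "x \<in> cells" "0 \<le> cell_deg x"
  then show "cell_lo x = {}" by (cases x rule: cell_cases) auto
next
  fix x assume "x \<in> cells" "cell_deg x < 0"
  then show "cell_hi x = UNIV" by (cases x rule: cell_cases) auto
next
  fix f :: "nat set + nat \<times> 'b \<Rightarrow> 'k" and \<tau> z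
  assume f: "\<And>x. f x \<noteq> 0 \<Longrightarrow> x \<in> cells \<and> cell_lo x \<subseteq> \<tau> \<and> \<tau> \<subseteq> cell_hi x" and z: "z \<in> cells" "\<tau> \<subseteq> cell_hi z"
  show "cell_diff (cell_diff f) z = 0"
  proof (cases z rule: cell_cases)
    case (cochain T)
    then have T: "T \<subseteq> {..<m}" using z by simp
    show ?thesis
    proof (cases "T = {}")
      case True
      have "(\<Sum>b\<in>B 0. aug b * cell_diff f (Inr (0, b)))
          = (\<Sum>b\<in>B 0. \<Sum>b'\<in>B (Suc 0). aug b * A 0 b b' * f (Inr (Suc 0, b')))"
        by (simp add: sum_distrib_left mult.assoc)
      also have "\<dots> = (\<Sum>b'\<in>B (Suc 0). (\<Sum>b\<in>B 0. aug b * A 0 b b') * f (Inr (Suc 0, b')))"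
        by (subst sum.swap) (simp add: sum_distrib_right)
      also have "\<dots> = 0" by (simp add: aug_matrix)
      finally show ?thesis using cochain True by simp
    next
      case False
      have "koszul (\<lambda>S. cell_diff f (Inl S)) T = koszul (koszul (\<lambda>S. f (Inl S))) T"
      proof (rule koszul_cong)
        fix i assume i: "i \<in> T"
        have "(\<Sum>b\<in>B 0. aug b * f (Inr (0, b))) = 0" if "T - {i} = {}"
        proof (rule ccontr)
          assume nz: "(\<Sum>b\<in>B 0. aug b * f (Inr (0, b))) \<noteq> 0"
          have "b \<in> B 0 \<and> \<delta> 0 b \<le> indicator_deg \<tau>" if "f (Inr (0, b)) \<noteq> 0" for b
            using f[OF that] degree_le_iff[of b 0 "indicator_deg \<tau>"] by simp
          then have "cov \<tau>" using aug_cov[of "\<lambda>b. f (Inr (0, b))" "indicator_deg \<tau>"] nz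
            by (simp add: positive_indicator)
          moreover have "i < m" "\<tau> \<inter> vs i = {}" using i T z cochain by auto
          ultimately show False by (simp add: cov_iff)
        qed
        then show "cell_diff f (Inl (T - {i})) = koszul (\<lambda>S. f (Inl S)) (T - {i})"
          using T by auto
      qed
      also have "\<dots> = 0" by (rule koszul_koszul) (use finite_subset[OF T] in simp)
      finally show ?thesis using cochain False T by simp
    qed
  next
    case (basis j b)
    have b: "b \<in> B j" using z basis by simp
    have "(\<Sum>b'\<in>B (Suc j). A j b b' * cell_diff f (Inr (Suc j, b')))
        = (\<Sum>b'\<in>B (Suc j). \<Sum>b''\<in>B (Suc (Suc j)). A j b b' * A (Suc j) b' b'' * f (Inr (Suc (Suc j), b'')))"
      by (simp add: sum_distrib_left mult.assoc)
    also have "\<dots> = (\<Sum>b''\<in>B (Suc (Suc j)). (\<Sum>b'\<in>B (Suc j). A j b b' * A (Suc j) b' b'') * f (Inr (Suc (Suc j), b'')))"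
      by (subst sum.swap) (simp add: sum_distrib_right)
    also have "\<dots> = 0" using b by (simp add: matrix_square)
    finally show ?thesis using basis b by simp
  qed
next
  fix f :: "nat set + nat \<times> 'b \<Rightarrow> 'k" and \<tau> q
  assume f: "\<And>x. f x \<noteq> 0 \<Longrightarrow> x \<in> cells \<and> cell_lo x \<subseteq> \<tau> \<and> \<tau> \<subseteq> cell_hi x \<and> cell_deg x = q"
    and df: "\<And>z. z \<in> cells \<Longrightarrow> \<tau> \<subseteq> cell_hi z \<Longrightarrow> cell_diff f z = 0"
  let ?goal = "\<exists>g. (\<forall>x. g x \<noteq> 0 \<longrightarrow> x \<in> cells \<and> cell_lo x \<subseteq> \<tau> \<and> \<tau> \<subseteq> cell_hi x \<and> cell_deg x = q - 1) \<and>
          (\<forall>z\<in>cells. \<tau> \<subseteq> cell_hi z \<longrightarrow> cell_diff g z = f z)"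
  let ?\<gamma> = "indicator_deg \<tau>"
  let ?V = "{t. t < m \<and> \<tau> \<inter> vs t = {}}"
  have face_le: "face (\<delta> j b) \<subseteq> \<tau> \<longleftrightarrow> \<delta> j b \<le> ?\<gamma>" if "b \<in> B j" for j b
    using degree_le_iff[OF that, of ?\<gamma>] by simp
  have V_iff: "S \<subseteq> ?V \<longleftrightarrow> Inl S \<in> cells \<and> \<tau> \<subseteq> cell_hi (Inl S)" for S
    by auto
  consider (nonneg) n where "q = int n" | (neg) j where "q = - int (Suc j)"
    by (rule int_cases)
  then show ?goal
  proof cases
    case (neg j)
    have fl: "f (Inl S) = 0" for S using f[of "Inl S"] neg by (cases "f (Inl S) = 0") auto
    have fr: "b \<in> B j \<and> \<delta> j b \<le> ?\<gamma> \<and> l = j" if "f (Inr (l, b)) \<noteq> 0" for l b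
      using f[OF that] neg face_le[of b l] by auto
    have "\<exists>g. (\<forall>b. g b \<noteq> 0 \<longrightarrow> b \<in> B (Suc j) \<and> \<delta> (Suc j) b \<le> ?\<gamma>) \<and>
        (\<forall>b\<in>B j. (\<Sum>b'\<in>B (Suc j). A j b b' * g b') = f (Inr (j, b)))"
    proof (cases j)
      case 0
      show ?thesis
        unfolding 0
        by (rule exact_0) (use fr 0 df[of "Inl {}"] in auto)
    next
      case (Suc l)
      show ?thesis
        unfolding Suc
      proof (rule exact_Suc)
        show "b \<in> B (Suc l) \<and> \<delta> (Suc l) b \<le> ?\<gamma>" if "f (Inr (Suc l, b)) \<noteq> 0" for b
          using fr[OF that] Suc by simp
        show "(\<Sum>b'\<in>B (Suc l). A l b b' * f (Inr (Suc l, b'))) = 0" if "b \<in> B l" for b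
          using df[of "Inr (l, b)"] that by simp
      qed
    qed
    then obtain g where g: "\<And>b. g b \<noteq> 0 \<Longrightarrow> b \<in> B (Suc j) \<and> \<delta> (Suc j) b \<le> ?\<gamma>"
      "\<And>b. b \<in> B j \<Longrightarrow> (\<Sum>b'\<in>B (Suc j). A j b b' * g b') = f (Inr (j, b))" by blast
    let ?g = "\<lambda>x :: nat set + nat \<times> 'b. case x of Inl S \<Rightarrow> 0 | Inr (l, b) \<Rightarrow> if l = Suc j then g b else 0"
    show ?goal
    proof (intro exI[of _ ?g] conjI allI impI ballI)
      fix x assume "?g x \<noteq> 0"
      then obtain b where "x = Inr (Suc j, b)" "g b \<noteq> 0" by (auto split: sum.splits if_splits)
      then show "x \<in> cells" "cell_lo x \<subseteq> \<tau>" "\<tau> \<subseteq> cell_hi x" "cell_deg x = q - 1"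
        using g(1)[of b] face_le[of b "Suc j"] neg by auto
    next
      fix z assume z: "z \<in> cells" "\<tau> \<subseteq> cell_hi z"
      show "cell_diff ?g z = f z"
      proof (cases z rule: cell_cases)
        case (cochain T)
        then show ?thesis using fl z by (simp add: koszul_eq_0)
      next
        case (basis l b)
        then show ?thesis using g(2)[of b] fr[of l b] z by (cases "l = j") auto
      qed
    qed
  next
    case (nonneg n)
    have fr: "f (Inr p) = 0" for p using f[of "Inr p"] nonneg by (cases p) fastforce
    have fl: "S \<subseteq> ?V \<and> card S = n" if "f (Inl S) \<noteq> 0" for S
      using f[OF that] V_iff[of S] nonneg by auto
    show ?goal
    proof (cases "?V = {}")
      case False
      then obtain v where v: "v \<in> ?V" by blast
      have "\<exists>g. (\<forall>S. g S \<noteq> 0 \<longrightarrow> S \<subseteq> ?V \<and> Suc (card S) = n) \<and> (\<forall>T\<subseteq>?V. koszul g T = f (Inl T))"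
      proof (rule cochain_exact[OF v _ fl])
        fix T assume T: "T \<subseteq> ?V" "T \<noteq> {}"
        then show "koszul (\<lambda>S. f (Inl S)) T = 0"
          using df[of "Inl T"] V_iff[of T] by (auto split: if_splits)
      qed simp_all
      then obtain g where g: "\<And>S. g S \<noteq> 0 \<Longrightarrow> S \<subseteq> ?V \<and> Suc (card S) = n" "\<And>T. T \<subseteq> ?V \<Longrightarrow> koszul g T = f (Inl T)"
        by blast
      let ?g = "\<lambda>x :: nat set + nat \<times> 'b. case x of Inl S \<Rightarrow> g S | Inr p \<Rightarrow> 0"
      show ?goal
      proof (intro exI[of _ ?g] conjI allI impI ballI)
        fix x assume "?g x \<noteq> 0"
        then obtain S where S: "x = Inl S" "g S \<noteq> 0" by (auto split: sum.splits)
        then show "x \<in> cells" "cell_lo x \<subseteq> \<tau>" "\<tau> \<subseteq> cell_hi x" "cell_deg x = q - 1"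
          using g(1)[of S] V_iff[of S] nonneg by auto
      next
        fix z assume z: "z \<in> cells" "\<tau> \<subseteq> cell_hi z"
        show "cell_diff ?g z = f z"
        proof (cases z rule: cell_cases)
          case (cochain T)
          then show ?thesis using g(2)[of T] V_iff[of T] z by auto
        next
          case (basis l b)
          then show ?thesis using fr by simp
        qed
      qed
    next
      case True
      then have cov: "cov \<tau>" by (auto simp: cov_iff)
      obtain u where u: "\<And>b. u b \<noteq> 0 \<Longrightarrow> b \<in> B 0 \<and> \<delta> 0 b \<le> ?\<gamma>" "(\<Sum>b\<in>B 0. aug b * u b) = 1"
        using cov_aug[of ?\<gamma>] cov by (auto simp: positive_indicator)
      let ?g = "\<lambda>x :: nat set + nat \<times> 'b. case x of Inl S \<Rightarrow> 0 | Inr (l, b) \<Rightarrow> if l = 0 then f (Inl {}) * u b else 0"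
      have aug: "(\<Sum>b\<in>B 0. aug b * ?g (Inr (0, b))) = f (Inl {})"
      proof -
        have "(\<Sum>b\<in>B 0. aug b * (f (Inl {}) * u b)) = f (Inl {}) * (\<Sum>b\<in>B 0. aug b * u b)"
          by (simp add: sum_distrib_left mult.left_commute)
        then show ?thesis using u(2) by simp
      qed
      show ?goal
      proof (intro exI[of _ ?g] conjI allI impI ballI)
        fix x assume "?g x \<noteq> 0"
        then obtain b where "x = Inr (0, b)" "u b \<noteq> 0" "f (Inl {}) \<noteq> 0" by (auto split: sum.splits if_splits)
        then show "x \<in> cells" "cell_lo x \<subseteq> \<tau>" "\<tau> \<subseteq> cell_hi x" "cell_deg x = q - 1"
          using u(1)[of b] face_le[of b 0] nonneg fl[of "{}"] by auto
      next
        fix z assume z: "z \<in> cells" "\<tau> \<subseteq> cell_hi z"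
        show "cell_diff ?g z = f z"
        proof (cases z rule: cell_cases)
          case (cochain T)
          then have "T = {}" using z V_iff[of T] True by simp
          then show ?thesis using aug cochain by simp
        next
          case (basis l b)
          then show ?thesis using fr by simp
        qed
      qed
    qed
  qed
qed

text \<open>
  The case distinction is needed because \<open>card N - r\<close> truncates.
\<close>
definition corner_basis :: "'n set \<Rightarrow> nat \<Rightarrow> 'b set" where
  "corner_basis N r = (if r \<le> card N then {b \<in> B (card N - r). face (\<delta> (card N - r) b) = N} else {})"

definition extend :: "(nat set \<Rightarrow> 'k) \<Rightarrow> nat set + nat \<times> 'b \<Rightarrow> 'k" where
  "extend c x = (case x of Inl S \<Rightarrow> c S | Inr _ \<Rightarrow> 0)"

text \<open>
  The value does not depend on the staircase chosen (lemma \<open>corner_value_staircase\<close>).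
\<close>
definition corner_value :: "'n set \<Rightarrow> nat \<Rightarrow> 'b \<Rightarrow> (nat set \<Rightarrow> 'k) \<Rightarrow> 'k" where
  "corner_value N r b c = (SOME y. double.staircase N r (extend c) y) N (Inr (card N - r, b))"

lemma extend_simps [simp]: "extend c (Inl S) = c S" "extend c (Inr p) = 0"
  by (simp_all add: extend_def)

lemma cocycle_extend: "closed_cochain m vs N r c \<longleftrightarrow> double.cocycle N r (extend c)"
proof
  assume c: "closed_cochain m vs N r c"
  show "double.cocycle N r (extend c)"
    unfolding double.cocycle_def
  proof (intro conjI allI impI ballI)
    fix x assume nz: "extend c x \<noteq> 0"
    then obtain S where S: "x = Inl S" "c S \<noteq> 0" by (cases x rule: cell_cases) auto
    then have "S \<subseteq> {..<m} \<and> card S = r \<and> N \<subseteq> \<Union> (vs ` S)"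
      using c by (simp add: closed_cochain_def cochain_def)
    then show "x \<in> cells" "cell_deg x = int r" "N \<inter> cell_hi x = {}"
      using S by auto
  next
    fix x assume "x \<in> cells"
    then show "cell_diff (extend c) x = 0"
      using c by (cases x rule: cell_cases) (auto simp: closed_cochain_def)
  qed
next
  assume c: "double.cocycle N r (extend c)"
  have "S \<subseteq> {..<m} \<and> card S = r \<and> N \<subseteq> \<Union> (vs ` S)" if "c S \<noteq> 0" for S
  proof -
    have "extend c (Inl S) \<noteq> 0" using that by simp
    then have "Inl S \<in> cells" "cell_deg (Inl S) = int r" "N \<inter> cell_hi (Inl S) = {}"
      using c unfolding double.cocycle_def by blast+
    then show ?thesis by auto
  qed
  moreover have "koszul c T = 0" if T: "T \<subseteq> {..<m}" for T
  proof -
    have "Inl T \<in> cells" using T by simp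
    then have "cell_diff (extend c) (Inl T) = 0" using c unfolding double.cocycle_def by blast
    then show ?thesis using T by (simp split: if_splits)
  qed
  ultimately show "closed_cochain m vs N r c" by (auto simp: closed_cochain_def cochain_def)
qed

lemma corner_value_staircase:
  assumes y: "double.staircase N r (extend c) y" and b: "b \<in> corner_basis N r"
  shows "corner_value N r b c = y N (Inr (card N - r, b))"
proof -
  have "double.staircase N r (extend c) (SOME y. double.staircase N r (extend c) y)"
    using someI[of "double.staircase N r (extend c)", OF y] .
  from double.corner_unique[OF this y] show ?thesis
    using b by (auto simp: corner_value_def corner_basis_def split: if_splits)
qed

lemma obtain_staircase:
  assumes "closed_cochain m vs N r c"
  obtains y where "double.staircase N r (extend c) y"
  using double.staircase_exists assms cocycle_extend by blast

lemma corner_value_add: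
  assumes "closed_cochain m vs N r c" "closed_cochain m vs N r c'" "b \<in> corner_basis N r"
  shows "corner_value N r b (\<lambda>S. c S + c' S) = corner_value N r b c + corner_value N r b c'"
proof -
  obtain y y' where y: "double.staircase N r (extend c) y" "double.staircase N r (extend c') y'"
    using assms obtain_staircase by metis
  have "extend (\<lambda>S. c S + c' S) = (\<lambda>x. extend c x + extend c' x)"
    by (auto simp: extend_def fun_eq_iff split: sum.splits)
  then show ?thesis
    using corner_value_staircase[OF _ assms(3)] y double.staircase_add[OF y] by simp
qed

lemma corner_value_scale:
  assumes "closed_cochain m vs N r c" "b \<in> corner_basis N r"
  shows "corner_value N r b (\<lambda>S. a * c S) = a * corner_value N r b c"
proof -
  obtain y where y: "double.staircase N r (extend c) y"
    using assms obtain_staircase by metis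
  have "extend (\<lambda>S. a * c S) = (\<lambda>x. a * extend c x)"
    by (auto simp: extend_def fun_eq_iff split: sum.splits)
  then show ?thesis
    using corner_value_staircase[of N r "\<lambda>S. a * c S" "\<lambda>\<tau> x. a * y \<tau> x" b] assms(2)
      corner_value_staircase[OF y assms(2)] double.staircase_scale[OF y, of a] by simp
qed

lemma corner_basis_cell:
  assumes y: "double.homogeneous (int r - 1) y" and x: "x \<in> cells" "cell_deg x < 0" "cell_lo x = N" "y N x \<noteq> 0"
  shows "\<exists>b\<in>corner_basis N r. x = Inr (card N - r, b)"
proof (cases x rule: cell_cases)
  case (cochain S)
  then show ?thesis using x by simp
next
  case (basis j b)
  have "cell_deg x + int (card N) = int r - 1" using double.homogeneousD[OF y x(4)] by simp
  then have "card N = r + j" using basis by simp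
  then show ?thesis using basis x by (auto simp: corner_basis_def)
qed

text \<open>
  Together with surjectivity below: the corner values identify the cohomology of \<open>C\<^sub>N\<close> with the
  scalar functions on \<open>corner_basis N r\<close>.
\<close>
lemma corner_value_exact_iff:
  assumes c: "closed_cochain m vs N r c"
  shows "(\<forall>b\<in>corner_basis N r. corner_value N r b c = 0) \<longleftrightarrow> exact_cochain m vs N r c"
proof
  obtain y where y: "double.staircase N r (extend c) y" using c obtain_staircase by metis
  then have hom: "double.homogeneous (int r - 1) y" by (simp add: double.staircase_def)
  assume z: "\<forall>b\<in>corner_basis N r. corner_value N r b c = 0"
  have "y N x = 0" if "x \<in> cells" "cell_deg x < 0" "cell_lo x = N" for x
    using corner_basis_cell[OF hom that] z corner_value_staircase[OF y] by fastforce
  from double.coboundary_if_corner_vanishes[OF y this] obtain e where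
    e: "\<And>x. e x \<noteq> 0 \<Longrightarrow> x \<in> cells \<and> 0 \<le> cell_deg x \<and> cell_deg x = int r - 1 \<and> N \<inter> cell_hi x = {}"
      "\<And>x. x \<in> cells \<Longrightarrow> cell_diff e x = extend c x" by blast
  have eR: "e (Inr p) = 0" for p
    using e(1)[of "Inr p"] by (cases p) fastforce
  have eL: "S \<subseteq> {..<m} \<and> int (card S) = int r - 1 \<and> N \<subseteq> \<Union> (vs ` S)" if "e (Inl S) \<noteq> 0" for S
    using e(1)[OF that] by auto
  have ce: "c T = (if T \<subseteq> {..<m} then koszul (\<lambda>S. e (Inl S)) T else 0)" for T
  proof (cases "T \<subseteq> {..<m}")
    case True
    then show ?thesis using e(2)[of "Inl T"] eR by (auto split: if_splits)
  next
    case False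
    then show ?thesis using c by (auto simp: closed_cochain_def cochain_def)
  qed
  show "exact_cochain m vs N r c"
  proof (cases r)
    case 0
    then have "e (Inl S) = 0" for S using eL[of S] by (cases "e (Inl S) = 0") auto
    then have "c T = 0" for T using ce[of T] by (auto intro: koszul_eq_0)
    then show ?thesis using 0 by (simp add: exact_cochain_def fun_eq_iff)
  next
    case (Suc q)
    have "cochain m vs N q (\<lambda>S. e (Inl S))" using eL Suc by (auto simp: cochain_def)
    then show ?thesis using ce Suc by (auto simp: exact_cochain_def fun_eq_iff intro!: exI[of _ "\<lambda>S. e (Inl S)"])
  qed
next
  obtain y where y: "double.staircase N r (extend c) y" using c obtain_staircase by metis
  assume ex: "exact_cochain m vs N r c"
  have "\<exists>e. (\<forall>S. e S \<noteq> 0 \<longrightarrow> S \<subseteq> {..<m} \<and> int (card S) = int r - 1 \<and> N \<subseteq> \<Union> (vs ` S)) \<and>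
      (\<forall>T\<subseteq>{..<m}. koszul e T = c T)"
  proof (cases r)
    case 0
    then have "c = (\<lambda>_. 0)" using ex by (simp add: exact_cochain_def)
    then show ?thesis by (intro exI[of _ "\<lambda>_. 0"]) (auto intro: koszul_eq_0)
  next
    case (Suc q)
    then obtain e where "cochain m vs N q e" "c = (\<lambda>T. if T \<subseteq> {..<m} then koszul e T else 0)"
      using ex by (auto simp: exact_cochain_def)
    then show ?thesis using Suc by (intro exI[of _ e]) (auto simp: cochain_def)
  qed
  then obtain e where e: "\<And>S. e S \<noteq> 0 \<Longrightarrow> S \<subseteq> {..<m} \<and> int (card S) = int r - 1 \<and> N \<subseteq> \<Union> (vs ` S)"
    "\<And>T. T \<subseteq> {..<m} \<Longrightarrow> koszul e T = c T" by blast
  show "\<forall>b\<in>corner_basis N r. corner_value N r b c = 0"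
  proof
    fix b assume b: "b \<in> corner_basis N r"
    have "y N (Inr (card N - r, b)) = 0"
    proof (rule double.staircase_coboundary[OF y, of "extend e"])
      fix x assume nz: "extend e x \<noteq> 0"
      then obtain S where "x = Inl S" "e S \<noteq> 0" by (cases x rule: cell_cases) auto
      then show "x \<in> cells \<and> 0 \<le> cell_deg x \<and> cell_deg x = int r - 1 \<and> N \<inter> cell_hi x = {}"
        using e(1)[of S] by auto
    next
      fix x assume "x \<in> cells"
      then show "cell_diff (extend e) x = extend c x"
        using e(2) by (cases x rule: cell_cases) auto
    qed (use b in \<open>auto simp: corner_basis_def split: if_splits\<close>)
    then show "corner_value N r b c = 0" using corner_value_staircase[OF y b] by simp
  qed
qed

lemma corner_value_surjective: "\<exists>c. closed_cochain m vs N r c \<and> (\<forall>b\<in>corner_basis N r. corner_value N r b c = t b)"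
proof -
  let ?t = "\<lambda>x :: nat set + nat \<times> 'b. case x of Inl S \<Rightarrow> 0 | Inr (j, b) \<Rightarrow> if j = card N - r \<and> b \<in> corner_basis N r then t b else 0"
  have "\<exists>c y. double.cocycle N r c \<and> double.staircase N r c y \<and> (\<forall>x. y N x = ?t x)"
  proof (rule double.corner_surjective)
    fix x assume "?t x \<noteq> 0"
    then obtain b where "x = Inr (card N - r, b)" "b \<in> corner_basis N r" by (auto split: sum.splits if_splits)
    then show "x \<in> cells \<and> cell_deg x < 0 \<and> cell_lo x = N \<and> cell_deg x + int (card N) = int r - 1"
      by (auto simp: corner_basis_def split: if_splits)
  qed
  then obtain c y where c: "double.cocycle N r c" "double.staircase N r c y" "\<And>x. y N x = ?t x" by blast
  have "c (Inr p) = 0" for p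
  proof (rule ccontr)
    assume "c (Inr p) \<noteq> 0"
    then have "cell_deg (Inr p) = int r" using c(1) by (auto simp: double.cocycle_def)
    then show False by (cases p) simp
  qed
  then have "extend (\<lambda>S. c (Inl S)) = c" by (auto simp: extend_def fun_eq_iff split: sum.splits)
  then show ?thesis
    using c cocycle_extend[of N r "\<lambda>S. c (Inl S)"] corner_value_staircase[of N r "\<lambda>S. c (Inl S)" y]
    by (intro exI[of _ "\<lambda>S. c (Inl S)"]) auto
qed

text \<open>
  This is where the linear strand appears.  Evaluate the staircase equation over \<open>N \<union> {i}\<close> at the
  top vertex and at the cell \<open>b\<close> of degree \<open>N\<close>.  On the Koszul side only the neighbour \<open>N\<close> of the
  top vertex carries \<open>b\<close>.  On the other side a basis element \<open>b'\<close> contributes only if its degree lies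
  strictly above \<open>N\<close> and within \<open>N \<union> {i}\<close>.
\<close>
lemma corner_value_insert:
  assumes i: "i \<notin> N" and c: "closed_cochain m vs (insert i N) r c" and b: "b \<in> corner_basis N r"
  shows "corner_value N r b c = koszul_sign i (insert i N) *
    (\<Sum>b'\<in>corner_basis (insert i N) r. A (card N - r) b b' * corner_value (insert i N) r b' c)"
proof -
  let ?N = "insert i N" and ?j = "card N - r"
  obtain y where y: "double.staircase ?N r (extend c) y" using c obtain_staircase by metis
  then have hom: "double.homogeneous (int r - 1) y" by (simp add: double.staircase_def)
  have bj: "b \<in> B ?j" "face (\<delta> ?j b) = N" "r \<le> card N" using b by (auto simp: corner_basis_def split: if_splits)
  have card: "card ?N - r = Suc ?j" "r \<le> card ?N" using i bj by (simp_all add: Suc_diff_le)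
  have "cell_diff (y ?N) (Inr (?j, b)) = koszul (\<lambda>\<sigma>. y \<sigma> (Inr (?j, b))) ?N"
    using double.staircaseD[OF y, of ?N "Inr (?j, b)"] bj by simp
  also have "\<dots> = (\<Sum>l\<in>{i}. koszul_sign l ?N * y (?N - {l}) (Inr (?j, b)))"
    unfolding koszul_def
  proof (rule sum.mono_neutral_right)
    show "\<forall>l\<in>?N - {i}. koszul_sign l ?N * y (?N - {l}) (Inr (?j, b)) = 0"
    proof
      fix l assume l: "l \<in> ?N - {i}"
      have "\<not> N \<subseteq> ?N - {l}" using l by auto
      then have "y (?N - {l}) (Inr (?j, b)) = 0"
        using double.homogeneousD[OF hom, of "?N - {l}" "Inr (?j, b)"] bj by (auto simp: double.live_def)
      then show "koszul_sign l ?N * y (?N - {l}) (Inr (?j, b)) = 0" by simp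
    qed
  qed auto
  also have "\<dots> = koszul_sign i ?N * corner_value N r b c"
    using corner_value_staircase[OF double.staircase_restrict[OF y] b] i by (simp add: subset_insertI)
  finally have "corner_value N r b c = koszul_sign i ?N * cell_diff (y ?N) (Inr (?j, b))" by simp
  also have "cell_diff (y ?N) (Inr (?j, b)) = (\<Sum>b'\<in>B (Suc ?j). A ?j b b' * y ?N (Inr (Suc ?j, b')))"
    using bj by simp
  also have "\<dots> = (\<Sum>b'\<in>corner_basis ?N r. A ?j b b' * y ?N (Inr (Suc ?j, b')))"
  proof (rule sum.mono_neutral_right)
    show "\<forall>b'\<in>B (Suc ?j) - corner_basis ?N r. A ?j b b' * y ?N (Inr (Suc ?j, b')) = 0"
    proof (rule ballI, rule ccontr)
      fix b' assume b': "b' \<in> B (Suc ?j) - corner_basis ?N r" "A ?j b b' * y ?N (Inr (Suc ?j, b')) \<noteq> 0"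
      have "N \<subset> face (\<delta> (Suc ?j) b')" using face_matrix[of b ?j b'] bj b' by auto
      moreover have "face (\<delta> (Suc ?j) b') \<subseteq> ?N"
        using double.homogeneousD[OF hom, of ?N "Inr (Suc ?j, b')"] b' by (auto simp: double.live_def)
      ultimately have "face (\<delta> (Suc ?j) b') = ?N" by auto
      then show False using b' card by (simp add: corner_basis_def)
    qed
  qed (use card in \<open>auto simp: corner_basis_def\<close>)
  also have "\<dots> = (\<Sum>b'\<in>corner_basis ?N r. A ?j b b' * corner_value ?N r b' c)"
    using corner_value_staircase[OF y] card by simp
  finally show ?thesis .
qed

end

section \<open>Laurent polynomials\<close>

definition neg :: "'n deg \<Rightarrow> 'n set" where "neg a = {i. a i < 0}"

abbreviation to_deg :: "('n \<Rightarrow> nat) \<Rightarrow> 'n deg" where "to_deg a \<equiv> (\<lambda>i. int (a i))"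

lemma lookup_to_laurent:
  "Poly_Mapping.lookup (to_laurent p) z = (if 0 \<le> z then Poly_Mapping.lookup p (\<lambda>i. nat (z i)) else 0)"
proof -
  have "Poly_Mapping.lookup (to_laurent p) z
      = (\<Sum>a\<in>Poly_Mapping.keys p. if to_deg a = z then Poly_Mapping.lookup p a else 0)"
    by (simp add: to_laurent_def lookup_sum lookup_single when_def)
  also have "\<dots> = (if 0 \<le> z then Poly_Mapping.lookup p (\<lambda>i. nat (z i)) else 0)"
  proof (cases "0 \<le> z")
    case True
    then have "to_deg a = z \<longleftrightarrow> a = (\<lambda>i. nat (z i))" for a
      by (auto simp: fun_eq_iff le_fun_def) (metis nat_int)
    then show ?thesis using True by (simp add: sum.delta in_keys_iff)
  next
    case False
    then have "to_deg a \<noteq> z" for a by (auto simp: le_fun_def)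
    then show ?thesis using False by simp
  qed
  finally show ?thesis .
qed

lemma to_laurent_single [simp]: "to_laurent (Poly_Mapping.single a c) = Poly_Mapping.single (to_deg a) c"
  by (cases "c = 0") (simp_all add: to_laurent_def)

lemma lookup_single_mult_laurent:
  "Poly_Mapping.lookup (Poly_Mapping.single e c * g) a = c * Poly_Mapping.lookup (g :: ('n, 'k::field) laurent) (a - e)"
  using lookup_mult_single_shift[of g e c "a - e"] by (simp add: mult.commute)

lemma lookup_to_laurent_mult:
  "Poly_Mapping.lookup (to_laurent p * g) a = (\<Sum>e\<in>Poly_Mapping.keys p. Poly_Mapping.lookup p e * Poly_Mapping.lookup g (a - to_deg e))"
  by (simp add: to_laurent_def sum_distrib_right lookup_sum lookup_single_mult_laurent)

lemma xpow_power: "xpow a ^ t = (Poly_Mapping.single (\<lambda>i. t * a i) 1 :: ('n, 'k::field) mpoly)"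
proof (induction t)
  case 0
  then show ?case by (simp add: single_one zero_fun_def[symmetric])
next
  case (Suc t)
  then show ?case by (simp add: xpow_def mult_single plus_fun_def)
qed

lemma localization_iff:
  "g \<in> localization a \<longleftrightarrow> (\<forall>b\<in>Poly_Mapping.keys g. \<forall>i. b i < 0 \<longrightarrow> 0 < a (i :: 'n::finite))"
proof
  assume "g \<in> localization a"
  then obtain t p where tp: "to_laurent (xpow a ^ t) * g = to_laurent p" by (auto simp: localization_def)
  show "\<forall>b\<in>Poly_Mapping.keys g. \<forall>i. b i < 0 \<longrightarrow> 0 < a i"
  proof (intro ballI allI impI)
    fix b i assume b: "b \<in> Poly_Mapping.keys g" "b i < 0"
    let ?z = "b + to_deg (\<lambda>i. t * a i)"
    have "Poly_Mapping.lookup (to_laurent p) ?z = Poly_Mapping.lookup g b"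
      unfolding tp[symmetric] xpow_power to_laurent_single lookup_single_mult_laurent by simp
    then have "Poly_Mapping.lookup (to_laurent p) ?z \<noteq> 0" using b by (simp add: in_keys_iff)
    then have "0 \<le> ?z" by (simp add: lookup_to_laurent split: if_splits)
    then have "0 \<le> b i + int (t * a i)" by (simp add: le_fun_def)
    then have "0 < t * a i" using b(2) by linarith
    then show "0 < a i" by simp
  qed
next
  assume *: "\<forall>b\<in>Poly_Mapping.keys g. \<forall>i. b i < 0 \<longrightarrow> 0 < a i"
  \<comment> \<open>a crude power of \<open>x\<^sup>a\<close> that clears all denominators\<close>
  define t where "t = (\<Sum>b\<in>Poly_Mapping.keys g. \<Sum>i\<in>UNIV. nat (- b i))"
  have bound: "- b i \<le> int t" if "b \<in> Poly_Mapping.keys g" for b i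
  proof -
    have "nat (- b i) \<le> (\<Sum>i\<in>UNIV. nat (- b i))" by (rule member_le_sum) auto
    also have "\<dots> \<le> t" unfolding t_def using that by (intro member_le_sum) auto
    finally show ?thesis by linarith
  qed
  let ?s = "to_deg (\<lambda>i. t * a i)"
  have nonneg: "0 \<le> b + ?s" if b: "b \<in> Poly_Mapping.keys g" for b
    unfolding le_fun_def
  proof
    fix i
    show "0 i \<le> (b + ?s) i"
    proof (cases "b i < 0")
      case True
      then have "1 \<le> a i" using * b by force
      then have "t * 1 \<le> t * a i" by (rule mult_le_mono2)
      then have "int t \<le> int (t * a i)" by linarith
      then show ?thesis using bound[OF b, of i] by simp
    qed simp
  qed
  define p where "p = (\<Sum>b\<in>Poly_Mapping.keys g. Poly_Mapping.single (\<lambda>i. nat ((b + ?s) i)) (Poly_Mapping.lookup g b))"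
  have "to_laurent (xpow a ^ t) * g = to_laurent p"
  proof (rule poly_mapping_eqI)
    fix z
    have "Poly_Mapping.lookup (to_laurent (xpow a ^ t) * g) z = Poly_Mapping.lookup g (z - ?s)"
      unfolding xpow_power to_laurent_single lookup_single_mult_laurent by simp
    also have "\<dots> = Poly_Mapping.lookup (to_laurent p) z"
    proof (cases "0 \<le> z")
      case True
      have eq: "(\<lambda>i. nat ((b + ?s) i)) = (\<lambda>i. nat (z i)) \<longleftrightarrow> b = z - ?s" if "b \<in> Poly_Mapping.keys g" for b
      proof
        assume h: "(\<lambda>i. nat ((b + ?s) i)) = (\<lambda>i. nat (z i))"
        show "b = z - ?s"
        proof
          fix i
          have "nat ((b + ?s) i) = nat (z i)" using fun_cong[OF h] .
          moreover have "0 \<le> (b + ?s) i" "0 \<le> z i" using nonneg[OF that] True by (simp_all add: le_fun_def)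
          ultimately have "(b + ?s) i = z i" by linarith
          then show "b i = (z - ?s) i" by (simp add: fun_diff_def)
        qed
      qed simp
      have "Poly_Mapping.lookup (to_laurent p) z
          = (\<Sum>b\<in>Poly_Mapping.keys g. if b = z - ?s then Poly_Mapping.lookup g b else 0)"
        using True eq by (simp add: lookup_to_laurent p_def lookup_sum lookup_single when_def cong: sum.cong)
      then show ?thesis by (simp add: sum.delta in_keys_iff)
    next
      case False
      have "z - ?s \<notin> Poly_Mapping.keys g"
      proof
        assume "z - ?s \<in> Poly_Mapping.keys g"
        then have "0 \<le> z - ?s + ?s" by (rule nonneg)
        then show False using False by simp
      qed
      then show ?thesis using False by (simp add: lookup_to_laurent in_keys_iff)
    qed
    finally show "Poly_Mapping.lookup (to_laurent (xpow a ^ t) * g) z = Poly_Mapping.lookup (to_laurent p) z" .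
  qed
  then show "g \<in> localization a" by (auto simp: localization_def)
qed

lemma lookup_laurent_deriv:
  fixes i :: 'n and g :: "('n, 'k::field) laurent"
  shows "Poly_Mapping.lookup (laurent_deriv i g) a = of_int (a i + 1) * Poly_Mapping.lookup g (a + unit_vec i)"
proof -
  have eq: "b - unit_vec i = a \<longleftrightarrow> b = a + unit_vec i" for b :: "'n deg" by (auto simp: diff_eq_eq)
  have "Poly_Mapping.lookup (laurent_deriv i g) a
      = (\<Sum>b\<in>Poly_Mapping.keys g. if b = a + unit_vec i then of_int (b i) * Poly_Mapping.lookup g b else 0)"
    by (simp add: laurent_deriv_def lookup_sum lookup_single when_def eq)
  then show ?thesis by (simp add: sum.delta in_keys_iff unit_vec_def)
qed

lemma laurent_piece_iff: "g \<in> laurent_piece a \<longleftrightarrow> (\<forall>b. b \<noteq> a \<longrightarrow> Poly_Mapping.lookup g b = 0)"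
  by (auto simp: laurent_piece_def in_keys_iff)

lemma lookup_sign_mult: "Poly_Mapping.lookup ((- 1) ^ n * (g :: ('n, 'k::field) laurent)) a = (- 1) ^ n * Poly_Mapping.lookup g a"
  by (cases "even n") simp_all

section \<open>The Cech complex degree by degree\<close>

definition component :: "(nat set \<Rightarrow> ('n, 'k::field) laurent) \<Rightarrow> 'n deg \<Rightarrow> nat set \<Rightarrow> 'k" where
  "component c a S = Poly_Mapping.lookup (c S) a"

definition monomial_cochain :: "'n deg \<Rightarrow> (nat set \<Rightarrow> 'k) \<Rightarrow> nat set \<Rightarrow> ('n, 'k::field) laurent" where
  "monomial_cochain a l S = Poly_Mapping.single a (l S)"

lemma component_monomial_cochain: "component (monomial_cochain a l) b = (if b = a then l else (\<lambda>_. 0))"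
  by (rule ext) (simp add: component_def monomial_cochain_def lookup_single when_def)

lemma component_eqI: "(\<And>a. component c a = component d a) \<Longrightarrow> c = d"
  by (auto simp: component_def fun_eq_iff intro!: poly_mapping_eqI)

lemma sum_exponents_pos: "finite S \<Longrightarrow> 0 < (\<Sum>j\<in>S. e j) i \<longleftrightarrow> (\<exists>j\<in>S. 0 < (e j :: 'n \<Rightarrow> nat) i)"
  by (induction rule: finite_induct) auto

definition cover :: "('n \<Rightarrow> nat) list \<Rightarrow> nat \<Rightarrow> 'n set" where
  "cover gs t = support (gs ! t)"

abbreviation "cech_cochain gs \<equiv> cochain (length gs) (cover gs)"
abbreviation "cech_closed gs \<equiv> closed_cochain (length gs) (cover gs)"
abbreviation "cech_exact gs \<equiv> exact_cochain (length gs) (cover gs)"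

text \<open>
  The Cech complex splits into its degrees, and in degree \<open>a\<close> it depends only on \<open>neg a\<close>.
\<close>
lemma cech_iff:
  "(c :: nat set \<Rightarrow> ('n::finite, 'k::field) laurent) \<in> cech gs r \<longleftrightarrow> (\<forall>a. cech_cochain gs (neg a) r (component c a))"
proof
  assume c: "c \<in> cech gs r"
  show "\<forall>a. cech_cochain gs (neg a) r (component c a)"
    unfolding cochain_def
  proof (intro allI impI)
    fix a S assume nz: "component c a S \<noteq> 0"
    then have "c S \<noteq> 0" by (auto simp: component_def)
    then have S: "S \<subseteq> {..<length gs} \<and> card S = r" and loc: "c S \<in> localization (\<Sum>j\<in>S. gs ! j)"
      using c by (auto simp: cech_def split: if_splits dest!: spec[of _ S])
    have fin: "finite S" using S finite_subset by blast
    have "a \<in> Poly_Mapping.keys (c S)" using nz by (simp add: component_def in_keys_iff)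
    then have "neg a \<subseteq> \<Union> ((cover gs) ` S)"
      using loc sum_exponents_pos[OF fin, of "\<lambda>j. gs ! j"] by (auto simp: localization_iff neg_def cover_def support_def)
    then show "S \<subseteq> {..<length gs} \<and> card S = r \<and> neg a \<subseteq> \<Union> ((cover gs) ` S)" using S by blast
  qed
next
  assume c: "\<forall>a. cech_cochain gs (neg a) r (component c a)"
  have c': "S \<subseteq> {..<length gs} \<and> card S = r \<and> neg a \<subseteq> \<Union> ((cover gs) ` S)" if "Poly_Mapping.lookup (c S) a \<noteq> 0" for a S
    using c that by (auto simp: cochain_def component_def)
  show "c \<in> cech gs r"
    unfolding cech_def mem_Collect_eq
  proof
    fix S
    show "if S \<subseteq> {..<length gs} \<and> card S = r then c S \<in> localization (\<Sum>j\<in>S. gs ! j) else c S = 0"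
    proof (cases "S \<subseteq> {..<length gs} \<and> card S = r")
      case True
      then have fin: "finite S" using finite_subset by blast
      have "c S \<in> localization (\<Sum>j\<in>S. gs ! j)"
        unfolding localization_iff
      proof (intro ballI allI impI)
        fix b i assume b: "b \<in> Poly_Mapping.keys (c S)" "b i < 0"
        then have "neg b \<subseteq> \<Union> ((cover gs) ` S)" using c'[of S b] by (simp add: in_keys_iff)
        then show "0 < (\<Sum>j\<in>S. gs ! j) i"
          using b sum_exponents_pos[OF fin, of "\<lambda>j. gs ! j" i] by (auto simp: neg_def cover_def support_def)
      qed
      then show ?thesis using True by simp
    next
      case False
      have "c S = 0" using c'[of S] False by (intro poly_mapping_eqI) auto
      then show ?thesis by (simp only: if_not_P[OF False])
    qed
  qed
qed

lemma component_cech_diff: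
  "component (cech_diff gs (c :: nat set \<Rightarrow> ('n::finite, 'k::field) laurent)) a T = (if T \<subseteq> {..<length gs} then koszul (component c a) T else 0)"
  by (simp add: component_def cech_diff_def lookup_sum lookup_sign_mult koszul_def koszul_sign_def)

lemma cocycles_iff:
  "(c :: nat set \<Rightarrow> ('n::finite, 'k::field) laurent) \<in> cocycles gs r \<longleftrightarrow> (\<forall>a. cech_closed gs (neg a) r (component c a))"
proof -
  have "cech_diff gs c = (\<lambda>_. 0) \<longleftrightarrow> (\<forall>a T. component (cech_diff gs c) a T = 0)"
    by (auto simp: component_def fun_eq_iff intro!: poly_mapping_eqI)
  then show ?thesis
    by (auto simp: cocycles_def cech_iff closed_cochain_def component_cech_diff)
qed

lemma exact_component:
  assumes "(c :: nat set \<Rightarrow> ('n::finite, 'k::field) laurent) \<in> coboundaries gs r"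
  shows "cech_exact gs (neg a) r (component c a)"
proof (cases r)
  case 0
  then show ?thesis using assms by (auto simp: coboundaries_def exact_cochain_def component_def)
next
  case (Suc q)
  then obtain e where e: "e \<in> cech gs q" "c = cech_diff gs e" using assms by (auto simp: coboundaries_def)
  then have "cech_cochain gs (neg a) q (component e a)" by (simp add: cech_iff)
  moreover have "component c a = (\<lambda>T. if T \<subseteq> {..<length gs} then koszul (component e a) T else 0)"
    by (rule ext) (simp add: e(2) component_cech_diff)
  ultimately show ?thesis using Suc by (auto simp: exact_cochain_def)
qed

lemma monomial_cocycle:
  assumes "cech_closed gs (neg a) r l"
  shows "(monomial_cochain a l :: nat set \<Rightarrow> ('n::finite, 'k::field) laurent) \<in> cocycles gs r"
  using assms by (auto simp: cocycles_iff component_monomial_cochain closed_cochain_def cochain_def intro: koszul_eq_0)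

lemma monomial_coboundary:
  assumes "cech_exact gs (neg a) r l"
  shows "(monomial_cochain a l :: nat set \<Rightarrow> ('n::finite, 'k::field) laurent) \<in> coboundaries gs r"
proof (cases r)
  case 0
  then show ?thesis using assms by (auto simp: coboundaries_def exact_cochain_def monomial_cochain_def)
next
  case (Suc q)
  then obtain e where e: "cech_cochain gs (neg a) q e" "l = (\<lambda>T. if T \<subseteq> {..<length gs} then koszul e T else 0)"
    using assms by (auto simp: exact_cochain_def)
  let ?e = "monomial_cochain a e :: nat set \<Rightarrow> ('n, 'k) laurent"
  have "?e \<in> cech gs q"
    using e(1) by (auto simp: cech_iff component_monomial_cochain cochain_def)
  moreover have "monomial_cochain a l = cech_diff gs ?e"
  proof (rule component_eqI)
    fix b
    show "component (monomial_cochain a l) b = component (cech_diff gs ?e) b"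
      by (auto simp: fun_eq_iff component_cech_diff component_monomial_cochain e(2) koszul_eq_0)
  qed
  ultimately show ?thesis using Suc by (auto simp: coboundaries_def)
qed

section \<open>Cosets\<close>

text \<open>
  The cosets in the quotient modules are those of ordinary additive groups; this description
  lets the type class machinery work on representatives.
\<close>
definition plus_coset :: "'a::ab_group_add set \<Rightarrow> 'a \<Rightarrow> 'a set" where
  "plus_coset N x = (\<lambda>h. h + x) ` N"

definition additive_subset :: "'a::ab_group_add set \<Rightarrow> bool" where
  "additive_subset N \<longleftrightarrow> 0 \<in> N \<and> (\<forall>x\<in>N. \<forall>y\<in>N. x - y \<in> N)"

lemma additive_subset_add: "additive_subset N \<Longrightarrow> x \<in> N \<Longrightarrow> y \<in> N \<Longrightarrow> x + y \<in> N"
proof -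
  assume N: "additive_subset N" "x \<in> N" "y \<in> N"
  then have "0 - y \<in> N" unfolding additive_subset_def by blast
  then have "x - (0 - y) \<in> N" using N unfolding additive_subset_def by blast
  then show ?thesis by simp
qed

lemma mem_plus_coset: "y \<in> plus_coset N x \<longleftrightarrow> y - x \<in> N"
  unfolding plus_coset_def by (metis (no_types, lifting) add_diff_cancel diff_add_cancel image_iff)

lemma plus_coset_eq_iff:
  assumes N: "additive_subset N"
  shows "plus_coset N x = plus_coset N y \<longleftrightarrow> x - y \<in> N"
proof
  assume "plus_coset N x = plus_coset N y"
  moreover have "x \<in> plus_coset N x" using N by (simp add: mem_plus_coset additive_subset_def)
  ultimately show "x - y \<in> N" by (simp add: mem_plus_coset)
next
  assume xy: "x - y \<in> N"
  show "plus_coset N x = plus_coset N y"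
  proof (intro equalityI subsetI)
    fix z assume "z \<in> plus_coset N x"
    then have "(z - x) + (x - y) \<in> N" by (intro additive_subset_add[OF N _ xy]) (simp add: mem_plus_coset)
    then show "z \<in> plus_coset N y" by (simp add: mem_plus_coset)
  next
    fix z assume "z \<in> plus_coset N y"
    then have "z - y \<in> N" by (simp add: mem_plus_coset)
    then have "(z - y) - (x - y) \<in> N" using N xy unfolding additive_subset_def by blast
    then show "z \<in> plus_coset N x" by (simp add: mem_plus_coset)
  qed
qed

lemma plus_coset_self: "additive_subset N \<Longrightarrow> x \<in> plus_coset N x"
  by (simp add: mem_plus_coset additive_subset_def)

lemma plus_coset_zero [simp]: "plus_coset N 0 = N"
  by (simp add: plus_coset_def)

lemma plus_coset_add:
  assumes N: "additive_subset N"
  shows "(\<Union>u\<in>plus_coset N x. \<Union>v\<in>plus_coset N y. {u + v}) = plus_coset N (x + y)"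
proof (intro equalityI subsetI)
  fix z assume "z \<in> (\<Union>u\<in>plus_coset N x. \<Union>v\<in>plus_coset N y. {u + v})"
  then obtain u v where uv: "u - x \<in> N" "v - y \<in> N" "z = u + v" by (auto simp: mem_plus_coset)
  have "z - (x + y) = (u - x) + (v - y)" using uv by simp
  then show "z \<in> plus_coset N (x + y)"
    using additive_subset_add[OF N uv(1,2)] by (simp only: mem_plus_coset)
next
  fix z assume "z \<in> plus_coset N (x + y)"
  then have "z - y \<in> plus_coset N x" by (simp add: mem_plus_coset algebra_simps)
  then show "z \<in> (\<Union>u\<in>plus_coset N x. \<Union>v\<in>plus_coset N y. {u + v})"
    using plus_coset_self[OF N, of y] by (intro UN_I[of "z - y"] UN_I[of y]) auto
qed

text \<open>
  An operation on a quotient is defined as a union over all representatives; if the operation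
  respects \<open>N\<close>, all of them give the same coset.
\<close>
lemma Union_plus_coset:
  assumes N: "additive_subset N" and F: "\<And>h. h \<in> N \<Longrightarrow> F (h + x) - F x \<in> N"
  shows "(\<Union>u\<in>plus_coset N x. plus_coset N (F u)) = plus_coset N (F x)"
proof -
  have "plus_coset N (F u) = plus_coset N (F x)" if "u \<in> plus_coset N x" for u
    using that F[of "u - x"] by (simp add: plus_coset_eq_iff[OF N] mem_plus_coset)
  then show ?thesis using plus_coset_self[OF N, of x] by blast
qed

section \<open>The graded injective modules\<close>

text \<open>
  The \<open>i\<close>-th localization consists of the Laurent polynomials with nonnegative exponents at \<open>x\<^sub>i\<close>.
  Conversely, each monomial of \<open>g\<close> is assigned to one variable of \<open>\<alpha>\<close> at which it is not negative.
  So the monomials that survive in \<open>E\<^sub>\<alpha>\<close> are those negative at all variables of \<open>\<alpha>\<close>.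
\<close>
lemma inj_relations_iff:
  "g \<in> inj_relations \<alpha> \<longleftrightarrow> (\<forall>a\<in>Poly_Mapping.keys (g :: ('n::finite, 'k::field) laurent). \<not> face \<alpha> \<subseteq> neg a)"
proof
  assume "g \<in> inj_relations \<alpha>"
  then obtain h where h: "g = (\<Sum>i\<in>face \<alpha>. h i)" "\<And>i. h i \<in> localization (\<lambda>j. if j = i then 0 else 1)"
    by (auto simp: inj_relations_def face_def)
  show "\<forall>a\<in>Poly_Mapping.keys g. \<not> face \<alpha> \<subseteq> neg a"
  proof
    fix a assume "a \<in> Poly_Mapping.keys g"
    then have "(\<Sum>i\<in>face \<alpha>. Poly_Mapping.lookup (h i) a) \<noteq> 0" by (simp add: h(1) in_keys_iff lookup_sum)
    then obtain i where i: "i \<in> face \<alpha>" "Poly_Mapping.lookup (h i) a \<noteq> 0"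
      by (meson sum.not_neutral_contains_not_neutral)
    then have "\<not> a i < 0" using h(2)[of i] unfolding localization_iff by (fastforce simp: in_keys_iff)
    then show "\<not> face \<alpha> \<subseteq> neg a" using i by (auto simp: neg_def)
  qed
next
  assume g: "\<forall>a\<in>Poly_Mapping.keys g. \<not> face \<alpha> \<subseteq> neg a"
  define ch where "ch a = (SOME i. i \<in> face \<alpha> \<and> \<not> a i < 0)" for a :: "'n deg"
  have ch: "ch a \<in> face \<alpha>" "\<not> a (ch a) < 0" if "a \<in> Poly_Mapping.keys g" for a
  proof -
    have "\<exists>i. i \<in> face \<alpha> \<and> \<not> a i < 0" using g that by (auto simp: neg_def)
    then have "ch a \<in> face \<alpha> \<and> \<not> a (ch a) < 0" unfolding ch_def by (rule someI_ex)
    then show "ch a \<in> face \<alpha>" "\<not> a (ch a) < 0" by auto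
  qed
  define h where "h i = (\<Sum>a\<in>{a \<in> Poly_Mapping.keys g. ch a = i}. Poly_Mapping.single a (Poly_Mapping.lookup g a))" for i
  have lookup_h: "Poly_Mapping.lookup (h i) a = (if ch a = i then Poly_Mapping.lookup g a else 0)" for i a
    by (simp add: h_def lookup_sum lookup_single when_def sum.delta in_keys_iff)
  have "(\<Sum>i\<in>face \<alpha>. h i) = g"
  proof (rule poly_mapping_eqI)
    fix a
    show "Poly_Mapping.lookup (\<Sum>i\<in>face \<alpha>. h i) a = Poly_Mapping.lookup g a"
      using ch[of a] by (cases "a \<in> Poly_Mapping.keys g") (auto simp: lookup_sum lookup_h sum.delta' in_keys_iff)
  qed
  moreover have "h i \<in> localization (\<lambda>j. if j = i then 0 else 1)" for i
    unfolding localization_iff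
  proof (intro ballI allI impI)
    fix b j assume b: "b \<in> Poly_Mapping.keys (h i)" "b j < 0"
    then have "ch b = i" "b \<in> Poly_Mapping.keys g" by (auto simp: in_keys_iff lookup_h split: if_splits)
    then have "j \<noteq> i" using ch[of b] b by auto
    then show "0 < (if j = i then 0 else 1 :: nat)" by simp
  qed
  ultimately show "g \<in> inj_relations \<alpha>"
    unfolding inj_relations_def face_def by blast
qed

lemma inj_relations_lookup:
  "g \<in> inj_relations \<alpha> \<longleftrightarrow> (\<forall>a. face \<alpha> \<subseteq> neg a \<longrightarrow> Poly_Mapping.lookup (g :: ('n::finite, 'k::field) laurent) a = 0)"
  unfolding inj_relations_iff by (auto simp: in_keys_iff)

lemma additive_inj_relations: "additive_subset (inj_relations \<alpha>)"
  by (simp add: additive_subset_def inj_relations_lookup lookup_minus)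

definition inj_class :: "('n::finite) deg \<Rightarrow> ('n, 'k::field) laurent \<Rightarrow> ('n, 'k) laurent set" where
  "inj_class \<alpha> g = plus_coset (inj_relations \<alpha>) g"

lemma inj_class_eq_iff:
  "inj_class \<alpha> g = inj_class \<alpha> h \<longleftrightarrow> (\<forall>a. face \<alpha> \<subseteq> neg a \<longrightarrow> Poly_Mapping.lookup g a = Poly_Mapping.lookup h a)"
  by (simp add: inj_class_def plus_coset_eq_iff[OF additive_inj_relations] inj_relations_lookup lookup_minus)

lemma inj_relations_shift:
  assumes "h \<in> inj_relations \<alpha>"
  shows "to_laurent p * h \<in> inj_relations \<alpha>"
  unfolding inj_relations_lookup
proof (intro allI impI)
  fix a assume a: "face \<alpha> \<subseteq> neg a"
  have "face \<alpha> \<subseteq> neg (a - to_deg e)" for e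
    using a by (force simp: neg_def fun_diff_def)
  then show "Poly_Mapping.lookup (to_laurent p * h) a = 0"
    using assms by (simp add: lookup_to_laurent_mult inj_relations_lookup)
qed

text \<open>
  A derivation lowers the exponent of \<open>x\<^sub>i\<close> by one, and the only way to turn a nonnegative exponent
  into a negative one is \<open>0 \<mapsto> -1\<close>, where the derivative is \<open>0\<close>.
\<close>
lemma inj_relations_deriv:
  assumes "h \<in> inj_relations \<alpha>"
  shows "laurent_deriv i h \<in> inj_relations \<alpha>"
  unfolding inj_relations_lookup
proof (intro allI impI)
  fix a assume a: "face \<alpha> \<subseteq> neg a"
  show "Poly_Mapping.lookup (laurent_deriv i h) a = 0"
  proof (cases "a i = - 1")
    case False
    have "face \<alpha> \<subseteq> neg (a + unit_vec i)"
    proof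
      fix j assume "j \<in> face \<alpha>"
      then show "j \<in> neg (a + unit_vec i)" using a False by (cases "j = i") (auto simp: neg_def unit_vec_def)
    qed
    then show ?thesis using assms by (simp add: lookup_laurent_deriv inj_relations_lookup)
  qed (simp add: lookup_laurent_deriv)
qed

lemma laurent_coset: "N +>\<^bsub>laurent_module\<^esub> g = plus_coset N g"
  by (auto simp: a_r_coset_def' laurent_module_def plus_coset_def)

lemma laurent_deriv_add: "laurent_deriv i (g + h) = laurent_deriv i g + laurent_deriv i h"
  by (rule poly_mapping_eqI) (simp add: lookup_laurent_deriv lookup_add distrib_left)

lemma inj_module_simps:
  "carrier (inj_module \<alpha>) = range (inj_class \<alpha>)"
  "\<zero>\<^bsub>inj_module \<alpha>\<^esub> = inj_class \<alpha> 0"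
  "inj_class \<alpha> g \<oplus>\<^bsub>inj_module \<alpha>\<^esub> inj_class \<alpha> h = inj_class \<alpha> (g + h)"
  "p \<odot>\<^bsub>inj_module \<alpha>\<^esub> inj_class \<alpha> g = inj_class \<alpha> (to_laurent p * g)"
  "deriv (inj_module \<alpha>) i (inj_class \<alpha> g) = inj_class \<alpha> (laurent_deriv i g)"
  "piece (inj_module \<alpha>) a = inj_class \<alpha> ` laurent_piece a"
proof -
  note N = additive_inj_relations[of \<alpha>]
  show "carrier (inj_module \<alpha>) = range (inj_class \<alpha>)"
    by (auto simp: inj_module_def quotmod_def A_RCOSETS_def' laurent_coset inj_class_def)
       (auto simp: laurent_module_def)
  show "\<zero>\<^bsub>inj_module \<alpha>\<^esub> = inj_class \<alpha> 0"
    by (simp add: inj_module_def quotmod_def inj_class_def)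
  show "inj_class \<alpha> g \<oplus>\<^bsub>inj_module \<alpha>\<^esub> inj_class \<alpha> h = inj_class \<alpha> (g + h)"
    using plus_coset_add[OF N]
    by (simp add: inj_module_def quotmod_def set_add_def set_mult_def inj_class_def laurent_module_def)
  show "p \<odot>\<^bsub>inj_module \<alpha>\<^esub> inj_class \<alpha> g = inj_class \<alpha> (to_laurent p * g)"
  proof -
    have "(\<Union>u\<in>plus_coset (inj_relations \<alpha>) g. plus_coset (inj_relations \<alpha>) (to_laurent p * u))
        = plus_coset (inj_relations \<alpha>) (to_laurent p * g)"
      by (rule Union_plus_coset[OF N]) (simp add: distrib_left inj_relations_shift)
    then show ?thesis
      by (simp add: inj_module_def quotmod_def laurent_coset inj_class_def) (simp add: laurent_module_def)
  qed
  show "deriv (inj_module \<alpha>) i (inj_class \<alpha> g) = inj_class \<alpha> (laurent_deriv i g)"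
  proof -
    have "(\<Union>u\<in>plus_coset (inj_relations \<alpha>) g. plus_coset (inj_relations \<alpha>) (laurent_deriv i u))
        = plus_coset (inj_relations \<alpha>) (laurent_deriv i g)"
      by (rule Union_plus_coset[OF N]) (simp add: laurent_deriv_add inj_relations_deriv)
    then show ?thesis
      by (simp add: inj_module_def quotmod_def laurent_coset inj_class_def) (simp add: laurent_module_def)
  qed
  show "piece (inj_module \<alpha>) a = inj_class \<alpha> ` laurent_piece a"
    by (simp add: inj_module_def quotmod_def laurent_coset inj_class_def) (simp add: laurent_module_def)
qed

lemma inj_proj_class:
  assumes "\<alpha> i = 0"
  shows "inj_proj \<alpha> i (inj_class \<alpha> g) = inj_class (\<alpha> + unit_vec i) g"
proof -
  let ?\<beta> = "\<alpha> + unit_vec i"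
  have sub: "h \<in> inj_relations ?\<beta>" if "h \<in> inj_relations \<alpha>" for h :: "('a, 'b) laurent"
  proof -
    have "face \<alpha> \<subseteq> face ?\<beta>" using assms by (auto simp: face_def unit_vec_def)
    then show ?thesis using that by (auto simp: inj_relations_lookup)
  qed
  have "inj_relations ?\<beta> <+>\<^bsub>laurent_module\<^esub> inj_class \<alpha> g
      = (\<Union>u\<in>inj_relations ?\<beta>. \<Union>v\<in>inj_class \<alpha> g. {u + v})"
    by (simp add: set_add_def set_mult_def laurent_module_def)
  also have "\<dots> = inj_class ?\<beta> g"
  proof (intro equalityI subsetI)
    fix z assume "z \<in> (\<Union>u\<in>inj_relations ?\<beta>. \<Union>v\<in>inj_class \<alpha> g. {u + v})"
    then obtain u v where uv: "u \<in> inj_relations ?\<beta>" "v - g \<in> inj_relations \<alpha>" "z = u + v"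
      by (auto simp: inj_class_def mem_plus_coset)
    then have "u + (v - g) \<in> inj_relations ?\<beta>"
      using additive_subset_add[OF additive_inj_relations uv(1) sub[OF uv(2)]] by simp
    then show "z \<in> inj_class ?\<beta> g" using uv(3) by (simp add: inj_class_def mem_plus_coset add_diff_eq)
  next
    fix z assume "z \<in> inj_class ?\<beta> g"
    then have "z - g \<in> inj_relations ?\<beta>" by (simp add: inj_class_def mem_plus_coset)
    moreover have "g \<in> inj_class \<alpha> g" by (simp add: inj_class_def plus_coset_self additive_inj_relations)
    ultimately show "z \<in> (\<Union>u\<in>inj_relations ?\<beta>. \<Union>v\<in>inj_class \<alpha> g. {u + v})"
      by (intro UN_I[of "z - g"] UN_I[of g]) auto
  qed
  finally show ?thesis by (simp add: inj_proj_def)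
qed

lemma cochain_antimono: "cochain m V N r c \<Longrightarrow> N' \<subseteq> N \<Longrightarrow> cochain m V N' r c"
  unfolding cochain_def by blast

lemma closed_cochain_antimono: "closed_cochain m V N r c \<Longrightarrow> N' \<subseteq> N \<Longrightarrow> closed_cochain m V N' r c"
  unfolding closed_cochain_def cochain_def by blast

lemma exact_cochain_antimono: "exact_cochain m V N r c \<Longrightarrow> N' \<subseteq> N \<Longrightarrow> exact_cochain m V N' r c"
proof (cases r)
  case (Suc q)
  assume "exact_cochain m V N r c" and sub: "N' \<subseteq> N"
  then obtain e where "cochain m V N q e" "c = (\<lambda>T. if T \<subseteq> {..<m} then koszul e T else 0)"
    using Suc by (auto simp: exact_cochain_def)
  then have "cochain m V N' q e \<and> c = (\<lambda>T. if T \<subseteq> {..<m} then koszul e T else 0)"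
    using cochain_antimono[OF _ sub] by blast
  then show ?thesis using Suc unfolding exact_cochain_def by auto
qed (simp add: exact_cochain_def)

lemma cochain_zero: "cochain m V N r (\<lambda>_. 0)"
  by (simp add: cochain_def)

lemma cochain_add: "cochain m V N r c \<Longrightarrow> cochain m V N r d \<Longrightarrow> cochain m V N r (\<lambda>S. c S + d S)"
  unfolding cochain_def by (metis add_0)

lemma cochain_scale: "cochain m V N r c \<Longrightarrow> cochain m V N r (\<lambda>S. t * c S)"
  by (simp add: cochain_def)

lemma cochain_diff:
  assumes "cochain m V N r c" "cochain m V N r d"
  shows "cochain m V N r (\<lambda>S. c S - d S)"
  unfolding cochain_def
proof (intro allI impI)
  fix S assume "c S - d S \<noteq> 0"
  then have "c S \<noteq> 0 \<or> d S \<noteq> 0" by auto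
  then show "S \<subseteq> {..<m} \<and> card S = r \<and> N \<subseteq> \<Union> (V ` S)" using assms unfolding cochain_def by blast
qed

lemma closed_cochain_zero: "closed_cochain m V N r (\<lambda>_. 0)"
  by (simp add: closed_cochain_def cochain_zero koszul_eq_0)

lemma closed_cochain_add: "closed_cochain m V N r c \<Longrightarrow> closed_cochain m V N r d \<Longrightarrow> closed_cochain m V N r (\<lambda>S. c S + d S)"
  by (simp add: closed_cochain_def cochain_add koszul_add)

lemma closed_cochain_scale: "closed_cochain m V N r c \<Longrightarrow> closed_cochain m V N r (\<lambda>S. t * c S)"
  by (simp add: closed_cochain_def cochain_scale koszul_scale)

lemma closed_cochain_sum:
  "finite E \<Longrightarrow> (\<And>e. e \<in> E \<Longrightarrow> closed_cochain m V N r (c e)) \<Longrightarrow> closed_cochain m V N r (\<lambda>S. \<Sum>e\<in>E. c e S)"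
  by (induction E rule: finite_induct) (simp_all add: closed_cochain_zero closed_cochain_add)

lemma cochain_sum:
  "finite E \<Longrightarrow> (\<And>e. e \<in> E \<Longrightarrow> cochain m V N r (c e)) \<Longrightarrow> cochain m V N r (\<lambda>S. \<Sum>e\<in>E. c e S)"
  by (induction E rule: finite_induct) (simp_all add: cochain_zero cochain_add)

lemma component_zero: "component (\<lambda>_. 0) a = (\<lambda>_. 0)"
  by (rule ext) (simp add: component_def)

lemma component_add: "component (\<lambda>S. c S + d S) a = (\<lambda>S. component c a S + component d a S)"
  by (rule ext) (simp add: component_def lookup_add)

lemma component_diff: "component (\<lambda>S. c S - d S) a = (\<lambda>S. component c a S - component d a S)"
  by (rule ext) (simp add: component_def lookup_minus)

lemma component_smult:
  "component (\<lambda>S. to_laurent p * c S) a = (\<lambda>S. \<Sum>e\<in>Poly_Mapping.keys p. Poly_Mapping.lookup p e * component c (a - to_deg e) S)"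
  by (rule ext) (simp add: component_def lookup_to_laurent_mult)

lemma component_deriv:
  "component (\<lambda>S. laurent_deriv i (c S)) a = (\<lambda>S. of_int (a i + 1) * component c (a + unit_vec i) S)"
  by (rule ext) (simp add: component_def lookup_laurent_deriv)

lemma neg_shift: "neg a \<subseteq> neg (a - to_deg e)"
  by (force simp: neg_def fun_diff_def)

lemma neg_unit: "a i \<noteq> - 1 \<Longrightarrow> neg a \<subseteq> neg (a + unit_vec i)"
proof
  fix j assume "a i \<noteq> - 1" "j \<in> neg a"
  then show "j \<in> neg (a + unit_vec i)" by (cases "j = i") (auto simp: neg_def unit_vec_def)
qed

lemma cech_smult: "(c :: nat set \<Rightarrow> ('n::finite, 'k::field) laurent) \<in> cech gs r \<Longrightarrow> (\<lambda>S. to_laurent p * c S) \<in> cech gs r"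
  unfolding cech_iff component_smult
  by (intro allI cochain_sum cochain_scale) (auto intro: cochain_antimono[OF _ neg_shift])

lemma cech_deriv: "(c :: nat set \<Rightarrow> ('n::finite, 'k::field) laurent) \<in> cech gs r \<Longrightarrow> (\<lambda>S. laurent_deriv i (c S)) \<in> cech gs r"
  unfolding cech_iff component_deriv
proof
  fix a assume c: "\<forall>a. cech_cochain gs (neg a) r (component c a)"
  show "cech_cochain gs (neg a) r (\<lambda>S. of_int (a i + 1) * component c (a + unit_vec i) S)"
  proof (cases "a i = - 1")
    case True
    then show ?thesis by (simp add: cochain_zero)
  next
    case False
    have "cech_cochain gs (neg (a + unit_vec i)) r (component c (a + unit_vec i))"
      using c by blast
    from cochain_antimono[OF this neg_unit[of a i, OF False]] show ?thesis by (rule cochain_scale)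
  qed
qed

lemma cech_diff_diff: "cech_diff gs (\<lambda>S. (c :: nat set \<Rightarrow> ('n::finite, 'k::field) laurent) S - d S) = (\<lambda>T. cech_diff gs c T - cech_diff gs d T)"
  by (rule component_eqI) (rule ext, simp add: component_cech_diff component_diff koszul_diff)

lemma cech_diff_smult: "cech_diff gs (\<lambda>S. to_laurent p * (c :: nat set \<Rightarrow> ('n::finite, 'k::field) laurent) S) = (\<lambda>T. to_laurent p * cech_diff gs c T)"
  by (rule ext) (simp add: cech_diff_def sum_distrib_left mult.left_commute)

lemma cech_diff_deriv: "cech_diff gs (\<lambda>S. laurent_deriv i ((c :: nat set \<Rightarrow> ('n::finite, 'k::field) laurent) S)) = (\<lambda>T. laurent_deriv i (cech_diff gs c T))"
  by (rule component_eqI) (rule ext, simp add: component_cech_diff component_deriv koszul_scale)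

lemma laurent_deriv_zero [simp]: "laurent_deriv i 0 = 0"
  by (simp add: laurent_deriv_def)

lemma cocycles_smult: "(c :: nat set \<Rightarrow> ('n::finite, 'k::field) laurent) \<in> cocycles gs r \<Longrightarrow> (\<lambda>S. to_laurent p * c S) \<in> cocycles gs r"
  by (simp add: cocycles_def cech_smult cech_diff_smult)

lemma cocycles_deriv: "(c :: nat set \<Rightarrow> ('n::finite, 'k::field) laurent) \<in> cocycles gs r \<Longrightarrow> (\<lambda>S. laurent_deriv i (c S)) \<in> cocycles gs r"
  by (simp add: cocycles_def cech_deriv cech_diff_deriv)

lemma cocycles_add: "(c :: nat set \<Rightarrow> ('n::finite, 'k::field) laurent) \<in> cocycles gs r \<Longrightarrow> d \<in> cocycles gs r \<Longrightarrow> c + d \<in> cocycles gs r"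
  by (simp add: cocycles_iff plus_fun_def component_add closed_cochain_add)

lemma coboundaries_smult: "(c :: nat set \<Rightarrow> ('n::finite, 'k::field) laurent) \<in> coboundaries gs r \<Longrightarrow> (\<lambda>S. to_laurent p * c S) \<in> coboundaries gs r"
  by (cases r) (auto simp: coboundaries_def image_iff cech_diff_smult[symmetric] intro: cech_smult)

lemma coboundaries_deriv: "(c :: nat set \<Rightarrow> ('n::finite, 'k::field) laurent) \<in> coboundaries gs r \<Longrightarrow> (\<lambda>S. laurent_deriv i (c S)) \<in> coboundaries gs r"
  by (cases r) (auto simp: coboundaries_def image_iff cech_diff_deriv[symmetric] intro: cech_deriv)

lemma additive_coboundaries: "additive_subset (coboundaries gs r :: (nat set \<Rightarrow> ('n::finite, 'k::field) laurent) set)"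
proof (cases r)
  case 0
  then show ?thesis by (simp add: coboundaries_def additive_subset_def zero_fun_def fun_diff_def)
next
  case (Suc q)
  have diff: "(\<lambda>S. c S - d S) \<in> cech gs q" if "c \<in> cech gs q" "d \<in> cech gs q" for c d :: "nat set \<Rightarrow> ('n, 'k) laurent"
    using that by (simp add: cech_iff component_diff cochain_diff)
  have "(\<lambda>_. 0) \<in> (cech gs q :: (nat set \<Rightarrow> ('n, 'k) laurent) set)"
    by (simp add: cech_iff component_zero cochain_zero)
  moreover have "cech_diff gs (\<lambda>_. 0) = (\<lambda>_. 0 :: ('n, 'k) laurent)"
    by (rule ext) (simp add: cech_diff_def)
  ultimately have "0 \<in> (coboundaries gs r :: (nat set \<Rightarrow> ('n, 'k) laurent) set)"
    using Suc by (force simp: coboundaries_def zero_fun_def)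
  moreover have "x - y \<in> coboundaries gs r"
    if "x \<in> coboundaries gs r" "y \<in> coboundaries gs r" for x y :: "nat set \<Rightarrow> ('n, 'k) laurent"
    using that Suc diff by (auto simp: coboundaries_def fun_diff_def cech_diff_diff[symmetric])
  ultimately show ?thesis by (simp add: additive_subset_def)
qed

text \<open>
  Proved degree by degree, where it is the square of the Koszul differential.
\<close>
lemma coboundaries_cocycles: "(c :: nat set \<Rightarrow> ('n::finite, 'k::field) laurent) \<in> coboundaries gs r \<Longrightarrow> c \<in> cocycles gs r"
proof -
  assume c: "c \<in> coboundaries gs r"
  have "cech_closed gs N r l" if ex: "cech_exact gs N r l" for N and l :: "nat set \<Rightarrow> 'k"
  proof (cases r)
    case 0
    then show ?thesis using ex by (simp add: exact_cochain_def closed_cochain_zero)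
  next
    case (Suc q)
    then obtain e where e: "cech_cochain gs N q e" "l = (\<lambda>T. if T \<subseteq> {..<length gs} then koszul e T else 0)"
      using ex by (auto simp: exact_cochain_def)
    have "T \<subseteq> {..<length gs} \<and> card T = r \<and> N \<subseteq> \<Union> (cover gs ` T)" if nz: "l T \<noteq> 0" for T
    proof -
      have T: "T \<subseteq> {..<length gs}" and "koszul e T \<noteq> 0" using nz e(2) by (auto split: if_splits)
      then obtain i where i: "i \<in> T" "e (T - {i}) \<noteq> 0" using koszul_nonzero by blast
      then have *: "card (T - {i}) = q" "N \<subseteq> \<Union> (cover gs ` (T - {i}))" using e(1) unfolding cochain_def by blast+
      have "finite T" using T finite_subset by blast
      then have "card T = r" using *(1) i Suc card_Suc_Diff1[of T i] by simp
      then show ?thesis using T * by blast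
    qed
    moreover have "koszul l T = 0" if T: "T \<subseteq> {..<length gs}" for T
    proof -
      have "koszul l T = koszul (koszul e) T"
        by (rule koszul_cong) (use T e(2) in auto)
      then show ?thesis using koszul_koszul[of T e] T finite_subset by fastforce
    qed
    ultimately show ?thesis by (simp add: closed_cochain_def cochain_def)
  qed
  then show ?thesis using exact_component[OF c] by (simp add: cocycles_iff)
qed

section \<open>Local cohomology as a module\<close>

definition coh_class :: "('n \<Rightarrow> nat) list \<Rightarrow> nat \<Rightarrow> (nat set \<Rightarrow> ('n, 'k::field) laurent) \<Rightarrow> (nat set \<Rightarrow> ('n, 'k) laurent) set" where
  "coh_class gs r c = plus_coset (coboundaries gs r) c"

lemma coh_class_eq_iff:
  "coh_class gs r c = coh_class gs r d \<longleftrightarrow> c - d \<in> (coboundaries gs r :: (nat set \<Rightarrow> ('n::finite, 'k::field) laurent) set)"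
  by (simp add: coh_class_def plus_coset_eq_iff[OF additive_coboundaries])

lemma cochain_coset: "N +>\<^bsub>submod cochain_module Z\<^esub> c = plus_coset N c"
  by (auto simp: a_r_coset_def' submod_def cochain_module_def plus_coset_def plus_fun_def)

lemma cohomology_simps:
  fixes c d :: "nat set \<Rightarrow> ('n::finite, 'k::field) laurent"
  shows "carrier (local_cohomology gs r :: (_, (nat set \<Rightarrow> ('n, 'k) laurent) set, 'n) graded_dmodule) = coh_class gs r ` cocycles gs r"
    and "coh_class gs r c \<oplus>\<^bsub>local_cohomology gs r\<^esub> coh_class gs r d = coh_class gs r (c + d)"
    and "p \<odot>\<^bsub>local_cohomology gs r\<^esub> coh_class gs r c = coh_class gs r (\<lambda>S. to_laurent p * c S)"
    and "deriv (local_cohomology gs r) i (coh_class gs r c) = coh_class gs r (\<lambda>S. laurent_deriv i (c S))"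
    and "piece (local_cohomology gs r :: (_, (nat set \<Rightarrow> ('n, 'k) laurent) set, 'n) graded_dmodule) a
      = coh_class gs r ` {c \<in> cocycles gs r. \<forall>S. c S \<in> laurent_piece a}"
proof -
  note N = additive_coboundaries[of gs r, where 'k = 'k]
  show "carrier (local_cohomology gs r :: (_, (nat set \<Rightarrow> ('n, 'k) laurent) set, 'n) graded_dmodule) = coh_class gs r ` cocycles gs r"
    by (auto simp: local_cohomology_def quotmod_def A_RCOSETS_def' cochain_coset coh_class_def)
       (auto simp: submod_def)
  show "coh_class gs r c \<oplus>\<^bsub>local_cohomology gs r\<^esub> coh_class gs r d = coh_class gs r (c + d)"
    using plus_coset_add[OF N, where x = c and y = d]
    by (simp add: local_cohomology_def quotmod_def set_add_def set_mult_def coh_class_def submod_def cochain_module_def plus_fun_def)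
  show "p \<odot>\<^bsub>local_cohomology gs r\<^esub> coh_class gs r c = coh_class gs r (\<lambda>S. to_laurent p * c S)"
  proof -
    have "(\<Union>u\<in>plus_coset (coboundaries gs r) c. plus_coset (coboundaries gs r) (\<lambda>S. to_laurent p * u S))
        = plus_coset (coboundaries gs r) (\<lambda>S. to_laurent p * c S)"
    proof (rule Union_plus_coset[OF N])
      fix h :: "nat set \<Rightarrow> ('n, 'k) laurent" assume "h \<in> coboundaries gs r"
      then have "(\<lambda>S. to_laurent p * h S) \<in> coboundaries gs r" by (rule coboundaries_smult)
      moreover have "(\<lambda>S. to_laurent p * (h + c) S) - (\<lambda>S. to_laurent p * c S) = (\<lambda>S. to_laurent p * h S)"
        by (simp add: fun_eq_iff fun_diff_def distrib_left)
      ultimately show "(\<lambda>S. to_laurent p * (h + c) S) - (\<lambda>S. to_laurent p * c S) \<in> coboundaries gs r" by simp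
    qed
    then show ?thesis
      by (simp add: local_cohomology_def quotmod_def cochain_coset coh_class_def) (simp add: submod_def cochain_module_def)
  qed
  show "deriv (local_cohomology gs r) i (coh_class gs r c) = coh_class gs r (\<lambda>S. laurent_deriv i (c S))"
  proof -
    have "(\<Union>u\<in>plus_coset (coboundaries gs r) c. plus_coset (coboundaries gs r) (\<lambda>S. laurent_deriv i (u S)))
        = plus_coset (coboundaries gs r) (\<lambda>S. laurent_deriv i (c S))"
    proof (rule Union_plus_coset[OF N])
      fix h :: "nat set \<Rightarrow> ('n, 'k) laurent" assume "h \<in> coboundaries gs r"
      then have "(\<lambda>S. laurent_deriv i (h S)) \<in> coboundaries gs r" by (rule coboundaries_deriv)
      moreover have "(\<lambda>S. laurent_deriv i ((h + c) S)) - (\<lambda>S. laurent_deriv i (c S)) = (\<lambda>S. laurent_deriv i (h S))"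
        by (simp add: fun_eq_iff fun_diff_def laurent_deriv_add)
      ultimately show "(\<lambda>S. laurent_deriv i ((h + c) S)) - (\<lambda>S. laurent_deriv i (c S)) \<in> coboundaries gs r" by simp
    qed
    then show ?thesis
      by (simp add: local_cohomology_def quotmod_def cochain_coset coh_class_def) (simp add: submod_def cochain_module_def)
  qed
  show "piece (local_cohomology gs r :: (_, (nat set \<Rightarrow> ('n, 'k) laurent) set, 'n) graded_dmodule) a
      = coh_class gs r ` {c \<in> cocycles gs r. \<forall>S. c S \<in> laurent_piece a}"
    by (simp add: local_cohomology_def quotmod_def cochain_coset coh_class_def)
       (auto simp: submod_def cochain_module_def)
qed

section \<open>Functionals define homomorphisms\<close>

text \<open>
  Linear functionals on the cohomology of \<open>C\<^sub>N\<close>, as functions on cocycles that kill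
  coboundaries.
\<close>
definition functional :: "('n \<Rightarrow> nat) list \<Rightarrow> nat \<Rightarrow> 'n set \<Rightarrow> ((nat set \<Rightarrow> 'k::field) \<Rightarrow> 'k) \<Rightarrow> bool" where
  "functional gs r N \<phi> \<longleftrightarrow>
     (\<forall>c d. cech_closed gs N r c \<longrightarrow> cech_closed gs N r d \<longrightarrow> \<phi> (\<lambda>S. c S + d S) = \<phi> c + \<phi> d) \<and>
     (\<forall>t c. cech_closed gs N r c \<longrightarrow> \<phi> (\<lambda>S. t * c S) = t * \<phi> c) \<and>
     (\<forall>c. cech_closed gs N r c \<longrightarrow> cech_exact gs N r c \<longrightarrow> \<phi> c = 0)"

lemma functionalD:
  assumes "functional gs r N \<phi>" "cech_closed gs N r c"
  shows "cech_closed gs N r d \<Longrightarrow> \<phi> (\<lambda>S. c S + d S) = \<phi> c + \<phi> d"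
    and "\<phi> (\<lambda>S. t * c S) = t * \<phi> c"
    and "cech_exact gs N r c \<Longrightarrow> \<phi> c = 0"
  using assms by (simp_all add: functional_def)

lemma functional_zero: "functional gs r N \<phi> \<Longrightarrow> \<phi> (\<lambda>_. 0) = 0"
  using functionalD(2)[of gs r N \<phi> "\<lambda>_. 0" 0] closed_cochain_zero by auto

lemma functional_sum:
  assumes "functional gs r N \<phi>" "finite E" "\<And>e. e \<in> E \<Longrightarrow> cech_closed gs N r (c e)"
  shows "\<phi> (\<lambda>S. \<Sum>e\<in>E. c e S) = (\<Sum>e\<in>E. \<phi> (c e))"
  using assms(2,3)
  by (induction E rule: finite_induct)
     (simp_all add: functional_zero[OF assms(1)] functionalD(1)[OF assms(1)] closed_cochain_sum)

text \<open>
  The Laurent polynomial with coefficient \<open>\<phi>\<close> of the degree \<open>a\<close> component of \<open>c\<close> at \<open>x\<^sup>a\<close>.  Only the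
  degrees are kept that survive in \<open>E\<^sub>\<alpha>\<close>; in them the component of a cocycle is a cocycle of
  \<open>C\<^sub>N\<close> for \<open>N = face \<alpha>\<close>, on which \<open>\<phi>\<close> is meaningful.
\<close>
definition pairing :: "('n deg) \<Rightarrow> ((nat set \<Rightarrow> 'k) \<Rightarrow> 'k) \<Rightarrow> nat \<Rightarrow> (nat set \<Rightarrow> ('n, 'k::field) laurent) \<Rightarrow> ('n, 'k) laurent" where
  "pairing \<alpha> \<phi> m c = (\<Sum>a\<in>{a \<in> \<Union>S\<in>Pow {..<m}. Poly_Mapping.keys (c S). face \<alpha> \<subseteq> neg a}. Poly_Mapping.single a (\<phi> (component c a)))"

lemma lookup_pairing:
  assumes c: "(c :: nat set \<Rightarrow> ('n::finite, 'k::field) laurent) \<in> cocycles gs r" and \<phi>: "functional gs r (face \<alpha>) \<phi>"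
  shows "Poly_Mapping.lookup (pairing \<alpha> \<phi> (length gs) c) a = (if face \<alpha> \<subseteq> neg a then \<phi> (component c a) else 0)"
proof -
  let ?A = "{a \<in> \<Union>S\<in>Pow {..<length gs}. Poly_Mapping.keys (c S). face \<alpha> \<subseteq> neg a}"
  have fin: "finite ?A" by (rule finite_subset[of _ "\<Union>S\<in>Pow {..<length gs}. Poly_Mapping.keys (c S)"]) auto
  have *: "Poly_Mapping.lookup (pairing \<alpha> \<phi> (length gs) c) a = (if a \<in> ?A then \<phi> (component c a) else 0)"
    unfolding pairing_def lookup_sum lookup_single when_def using fin by (simp add: sum.delta)
  have "\<phi> (component c a) = 0" if "face \<alpha> \<subseteq> neg a" "a \<notin> ?A"
  proof -
    have "component c a S = 0" for S
    proof (cases "S \<subseteq> {..<length gs}")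
      case True
      then show ?thesis using that by (auto simp: component_def in_keys_iff)
    next
      case False
      have "cech_closed gs (neg a) r (component c a)" using c by (simp add: cocycles_iff)
      then show ?thesis using False unfolding closed_cochain_def cochain_def by blast
    qed
    then have "component c a = (\<lambda>_. 0)" by auto
    then show ?thesis using functional_zero[OF \<phi>] by simp
  qed
  then show ?thesis using * by auto
qed

lemma component_closed:
  "c \<in> cocycles gs r \<Longrightarrow> N \<subseteq> neg a \<Longrightarrow> cech_closed gs N r (component c (a :: ('n::finite) deg) :: nat set \<Rightarrow> 'k::field)"
  by (rule closed_cochain_antimono[of _ _ "neg a"]) (simp_all add: cocycles_iff)

definition hom_of :: "('n \<Rightarrow> nat) list \<Rightarrow> nat \<Rightarrow> ('n::finite) deg \<Rightarrow> ((nat set \<Rightarrow> 'k) \<Rightarrow> 'k) \<Rightarrow>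
    (nat set \<Rightarrow> ('n, 'k::field) laurent) set \<Rightarrow> ('n, 'k) laurent set" where
  "hom_of gs r \<alpha> \<phi> = (\<lambda>U\<in>carrier (local_cohomology gs r).
     inj_class \<alpha> (pairing \<alpha> \<phi> (length gs) (SOME c. c \<in> cocycles gs r \<and> U = coh_class gs r c)))"

context
  fixes gs :: "('n::finite \<Rightarrow> nat) list" and r :: nat and \<alpha> :: "'n deg" and \<phi> :: "(nat set \<Rightarrow> 'k::field) \<Rightarrow> 'k"
  assumes \<phi>: "functional gs r (face \<alpha>) \<phi>"
begin

lemma hom_of_class:
  assumes c: "(c :: nat set \<Rightarrow> ('n, 'k) laurent) \<in> cocycles gs r"
  shows "hom_of gs r \<alpha> \<phi> (coh_class gs r c) = inj_class \<alpha> (pairing \<alpha> \<phi> (length gs) c)"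
proof -
  let ?d = "SOME d. d \<in> cocycles gs r \<and> coh_class gs r c = coh_class gs r d"
  have "?d \<in> cocycles gs r \<and> coh_class gs r c = coh_class gs r ?d"
    by (rule someI[of _ c]) (use c in simp)
  then have d: "?d \<in> cocycles gs r" "?d - c \<in> coboundaries gs r" using coh_class_eq_iff[of gs r ?d c] by simp_all
  have "inj_class \<alpha> (pairing \<alpha> \<phi> (length gs) ?d) = inj_class \<alpha> (pairing \<alpha> \<phi> (length gs) c)"
    unfolding inj_class_eq_iff
  proof (intro allI impI)
    fix a assume a: "face \<alpha> \<subseteq> neg a"
    have h: "cech_closed gs (face \<alpha>) r (component (?d - c) a)"
      "cech_exact gs (face \<alpha>) r (component (?d - c) a)"
      using component_closed[OF coboundaries_cocycles[OF d(2)] a] exact_component[OF d(2)] exact_cochain_antimono[OF _ a]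
      by blast+
    have "component ?d a = (\<lambda>S. component (?d - c) a S + component c a S)"
      by (rule ext) (simp add: component_def fun_diff_def lookup_minus)
    then have "\<phi> (component ?d a) = \<phi> (component c a)"
      using functionalD(1)[OF \<phi> h(1) component_closed[OF c a]] functionalD(3)[OF \<phi> h] by simp
    then show "Poly_Mapping.lookup (pairing \<alpha> \<phi> (length gs) ?d) a = Poly_Mapping.lookup (pairing \<alpha> \<phi> (length gs) c) a"
      using a by (simp add: lookup_pairing[OF d(1) \<phi>] lookup_pairing[OF c \<phi>])
  qed
  then show ?thesis
    using c by (simp add: hom_of_def cohomology_simps(1))
qed

text \<open>
  Both descriptions of the admissible maps are verified: commuting with the derivations and
  preserving degrees.  For the derivations the only degrees in which \<open>E\<^sub>\<alpha>\<close> sees \<open>\<partial>\<^sub>i c\<close> but not \<open>c\<close> are those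
  with exponent \<open>-1\<close> at \<open>x\<^sub>i\<close>, and there \<open>\<partial>\<^sub>i c = 0\<close>.
\<close>
lemma hom_of_in_diff_homs: "hom_of gs r \<alpha> \<phi> \<in> diff_homs (local_cohomology gs r) (inj_module \<alpha>)"
proof -
  let ?M = "local_cohomology gs r :: (_, (nat set \<Rightarrow> ('n, 'k) laurent) set, 'n) graded_dmodule"
  let ?f = "hom_of gs r \<alpha> \<phi>" and ?P = "pairing \<alpha> \<phi> (length gs)"
  have add: "inj_class \<alpha> (?P (c + d)) = inj_class \<alpha> (?P c + ?P d)" if c: "c \<in> cocycles gs r" and d: "d \<in> cocycles gs r" for c d
    unfolding inj_class_eq_iff
  proof (intro allI impI)
    fix a assume a: "face \<alpha> \<subseteq> neg a"
    have "component (c + d) a = (\<lambda>S. component c a S + component d a S)"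
      by (simp only: plus_fun_def component_add)
    then have "\<phi> (component (c + d) a) = \<phi> (component c a) + \<phi> (component d a)"
      using functionalD(1)[OF \<phi> component_closed[OF c a] component_closed[OF d a]] by simp
    then show "Poly_Mapping.lookup (?P (c + d)) a = Poly_Mapping.lookup (?P c + ?P d) a"
      using a by (simp add: lookup_add lookup_pairing[OF _ \<phi>] cocycles_add c d)
  qed
  have smult: "inj_class \<alpha> (?P (\<lambda>S. to_laurent p * c S)) = inj_class \<alpha> (to_laurent p * ?P c)"
    if c: "c \<in> cocycles gs r" for c p
    unfolding inj_class_eq_iff
  proof (intro allI impI)
    fix a assume a: "face \<alpha> \<subseteq> neg a"
    have a': "face \<alpha> \<subseteq> neg (a - to_deg e)" for e using a neg_shift[of a e] by blast
    note cl = component_closed[OF c a']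
    have "\<phi> (\<lambda>S. \<Sum>e\<in>Poly_Mapping.keys p. Poly_Mapping.lookup p e * component c (a - to_deg e) S)
        = (\<Sum>e\<in>Poly_Mapping.keys p. \<phi> (\<lambda>S. Poly_Mapping.lookup p e * component c (a - to_deg e) S))"
      by (rule functional_sum[OF \<phi>]) (simp_all add: closed_cochain_scale cl)
    also have "\<dots> = (\<Sum>e\<in>Poly_Mapping.keys p. Poly_Mapping.lookup p e * \<phi> (component c (a - to_deg e)))"
      by (simp add: functionalD(2)[OF \<phi> cl])
    finally show "Poly_Mapping.lookup (?P (\<lambda>S. to_laurent p * c S)) a = Poly_Mapping.lookup (to_laurent p * ?P c) a"
      using a a' by (simp add: lookup_pairing[OF _ \<phi>] c cocycles_smult component_smult lookup_to_laurent_mult)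
  qed
  have der: "inj_class \<alpha> (?P (\<lambda>S. laurent_deriv i (c S))) = inj_class \<alpha> (laurent_deriv i (?P c))"
    if c: "c \<in> cocycles gs r" for c i
    unfolding inj_class_eq_iff
  proof (intro allI impI)
    fix a assume a: "face \<alpha> \<subseteq> neg a"
    have "\<phi> (\<lambda>S. of_int (a i + 1) * component c (a + unit_vec i) S)
        = of_int (a i + 1) * (if face \<alpha> \<subseteq> neg (a + unit_vec i) then \<phi> (component c (a + unit_vec i)) else 0)"
    proof (cases "a i = - 1")
      case True
      then show ?thesis using functional_zero[OF \<phi>] by simp
    next
      case False
      then have *: "face \<alpha> \<subseteq> neg (a + unit_vec i)" using a neg_unit[of a i] by blast
      then show ?thesis using functionalD(2)[OF \<phi> component_closed[OF c *]] by simp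
    qed
    then show "Poly_Mapping.lookup (?P (\<lambda>S. laurent_deriv i (c S))) a = Poly_Mapping.lookup (laurent_deriv i (?P c)) a"
      using a by (simp add: lookup_pairing[OF _ \<phi>] c cocycles_deriv component_deriv lookup_laurent_deriv)
  qed
  have hom: "?f \<in> module_homs mpoly_ring ?M (inj_module \<alpha>)"
    unfolding module_homs_def
    by (auto simp: cohomology_simps inj_module_simps hom_of_class cocycles_add cocycles_smult add smult)
  have ext: "?f \<in> extensional (carrier ?M)" by (simp add: hom_of_def)
  have deriv: "?f (deriv ?M i x) = deriv (inj_module \<alpha>) i (?f x)" if "x \<in> carrier ?M" for i x
    using that by (auto simp: cohomology_simps inj_module_simps hom_of_class cocycles_deriv der)
  have piece: "?f ` piece ?M a \<subseteq> piece (inj_module \<alpha>) a" for a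
  proof
    fix y assume "y \<in> ?f ` piece ?M a"
    then obtain c where c: "c \<in> cocycles gs r" "\<And>S. c S \<in> laurent_piece a" "y = inj_class \<alpha> (?P c)"
      by (auto simp: cohomology_simps hom_of_class)
    have "?P c \<in> laurent_piece a"
      unfolding laurent_piece_iff
    proof (intro allI impI)
      fix b assume "b \<noteq> a"
      then have "component c b = (\<lambda>_. 0)" using c(2) by (auto simp: component_def laurent_piece_iff)
      then show "Poly_Mapping.lookup (?P c) b = 0" using functional_zero[OF \<phi>] by (simp add: lookup_pairing[OF c(1) \<phi>])
    qed
    then show "y \<in> piece (inj_module \<alpha>) a" using c(3) by (simp add: inj_module_simps)
  qed
  show ?thesis using hom ext deriv piece by (simp add: diff_homs_def)
qed

end

lemma functional_antimono:
  assumes "functional gs r N \<phi>" "N \<subseteq> N'"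
  shows "functional gs r N' \<phi>"
  unfolding functional_def
  by (intro conjI allI impI functionalD[OF assms(1)] closed_cochain_antimono[OF _ assms(2)]
      exact_cochain_antimono[OF _ assms(2)])

lemma hom_of_cong:
  fixes \<phi> \<psi> :: "(nat set \<Rightarrow> 'k::field) \<Rightarrow> 'k"
  assumes \<phi>: "functional gs r (face \<alpha>) \<phi>" and \<psi>: "functional gs r (face \<alpha>) \<psi>"
    and eq: "\<And>l. cech_closed gs (face \<alpha>) r l \<Longrightarrow> \<phi> l = \<psi> l"
  shows "hom_of gs r \<alpha> \<phi> = (hom_of gs r \<alpha> \<psi> :: (nat set \<Rightarrow> ('n::finite, 'k) laurent) set \<Rightarrow> _)"
proof (rule extensionalityI)
  let ?M = "local_cohomology gs r :: (_, (nat set \<Rightarrow> ('n, 'k) laurent) set, 'n) graded_dmodule"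
  show "hom_of gs r \<alpha> \<phi> \<in> extensional (carrier ?M)" "hom_of gs r \<alpha> \<psi> \<in> extensional (carrier ?M)"
    by (simp_all add: hom_of_def)
  fix x assume "x \<in> carrier ?M"
  then obtain c where c: "c \<in> cocycles gs r" "x = coh_class gs r c" by (auto simp: cohomology_simps)
  have "inj_class \<alpha> (pairing \<alpha> \<phi> (length gs) c) = inj_class \<alpha> (pairing \<alpha> \<psi> (length gs) c)"
    using component_closed[OF c(1)] eq
    by (simp add: inj_class_eq_iff lookup_pairing[OF c(1) \<phi>] lookup_pairing[OF c(1) \<psi>])
  then show "hom_of gs r \<alpha> \<phi> x = hom_of gs r \<alpha> \<psi> x"
    by (simp add: c(2) hom_of_class[OF \<phi> c(1)] hom_of_class[OF \<psi> c(1)])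
qed

lemma neg_uminus: "\<alpha> \<in> cube \<Longrightarrow> neg (\<lambda>i. - \<alpha> i) = face \<alpha>"
  by (auto simp: neg_def face_def cube_def)

lemma inj_class_single_eq_iff:
  "face \<alpha> \<subseteq> neg a \<Longrightarrow> inj_class \<alpha> (Poly_Mapping.single a s) = inj_class \<alpha> (Poly_Mapping.single a t) \<longleftrightarrow> s = t"
  by (auto simp: inj_class_eq_iff lookup_single when_def)

text \<open>
  The functional can be read off in degree \<open>-\<alpha>\<close>.
\<close>
lemma hom_of_inject:
  fixes \<phi> \<psi> :: "(nat set \<Rightarrow> 'k::field) \<Rightarrow> 'k"
  assumes \<alpha>: "\<alpha> \<in> cube" and \<phi>: "functional gs r (face \<alpha>) \<phi>" and \<psi>: "functional gs r (face \<alpha>) \<psi>"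
    and eq: "hom_of gs r \<alpha> \<phi> = (hom_of gs r \<alpha> \<psi> :: (nat set \<Rightarrow> ('n::finite, 'k) laurent) set \<Rightarrow> _)"
    and l: "cech_closed gs (face \<alpha>) r l"
  shows "\<phi> l = \<psi> l"
proof -
  let ?a = "\<lambda>i. - \<alpha> i"
  let ?c = "monomial_cochain ?a l :: nat set \<Rightarrow> ('n, 'k) laurent"
  have c: "?c \<in> cocycles gs r" by (rule monomial_cocycle) (simp add: neg_uminus[OF \<alpha>] l)
  have "inj_class \<alpha> (pairing \<alpha> \<phi> (length gs) ?c) = inj_class \<alpha> (pairing \<alpha> \<psi> (length gs) ?c)"
    using eq hom_of_class[OF \<phi> c] hom_of_class[OF \<psi> c] by simp
  then have "Poly_Mapping.lookup (pairing \<alpha> \<phi> (length gs) ?c) ?a = Poly_Mapping.lookup (pairing \<alpha> \<psi> (length gs) ?c) ?a"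
    using neg_uminus[OF \<alpha>] by (simp add: inj_class_eq_iff)
  then show ?thesis
    by (simp add: lookup_pairing[OF c \<phi>] lookup_pairing[OF c \<psi>] neg_uminus[OF \<alpha>] component_monomial_cochain)
qed

section \<open>Every homomorphism comes from a functional\<close>

context
  fixes gs :: "('n::finite \<Rightarrow> nat) list" and r :: nat and \<alpha> :: "'n deg"
    and f :: "(nat set \<Rightarrow> ('n, 'k::field) laurent) set \<Rightarrow> ('n, 'k) laurent set"
  assumes \<alpha>: "\<alpha> \<in> cube" and f: "f \<in> diff_homs (local_cohomology gs r) (inj_module \<alpha>)"
begin

lemma hom_class: "c \<in> cocycles gs r \<Longrightarrow> \<exists>g. f (coh_class gs r c) = inj_class \<alpha> g"
proof -
  assume "c \<in> cocycles gs r"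
  then have "coh_class gs r c \<in> carrier (local_cohomology gs r)" by (simp add: cohomology_simps)
  then have "f (coh_class gs r c) \<in> carrier (inj_module \<alpha>)"
    using f unfolding diff_homs_def module_homs_def by auto
  then show ?thesis by (auto simp: inj_module_simps)
qed

lemma hom_add: "c \<in> cocycles gs r \<Longrightarrow> d \<in> cocycles gs r \<Longrightarrow>
    f (coh_class gs r (c + d)) = f (coh_class gs r c) \<oplus>\<^bsub>inj_module \<alpha>\<^esub> f (coh_class gs r d)"
  using f unfolding diff_homs_def module_homs_def by (simp add: cohomology_simps)

lemma hom_smult: "c \<in> cocycles gs r \<Longrightarrow>
    f (coh_class gs r (\<lambda>S. to_laurent p * c S)) = p \<odot>\<^bsub>inj_module \<alpha>\<^esub> f (coh_class gs r c)"
  using f unfolding diff_homs_def module_homs_def by (simp add: cohomology_simps)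

text \<open>
  In characteristic \<open>0\<close> the Euler operator \<open>x\<^sub>i\<partial>\<^sub>i\<close> acts on
  degree \<open>a\<close> as multiplication by \<open>a\<^sub>i\<close>, so the image of an element of degree \<open>a\<close> has no component
  in any other degree.
\<close>
lemma hom_monomial:
  assumes l: "cech_closed gs (neg a) r l"
  shows "\<exists>t. f (coh_class gs r (monomial_cochain a l)) = inj_class \<alpha> (Poly_Mapping.single a t)"
proof -
  let ?c = "monomial_cochain a l :: nat set \<Rightarrow> ('n, 'k) laurent"
  have c: "?c \<in> cocycles gs r" by (rule monomial_cocycle[OF l])
  show ?thesis
  proof (cases "CHAR('k) = 0")
    case False
    have "?c S \<in> laurent_piece a" for S by (simp add: monomial_cochain_def laurent_piece_iff lookup_single when_def)
    then have "coh_class gs r ?c \<in> piece (local_cohomology gs r) a" using c by (auto simp: cohomology_simps)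
    then have "f (coh_class gs r ?c) \<in> piece (inj_module \<alpha>) a"
      using f False unfolding diff_homs_def by auto
    then obtain g where g: "g \<in> laurent_piece a" "f (coh_class gs r ?c) = inj_class \<alpha> g" by (auto simp: inj_module_simps)
    have "g = Poly_Mapping.single a (Poly_Mapping.lookup g a)"
      using g(1) by (intro poly_mapping_eqI) (auto simp: lookup_single when_def laurent_piece_iff)
    then show ?thesis using g(2) by metis
  next
    case True
    obtain g where g: "f (coh_class gs r ?c) = inj_class \<alpha> g" using hom_class[OF c] by blast
    have zero: "Poly_Mapping.lookup g b = 0" if b: "face \<alpha> \<subseteq> neg b" "b \<noteq> a" for b
    proof -
      obtain i where i: "a i \<noteq> b i" using b(2) by (metis ext)
      let ?x = "Poly_Mapping.single (\<lambda>j. if j = i then 1 else 0) 1 :: ('n, 'k) mpoly"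
      let ?s = "Poly_Mapping.single (\<lambda>j. 0) (of_int (a i)) :: ('n, 'k) mpoly"
      have x: "to_laurent ?x = Poly_Mapping.single (unit_vec i) 1"
        by (simp add: unit_vec_def if_distrib cong: if_cong)
      have s: "to_laurent ?s = Poly_Mapping.single 0 (of_int (a i))"
        by (simp add: zero_fun_def)
      have lx: "Poly_Mapping.lookup (to_laurent ?x * laurent_deriv i h) k = of_int (k i) * Poly_Mapping.lookup h k" for h k
      proof -
        have "(k - unit_vec i) i + 1 = k i" by (simp add: unit_vec_def fun_diff_def)
        then show ?thesis by (simp only: x lookup_single_mult_laurent lookup_laurent_deriv) simp
      qed
      have ls: "Poly_Mapping.lookup (to_laurent ?s * h) k = of_int (a i) * Poly_Mapping.lookup h k" for h k
        by (simp only: s lookup_single_mult_laurent diff_0_right)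
      have euler: "(\<lambda>S. to_laurent ?x * laurent_deriv i (?c S)) = (\<lambda>S. to_laurent ?s * ?c S)"
      proof (rule ext, rule poly_mapping_eqI)
        fix S k
        show "Poly_Mapping.lookup (to_laurent ?x * laurent_deriv i (?c S)) k = Poly_Mapping.lookup (to_laurent ?s * ?c S) k"
          unfolding lx ls by (auto simp: monomial_cochain_def lookup_single when_def)
      qed
      have dc: "(\<lambda>S. laurent_deriv i (?c S)) \<in> cocycles gs r" by (rule cocycles_deriv[OF c])
      have fd: "f (coh_class gs r (\<lambda>S. laurent_deriv i (?c S))) = deriv (inj_module \<alpha>) i (f (coh_class gs r ?c))"
      proof -
        have "coh_class gs r ?c \<in> carrier (local_cohomology gs r)" using c by (simp add: cohomology_simps)
        then have "f (deriv (local_cohomology gs r) i (coh_class gs r ?c)) = deriv (inj_module \<alpha>) i (f (coh_class gs r ?c))"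
          using f True unfolding diff_homs_def by simp
        then show ?thesis by (simp only: cohomology_simps)
      qed
      have "inj_class \<alpha> (to_laurent ?x * laurent_deriv i g) = inj_class \<alpha> (to_laurent ?s * g)"
        using hom_smult[OF dc, of ?x] hom_smult[OF c, of ?s]
        unfolding euler fd g inj_module_simps by simp
      then have "Poly_Mapping.lookup (to_laurent ?x * laurent_deriv i g) b = Poly_Mapping.lookup (to_laurent ?s * g) b"
        using b(1) unfolding inj_class_eq_iff by blast
      then have "of_int (b i) * Poly_Mapping.lookup g b = of_int (a i) * Poly_Mapping.lookup g b"
        unfolding lx ls .
      then have "of_int (b i - a i) * Poly_Mapping.lookup g b = 0" by (simp add: left_diff_distrib)
      moreover have "(of_int (b i - a i) :: 'k) \<noteq> 0"
        using i True by (simp only: of_int_eq_0_iff_char_dvd) simp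
      ultimately show ?thesis by simp
    qed
    have "inj_class \<alpha> g = inj_class \<alpha> (Poly_Mapping.single a (Poly_Mapping.lookup g a))"
      unfolding inj_class_eq_iff using zero by (auto simp: lookup_single when_def)
    then show ?thesis using g by auto
  qed
qed

definition value_at :: "'n deg \<Rightarrow> (nat set \<Rightarrow> 'k) \<Rightarrow> 'k" where
  "value_at a l = (SOME t. f (coh_class gs r (monomial_cochain a l)) = inj_class \<alpha> (Poly_Mapping.single a t))"

lemma hom_monomial_value: "cech_closed gs (neg a) r l \<Longrightarrow> f (coh_class gs r (monomial_cochain a l)) = inj_class \<alpha> (Poly_Mapping.single a (value_at a l))"
  unfolding value_at_def by (rule someI_ex) (rule hom_monomial)

text \<open>
  Linearity over \<open>x\<^sup>e\<close>, which moves degree \<open>b\<close> to \<open>b + e\<close> without changing the scalars.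
\<close>
lemma value_at_shift:
  assumes l: "cech_closed gs (neg b) r l" and a: "face \<alpha> \<subseteq> neg (b + to_deg e)"
  shows "value_at (b + to_deg e) l = value_at b l"
proof -
  have sub: "neg (b + to_deg e) \<subseteq> neg b" using neg_shift[of "b + to_deg e" e] by simp
  have "(\<lambda>S. to_laurent (Poly_Mapping.single e 1) * monomial_cochain b l S) = (monomial_cochain (b + to_deg e) l :: nat set \<Rightarrow> ('n, 'k) laurent)"
    by (rule ext) (simp add: monomial_cochain_def mult_single add.commute)
  then have "inj_class \<alpha> (Poly_Mapping.single (b + to_deg e) (value_at (b + to_deg e) l))
      = Poly_Mapping.single e 1 \<odot>\<^bsub>inj_module \<alpha>\<^esub> inj_class \<alpha> (Poly_Mapping.single b (value_at b l))"
    using hom_smult[OF monomial_cocycle[OF l], of "Poly_Mapping.single e 1"] hom_monomial_value[OF l]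
      hom_monomial_value[OF closed_cochain_antimono[OF l sub]] by simp
  also have "\<dots> = inj_class \<alpha> (Poly_Mapping.single (b + to_deg e) (value_at b l))"
    by (simp add: inj_module_simps mult_single add.commute)
  finally show ?thesis by (simp only: inj_class_single_eq_iff[OF a])
qed

definition hom_functional :: "(nat set \<Rightarrow> 'k) \<Rightarrow> 'k" where
  "hom_functional = value_at (\<lambda>i. - \<alpha> i)"

lemma value_at_eq:
  assumes a: "face \<alpha> \<subseteq> neg a" and l: "cech_closed gs (neg a) r l"
  shows "value_at a l = hom_functional l"
proof -
  \<comment> \<open>a degree from which both \<open>a\<close> and \<open>-\<alpha>\<close> are reached by multiplication with monomials; it has
    the same negative coordinates as \<open>a\<close>, so that \<open>l\<close> is still a cocycle there\<close>
  let ?b = "\<lambda>i. min (a i) (- \<alpha> i)"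
  have nb: "neg ?b = neg a"
    using a neg_uminus[OF \<alpha>] by (auto simp: neg_def min_less_iff_disj)
  have 1: "a = ?b + to_deg (\<lambda>i. nat (a i - ?b i))" and 2: "(\<lambda>i. - \<alpha> i) = ?b + to_deg (\<lambda>i. nat (- \<alpha> i - ?b i))"
    by (auto simp: fun_eq_iff)
  have "value_at a l = value_at ?b l"
    using value_at_shift[of ?b l "\<lambda>i. nat (a i - ?b i)"] 1 a l nb by simp
  also have "\<dots> = value_at (\<lambda>i. - \<alpha> i) l"
    using value_at_shift[of ?b l "\<lambda>i. nat (- \<alpha> i - ?b i)"] 2 l nb neg_uminus[OF \<alpha>] by simp
  finally show ?thesis by (simp add: hom_functional_def)
qed

lemma value_at_base: "cech_closed gs (face \<alpha>) r l \<Longrightarrow>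
    f (coh_class gs r (monomial_cochain (\<lambda>i. - \<alpha> i) l)) = inj_class \<alpha> (Poly_Mapping.single (\<lambda>i. - \<alpha> i) (hom_functional l))"
  unfolding hom_functional_def by (rule hom_monomial_value) (simp add: neg_uminus[OF \<alpha>])

lemma base_inject: "inj_class \<alpha> (Poly_Mapping.single (\<lambda>i. - \<alpha> i) s) = inj_class \<alpha> (Poly_Mapping.single (\<lambda>i. - \<alpha> i) t) \<longleftrightarrow> s = (t :: 'k)"
  by (rule inj_class_single_eq_iff) (simp add: neg_uminus[OF \<alpha>])

lemma base_cocycle: "cech_closed gs (face \<alpha>) r l \<Longrightarrow> monomial_cochain (\<lambda>i. - \<alpha> i) l \<in> cocycles gs r"
  by (rule monomial_cocycle) (simp add: neg_uminus[OF \<alpha>])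

lemma hom_zero: "f (coh_class gs r (\<lambda>_. 0)) = inj_class \<alpha> 0"
proof -
  have c: "(\<lambda>_. 0) \<in> cocycles gs r" by (simp add: cocycles_iff component_zero closed_cochain_zero)
  obtain g where "f (coh_class gs r (\<lambda>_. 0)) = inj_class \<alpha> g" using hom_class[OF c] by blast
  then show ?thesis using hom_smult[OF c, of 0] by (simp add: inj_module_simps to_laurent_def)
qed

lemma functional_hom_functional: "functional gs r (face \<alpha>) hom_functional"
  unfolding functional_def
proof (intro conjI allI impI)
  let ?a = "\<lambda>i. - \<alpha> i"
  fix c d :: "nat set \<Rightarrow> 'k" assume c: "cech_closed gs (face \<alpha>) r c" and d: "cech_closed gs (face \<alpha>) r d"
  have "monomial_cochain ?a (\<lambda>S. c S + d S) = (monomial_cochain ?a c + monomial_cochain ?a d :: nat set \<Rightarrow> ('n, 'k) laurent)"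
    by (rule ext) (simp add: monomial_cochain_def single_add)
  then have "inj_class \<alpha> (Poly_Mapping.single ?a (hom_functional (\<lambda>S. c S + d S))) =
      inj_class \<alpha> (Poly_Mapping.single ?a (hom_functional c)) \<oplus>\<^bsub>inj_module \<alpha>\<^esub> inj_class \<alpha> (Poly_Mapping.single ?a (hom_functional d))"
    using hom_add[OF base_cocycle[OF c] base_cocycle[OF d]] value_at_base[OF closed_cochain_add[OF c d]]
      value_at_base[OF c] value_at_base[OF d] by simp
  also have "\<dots> = inj_class \<alpha> (Poly_Mapping.single ?a (hom_functional c + hom_functional d))"
    by (simp only: inj_module_simps single_add)
  finally show "hom_functional (\<lambda>S. c S + d S) = hom_functional c + hom_functional d" by (simp only: base_inject)
next
  let ?a = "\<lambda>i. - \<alpha> i"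
  fix t and c :: "nat set \<Rightarrow> 'k" assume c: "cech_closed gs (face \<alpha>) r c"
  let ?t = "Poly_Mapping.single (\<lambda>_. 0) t :: ('n, 'k) mpoly"
  have t: "to_laurent ?t = Poly_Mapping.single 0 t" by (simp add: zero_fun_def)
  have "monomial_cochain ?a (\<lambda>S. t * c S) = (\<lambda>S. to_laurent ?t * monomial_cochain ?a c S :: ('n, 'k) laurent)"
    unfolding t by (rule ext) (simp add: monomial_cochain_def mult_single)
  then have "inj_class \<alpha> (Poly_Mapping.single ?a (hom_functional (\<lambda>S. t * c S))) =
      ?t \<odot>\<^bsub>inj_module \<alpha>\<^esub> inj_class \<alpha> (Poly_Mapping.single ?a (hom_functional c))"
    using hom_smult[OF base_cocycle[OF c], of ?t] value_at_base[OF closed_cochain_scale[OF c, of t]] value_at_base[OF c] by simp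
  also have "\<dots> = inj_class \<alpha> (Poly_Mapping.single ?a (t * hom_functional c))"
    unfolding inj_module_simps t by (simp add: mult_single)
  finally show "hom_functional (\<lambda>S. t * c S) = t * hom_functional c" by (simp only: base_inject)
next
  let ?a = "\<lambda>i. - \<alpha> i"
  fix c :: "nat set \<Rightarrow> 'k" assume c: "cech_closed gs (face \<alpha>) r c" and ex: "cech_exact gs (face \<alpha>) r c"
  have "monomial_cochain ?a c \<in> (coboundaries gs r :: (nat set \<Rightarrow> ('n, 'k) laurent) set)"
    by (rule monomial_coboundary) (simp add: neg_uminus[OF \<alpha>] ex)
  then have "coh_class gs r (monomial_cochain ?a c) = coh_class gs r (\<lambda>_. 0 :: ('n, 'k) laurent)"
    by (simp add: coh_class_eq_iff fun_diff_def)
  then have "inj_class \<alpha> (Poly_Mapping.single ?a (hom_functional c)) = inj_class \<alpha> (Poly_Mapping.single ?a 0)"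
    using value_at_base[OF c] hom_zero by simp
  then show "hom_functional c = 0" by (simp only: base_inject)
qed

text \<open>
  A cocycle is the sum of its homogeneous components, on which \<open>f\<close> is known.
\<close>
lemma hom_eq_hom_of: "f = hom_of gs r \<alpha> hom_functional"
proof (rule extensionalityI)
  let ?M = "local_cohomology gs r :: (_, (nat set \<Rightarrow> ('n, 'k) laurent) set, 'n) graded_dmodule"
  show "f \<in> extensional (carrier ?M)" using f by (simp add: diff_homs_def)
  show "hom_of gs r \<alpha> hom_functional \<in> extensional (carrier ?M)" by (simp add: hom_of_def)
  fix x assume "x \<in> carrier ?M"
  then obtain c where c: "c \<in> cocycles gs r" "x = coh_class gs r c" by (auto simp: cohomology_simps)
  let ?A = "\<Union>S\<in>Pow {..<length gs}. Poly_Mapping.keys (c S)"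
  have cl: "cech_closed gs (neg a) r (component c a)" for a using c by (simp add: cocycles_iff)
  have part: "f (coh_class gs r (\<Sum>a\<in>A. monomial_cochain a (component c a))) = inj_class \<alpha> (\<Sum>a\<in>A. Poly_Mapping.single a (value_at a (component c a)))
      \<and> (\<Sum>a\<in>A. monomial_cochain a (component c a)) \<in> cocycles gs r"
    if "finite A" for A
    using that
  proof (induction A rule: finite_induct)
    case empty
    then show ?case using hom_zero by (simp add: zero_fun_def cocycles_iff component_zero closed_cochain_zero)
  next
    case (insert a A)
    let ?m = "monomial_cochain a (component c a)" and ?s = "\<Sum>a\<in>A. monomial_cochain a (component c a)"
    have m: "?m \<in> cocycles gs r" by (rule monomial_cocycle[OF cl])
    have s: "?s \<in> cocycles gs r"
      and fs: "f (coh_class gs r ?s) = inj_class \<alpha> (\<Sum>a\<in>A. Poly_Mapping.single a (value_at a (component c a)))"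
      using insert.IH by blast+
    have sums: "(\<Sum>a\<in>insert a A. monomial_cochain a (component c a)) = ?m + ?s"
      "(\<Sum>a\<in>insert a A. Poly_Mapping.single a (value_at a (component c a)))
        = Poly_Mapping.single a (value_at a (component c a)) + (\<Sum>a\<in>A. Poly_Mapping.single a (value_at a (component c a)))"
      by (rule sum.insert; fact)+
    show ?case
      unfolding sums hom_add[OF m s] fs hom_monomial_value[OF cl] inj_module_simps
      using cocycles_add[OF m s] by blast
  qed
  have "(\<Sum>a\<in>?A. monomial_cochain a (component c a)) = c"
  proof (rule ext, rule poly_mapping_eqI)
    fix S b
    have "(\<Sum>a\<in>A. monomial_cochain a (component c a)) S = (\<Sum>a\<in>A. monomial_cochain a (component c a) S)" if "finite A" for A
      using that by (induction A rule: finite_induct) simp_all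
    then have "Poly_Mapping.lookup ((\<Sum>a\<in>?A. monomial_cochain a (component c a)) S) b = (if b \<in> ?A then component c b S else 0)"
      by (simp add: lookup_sum monomial_cochain_def lookup_single when_def sum.delta)
    also have "\<dots> = component c b S"
    proof -
      have "component c b S = 0" if "b \<notin> ?A"
      proof (cases "S \<subseteq> {..<length gs}")
        case True
        then show ?thesis using that by (auto simp: component_def in_keys_iff)
      next
        case False
        then show ?thesis using cl[of b] unfolding closed_cochain_def cochain_def by blast
      qed
      then show ?thesis by auto
    qed
    finally show "Poly_Mapping.lookup ((\<Sum>a\<in>?A. monomial_cochain a (component c a)) S) b = Poly_Mapping.lookup (c S) b"
      by (simp add: component_def)
  qed
  then have "f x = inj_class \<alpha> (\<Sum>a\<in>?A. Poly_Mapping.single a (value_at a (component c a)))"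
    using part[of ?A] c(2) by simp
  also have "\<dots> = inj_class \<alpha> (pairing \<alpha> hom_functional (length gs) c)"
    unfolding inj_class_eq_iff
  proof (intro allI impI)
    fix b assume b: "face \<alpha> \<subseteq> neg b"
    have "Poly_Mapping.lookup (\<Sum>a\<in>?A. Poly_Mapping.single a (value_at a (component c a))) b
        = (if b \<in> ?A then hom_functional (component c b) else 0)"
      using value_at_eq[OF b cl[of b]] by (simp add: lookup_sum lookup_single when_def sum.delta)
    moreover have "Poly_Mapping.lookup (pairing \<alpha> hom_functional (length gs) c) b = (if b \<in> ?A then hom_functional (component c b) else 0)"
    proof -
      have fin: "finite {a \<in> ?A. face \<alpha> \<subseteq> neg a}" by (rule finite_subset[of _ ?A]) auto
      then show ?thesis unfolding pairing_def lookup_sum lookup_single when_def using b by (simp add: sum.delta)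
    qed
    ultimately show "Poly_Mapping.lookup (\<Sum>a\<in>?A. Poly_Mapping.single a (value_at a (component c a))) b
        = Poly_Mapping.lookup (pairing \<alpha> hom_functional (length gs) c) b" by simp
  qed
  finally show "f x = hom_of gs r \<alpha> hom_functional x"
    by (simp add: c(2) hom_of_class[OF functional_hom_functional c(1)])
qed

end

lemma diff_homs_are_functionals:
  assumes "\<alpha> \<in> cube" "(f :: (nat set \<Rightarrow> ('n::finite, 'k::field) laurent) set \<Rightarrow> _) \<in> diff_homs (local_cohomology gs r) (inj_module \<alpha>)"
  shows "\<exists>\<phi>. functional gs r (face \<alpha>) \<phi> \<and> f = hom_of gs r \<alpha> \<phi>"
  using functional_hom_functional[OF assms] hom_eq_hom_of[OF assms] by blast

section \<open>The hypercube in terms of functionals\<close>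

context
  fixes gs :: "('n::finite \<Rightarrow> nat) list" and r :: nat and \<alpha> :: "'n deg" and \<phi> :: "(nat set \<Rightarrow> 'k::field) \<Rightarrow> 'k"
    and M :: "(('n, 'k) mpoly, (nat set \<Rightarrow> ('n, 'k) laurent) set, 'n) graded_dmodule"
  defines "M \<equiv> local_cohomology gs r"
  assumes \<phi>: "functional gs r (face \<alpha>) \<phi>"
begin

lemma hypercube_carrier: "hom_of gs r \<alpha> \<phi> \<in> carrier (hypercube M \<alpha>)"
  using hom_of_in_diff_homs[OF \<phi>] by (simp add: hypercube_def hom_space_def M_def)

lemma functional_add:
  "functional gs r (face \<alpha>) \<psi> \<Longrightarrow> functional gs r (face \<alpha>) (\<lambda>l. \<phi> l + \<psi> l)"
  using \<phi> by (simp add: functional_def distrib_left)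

lemma functional_scale: "functional gs r (face \<alpha>) (\<lambda>l. t * \<phi> l)"
  using \<phi> by (simp add: functional_def distrib_left)

lemma hypercube_add:
  assumes \<psi>: "functional gs r (face \<alpha>) \<psi>"
  shows "hom_of gs r \<alpha> \<phi> \<oplus>\<^bsub>hypercube M \<alpha>\<^esub> hom_of gs r \<alpha> \<psi> = hom_of gs r \<alpha> (\<lambda>l. \<phi> l + \<psi> l)"
proof (rule extensionalityI[of _ "carrier M"])
  fix x assume x: "x \<in> carrier M"
  then obtain c where c: "c \<in> cocycles gs r" "x = coh_class gs r c" by (auto simp: M_def cohomology_simps)
  have "inj_class \<alpha> (pairing \<alpha> \<phi> (length gs) c + pairing \<alpha> \<psi> (length gs) c) = inj_class \<alpha> (pairing \<alpha> (\<lambda>l. \<phi> l + \<psi> l) (length gs) c)"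
    by (simp add: inj_class_eq_iff lookup_add lookup_pairing[OF c(1)] \<phi> \<psi> functional_add)
  then show "(hom_of gs r \<alpha> \<phi> \<oplus>\<^bsub>hypercube M \<alpha>\<^esub> hom_of gs r \<alpha> \<psi>) x = hom_of gs r \<alpha> (\<lambda>l. \<phi> l + \<psi> l) x"
    using x c by (simp add: hypercube_def hom_space_def hom_of_class \<phi> \<psi> functional_add inj_module_simps)
qed (simp_all add: hypercube_def hom_space_def hom_of_def M_def)

lemma hypercube_smult: "t \<odot>\<^bsub>hypercube M \<alpha>\<^esub> hom_of gs r \<alpha> \<phi> = hom_of gs r \<alpha> (\<lambda>l. t * \<phi> l)"
proof (rule extensionalityI[of _ "carrier M"])
  fix x assume x: "x \<in> carrier M"
  then obtain c where c: "c \<in> cocycles gs r" "x = coh_class gs r c" by (auto simp: M_def cohomology_simps)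
  have "inj_class \<alpha> (to_laurent (Poly_Mapping.single 0 t) * pairing \<alpha> \<phi> (length gs) c) = inj_class \<alpha> (pairing \<alpha> (\<lambda>l. t * \<phi> l) (length gs) c)"
    by (simp add: inj_class_eq_iff lookup_single_mult_laurent lookup_pairing[OF c(1)] \<phi> functional_scale zero_fun_def fun_diff_def)
  then show "(t \<odot>\<^bsub>hypercube M \<alpha>\<^esub> hom_of gs r \<alpha> \<phi>) x = hom_of gs r \<alpha> (\<lambda>l. t * \<phi> l) x"
    using x c by (simp add: hypercube_def hom_space_def hom_of_class \<phi> functional_scale inj_module_simps del: to_laurent_single)
qed (simp_all add: hypercube_def hom_space_def hom_of_def M_def)

lemma hypercube_map_hom_of:
  assumes "\<alpha> i = 0"
  shows "hypercube_map M \<alpha> i (hom_of gs r \<alpha> \<phi>) = hom_of gs r (\<alpha> + unit_vec i) \<phi>"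
proof (rule extensionalityI[of _ "carrier M"])
  have sub: "face \<alpha> \<subseteq> face (\<alpha> + unit_vec i)" using assms by (auto simp: face_def unit_vec_def)
  note \<phi>' = functional_antimono[OF \<phi> sub]
  fix x assume x: "x \<in> carrier M"
  then obtain c where c: "c \<in> cocycles gs r" "x = coh_class gs r c" by (auto simp: M_def cohomology_simps)
  have "inj_class (\<alpha> + unit_vec i) (pairing \<alpha> \<phi> (length gs) c) = inj_class (\<alpha> + unit_vec i) (pairing (\<alpha> + unit_vec i) \<phi> (length gs) c)"
    using sub by (auto simp: inj_class_eq_iff lookup_pairing[OF c(1)] \<phi> \<phi>')
  then show "hypercube_map M \<alpha> i (hom_of gs r \<alpha> \<phi>) x = hom_of gs r (\<alpha> + unit_vec i) \<phi> x"
    using x c by (simp add: hypercube_map_def hom_of_class \<phi> \<phi>' inj_proj_class[of \<alpha> i, OF assms])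
qed (simp_all add: hypercube_map_def hom_of_def M_def)

end

lemma functional_const_zero: "functional gs r N (\<lambda>_. 0)"
  by (simp add: functional_def)

lemma hypercube_zero:
  "\<zero>\<^bsub>hypercube (local_cohomology gs r :: (('n::finite, 'k::field) mpoly, (nat set \<Rightarrow> ('n, 'k) laurent) set, 'n) graded_dmodule) \<alpha>\<^esub> = hom_of gs r \<alpha> (\<lambda>_. 0)"
proof (rule extensionalityI[of _ "carrier (local_cohomology gs r)"])
  fix x :: "(nat set \<Rightarrow> ('n, 'k) laurent) set" assume x: "x \<in> carrier (local_cohomology gs r)"
  then obtain c where c: "c \<in> cocycles gs r" "x = coh_class gs r c" by (auto simp: cohomology_simps)
  have "inj_class \<alpha> 0 = inj_class \<alpha> (pairing \<alpha> (\<lambda>_. 0) (length gs) c)"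
    by (simp add: inj_class_eq_iff lookup_pairing[OF c(1) functional_const_zero])
  then show "\<zero>\<^bsub>hypercube (local_cohomology gs r) \<alpha>\<^esub> x = hom_of gs r \<alpha> (\<lambda>_. 0) x"
    using x c by (simp add: hypercube_def hom_space_def hom_of_class functional_const_zero inj_module_simps)
qed (simp_all add: hypercube_def hom_space_def hom_of_def)

section \<open>Vector spaces with coordinates\<close>

lemma base_field_simps [simp]:
  "carrier (base_field :: 'k::field ring) = UNIV" "\<zero>\<^bsub>base_field\<^esub> = (0 :: 'k)" "\<one>\<^bsub>base_field\<^esub> = (1 :: 'k)"
  "x \<oplus>\<^bsub>base_field\<^esub> y = (x + y :: 'k)" "x \<otimes>\<^bsub>base_field\<^esub> y = (x * y :: 'k)"
  by (simp_all add: ring_of_type_algebra_def)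

text \<open>
  A vector space presented by its coordinate functions.  Only the values of a coordinate function
  on \<open>B\<close> matter; allowing arbitrary functions avoids restrictions throughout.
\<close>
definition coordinates :: "('k::field, 'v) module \<Rightarrow> 'b set \<Rightarrow> (('b \<Rightarrow> 'k) \<Rightarrow> 'v) \<Rightarrow> bool" where
  "coordinates V B \<Psi> \<longleftrightarrow> finite B \<and> carrier V = range \<Psi> \<and> (\<forall>c d. \<Psi> c = \<Psi> d \<longleftrightarrow> (\<forall>b\<in>B. c b = d b)) \<and>
     (\<forall>c d. \<Psi> c \<oplus>\<^bsub>V\<^esub> \<Psi> d = \<Psi> (\<lambda>b. c b + d b)) \<and> (\<forall>t c. t \<odot>\<^bsub>V\<^esub> \<Psi> c = \<Psi> (\<lambda>b. t * c b)) \<and>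
     \<zero>\<^bsub>V\<^esub> = \<Psi> (\<lambda>_. 0)"

context
  fixes V :: "('k::field, 'v) module" and B :: "'b set" and \<Psi> :: "('b \<Rightarrow> 'k) \<Rightarrow> 'v"
  assumes coords: "coordinates V B \<Psi>"
begin

lemma coordinates_simps:
  "finite B" "carrier V = range \<Psi>" "\<Psi> c = \<Psi> d \<longleftrightarrow> (\<forall>b\<in>B. c b = d b)"
  "\<Psi> c \<oplus>\<^bsub>V\<^esub> \<Psi> d = \<Psi> (\<lambda>b. c b + d b)" "t \<odot>\<^bsub>V\<^esub> \<Psi> c = \<Psi> (\<lambda>b. t * c b)" "\<zero>\<^bsub>V\<^esub> = \<Psi> (\<lambda>_. 0)"
  using coords unfolding coordinates_def by blast+

lemma abelian_group_coordinates: "abelian_group V"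
proof (rule abelian_groupI)
  fix x assume "x \<in> carrier V"
  then obtain c where c: "x = \<Psi> c" by (auto simp: coordinates_simps(2))
  show "\<exists>y\<in>carrier V. y \<oplus>\<^bsub>V\<^esub> x = \<zero>\<^bsub>V\<^esub>"
    by (rule bexI[of _ "\<Psi> (\<lambda>b. - c b)"]) (auto simp: c coordinates_simps(2) coordinates_simps(3,4,6))
qed (auto simp: coordinates_simps(2) coordinates_simps(4,6) coordinates_simps(3) add.assoc add.commute)

lemma module_coordinates: "module base_field V"
proof (rule moduleI)
  show "cring (base_field :: 'k ring)" by (rule cring_from_type_algebra)
  show "abelian_group V" by (rule abelian_group_coordinates)
qed (auto simp: coordinates_simps(2,4,5) coordinates_simps(3) algebra_simps)

lemma finsum_coordinates:
  assumes "finite I"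
  shows "(\<Oplus>\<^bsub>V\<^esub>i\<in>I. \<Psi> (c i)) = \<Psi> (\<lambda>b. \<Sum>i\<in>I. c i b)"
proof -
  interpret abelian_group V by (rule abelian_group_coordinates)
  show ?thesis
    using assms
  proof (induction I rule: finite_induct)
    case empty
    then show ?case by (simp add: coordinates_simps(6))
  next
    case (insert i I)
    then have "(\<Oplus>\<^bsub>V\<^esub>i\<in>insert i I. \<Psi> (c i)) = \<Psi> (c i) \<oplus>\<^bsub>V\<^esub> (\<Oplus>\<^bsub>V\<^esub>i\<in>I. \<Psi> (c i))"
      by (intro finsum_insert) (auto simp: coordinates_simps(2))
    then show ?case using insert by (simp add: coordinates_simps(4))
  qed
qed

definition coordinate_basis :: "'b \<Rightarrow> 'v" where
  "coordinate_basis b = \<Psi> (\<lambda>c. if c = b then 1 else 0)"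

lemma expansion: "(\<Oplus>\<^bsub>V\<^esub>b\<in>B. c b \<odot>\<^bsub>V\<^esub> coordinate_basis b) = \<Psi> c"
proof -
  have "(\<Oplus>\<^bsub>V\<^esub>b\<in>B. c b \<odot>\<^bsub>V\<^esub> coordinate_basis b) = \<Psi> (\<lambda>b'. \<Sum>b\<in>B. c b * (if b' = b then 1 else 0))"
    by (simp add: coordinate_basis_def coordinates_simps(5) finsum_coordinates coordinates_simps(1))
  also have "\<dots> = \<Psi> c"
    unfolding coordinates_simps(3)
  proof
    fix b' assume "b' \<in> B"
    then show "(\<Sum>b\<in>B. c b * (if b' = b then 1 else 0)) = c b'"
      using sum_times_delta[OF coordinates_simps(1), of b' c] by (simp add: eq_commute)
  qed
  finally show ?thesis .
qed

lemma is_basis_coordinates: "is_basis base_field V B coordinate_basis"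
  unfolding is_basis_def
proof (intro conjI ballI)
  show "module base_field V" by (rule module_coordinates)
  show "finite B" by (rule coordinates_simps)
  show "coordinate_basis \<in> B \<rightarrow> carrier V" by (auto simp: coordinate_basis_def coordinates_simps(2))
  fix x assume "x \<in> carrier V"
  then obtain c where c: "x = \<Psi> c" by (auto simp: coordinates_simps(2))
  show "\<exists>!c. c \<in> B \<rightarrow>\<^sub>E carrier base_field \<and> x = (\<Oplus>\<^bsub>V\<^esub>b\<in>B. c b \<odot>\<^bsub>V\<^esub> coordinate_basis b)"
  proof (rule ex1I[of _ "restrict c B"])
    show "restrict c B \<in> B \<rightarrow>\<^sub>E carrier base_field \<and> x = (\<Oplus>\<^bsub>V\<^esub>b\<in>B. restrict c B b \<odot>\<^bsub>V\<^esub> coordinate_basis b)"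
      by (simp add: expansion c coordinates_simps(3))
    fix d assume "d \<in> B \<rightarrow>\<^sub>E carrier base_field \<and> x = (\<Oplus>\<^bsub>V\<^esub>b\<in>B. d b \<odot>\<^bsub>V\<^esub> coordinate_basis b)"
    then have d: "d \<in> extensional B" "\<forall>b\<in>B. c b = d b" by (auto simp: expansion c coordinates_simps(3) PiE_def)
    show "d = restrict c B"
      by (rule extensionalityI[of _ B]) (use d in auto)
  qed
qed

end

lemma is_matrix_of_coordinates:
  assumes V: "coordinates V B \<Psi>" and W: "coordinates W C \<Omega>"
    and F: "\<And>c. F (\<Psi> c) = \<Omega> (\<lambda>b'. \<Sum>b\<in>B. A b' b * c b)"
  shows "is_matrix_of base_field V B (coordinate_basis \<Psi>) W C (coordinate_basis \<Omega>) A F"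
  unfolding is_matrix_of_def
proof (intro conjI ballI)
  show "F \<in> module_homs base_field V W"
    unfolding module_homs_def
    by (auto simp: coordinates_simps(2)[OF V] coordinates_simps(2)[OF W] coordinates_simps(4,5)[OF V] coordinates_simps(4,5)[OF W]
        F distrib_left sum.distrib sum_distrib_left mult.left_commute)
  fix b assume b: "b \<in> B"
  have "F (coordinate_basis \<Psi> b) = \<Omega> (\<lambda>b'. A b' b)"
    by (simp add: coordinate_basis_def[OF V] F sum_times_delta[OF coordinates_simps(1)[OF V] b])
  also have "\<dots> = (\<Oplus>\<^bsub>W\<^esub>c\<in>C. A c b \<odot>\<^bsub>W\<^esub> coordinate_basis \<Omega> c)"
    by (rule expansion[OF W, symmetric])
  finally show "F (coordinate_basis \<Psi> b) = (\<Oplus>\<^bsub>W\<^esub>c\<in>C. A c b \<odot>\<^bsub>W\<^esub> coordinate_basis \<Omega> c)" .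
qed

lemma coordinates_direct_sum:
  assumes V: "\<And>\<alpha>. \<alpha> \<in> A \<Longrightarrow> coordinates (V \<alpha>) (B \<alpha>) (\<Psi> \<alpha>)" and A: "finite A"
    and disj: "\<And>\<alpha> \<beta> b. \<alpha> \<in> A \<Longrightarrow> \<beta> \<in> A \<Longrightarrow> b \<in> B \<alpha> \<Longrightarrow> b \<in> B \<beta> \<Longrightarrow> \<alpha> = \<beta>"
  shows "coordinates (direct_sum A V) (\<Union>\<alpha>\<in>A. B \<alpha>) (\<lambda>c. \<lambda>\<alpha>\<in>A. \<Psi> \<alpha> c)"
  unfolding coordinates_def
proof (intro conjI allI)
  show "finite (\<Union>\<alpha>\<in>A. B \<alpha>)" using A coordinates_simps(1)[OF V] by blast
  show "carrier (direct_sum A V) = range (\<lambda>c. \<lambda>\<alpha>\<in>A. \<Psi> \<alpha> c)"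
  proof (intro equalityI subsetI)
    fix x assume x: "x \<in> carrier (direct_sum A V)"
    have "\<exists>c. x \<alpha> = \<Psi> \<alpha> c" if "\<alpha> \<in> A" for \<alpha>
    proof -
      have "x \<alpha> \<in> carrier (V \<alpha>)" using x that by (auto simp: direct_sum_def PiE_def)
      then show ?thesis using coordinates_simps(2)[OF V[OF that]] by auto
    qed
    then obtain c where c: "\<And>\<alpha>. \<alpha> \<in> A \<Longrightarrow> x \<alpha> = \<Psi> \<alpha> (c \<alpha>)" by metis
    define d where "d b = c (SOME \<alpha>. \<alpha> \<in> A \<and> b \<in> B \<alpha>) b" for b
    have d: "d b = c \<alpha> b" if "\<alpha> \<in> A" "b \<in> B \<alpha>" for \<alpha> b
    proof -
      have "(SOME \<alpha>. \<alpha> \<in> A \<and> b \<in> B \<alpha>) = \<alpha>" using that disj by (intro some_equality) auto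
      then show ?thesis by (simp add: d_def)
    qed
    have "x = (\<lambda>\<alpha>\<in>A. \<Psi> \<alpha> d)"
    proof (rule extensionalityI[of _ A])
      show "x \<in> extensional A" using x by (auto simp: direct_sum_def PiE_def)
      fix \<alpha> assume "\<alpha> \<in> A"
      then show "x \<alpha> = (\<lambda>\<alpha>\<in>A. \<Psi> \<alpha> d) \<alpha>" using c d coordinates_simps(3)[OF V] by simp
    qed simp
    then show "x \<in> range (\<lambda>c. \<lambda>\<alpha>\<in>A. \<Psi> \<alpha> c)" by blast
  next
    fix x assume "x \<in> range (\<lambda>c. \<lambda>\<alpha>\<in>A. \<Psi> \<alpha> c)"
    then obtain c where "x = (\<lambda>\<alpha>\<in>A. \<Psi> \<alpha> c)" by blast
    then show "x \<in> carrier (direct_sum A V)" using coordinates_simps(2)[OF V] by (auto simp: direct_sum_def)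
  qed
  fix c d
  show "(\<lambda>\<alpha>\<in>A. \<Psi> \<alpha> c) = (\<lambda>\<alpha>\<in>A. \<Psi> \<alpha> d) \<longleftrightarrow> (\<forall>b\<in>\<Union>\<alpha>\<in>A. B \<alpha>. c b = d b)"
  proof
    assume eq: "(\<lambda>\<alpha>\<in>A. \<Psi> \<alpha> c) = (\<lambda>\<alpha>\<in>A. \<Psi> \<alpha> d)"
    have "\<Psi> \<alpha> c = \<Psi> \<alpha> d" if "\<alpha> \<in> A" for \<alpha> using fun_cong[OF eq, of \<alpha>] that by simp
    then show "\<forall>b\<in>\<Union>\<alpha>\<in>A. B \<alpha>. c b = d b" using coordinates_simps(3)[OF V] by blast
  next
    assume "\<forall>b\<in>\<Union>\<alpha>\<in>A. B \<alpha>. c b = d b"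
    then have "\<Psi> \<alpha> c = \<Psi> \<alpha> d" if "\<alpha> \<in> A" for \<alpha> using that coordinates_simps(3)[OF V[OF that]] by blast
    then show "(\<lambda>\<alpha>\<in>A. \<Psi> \<alpha> c) = (\<lambda>\<alpha>\<in>A. \<Psi> \<alpha> d)" by (intro restrict_ext) auto
  qed
  show "(\<lambda>\<alpha>\<in>A. \<Psi> \<alpha> c) \<oplus>\<^bsub>direct_sum A V\<^esub> (\<lambda>\<alpha>\<in>A. \<Psi> \<alpha> d) = (\<lambda>\<alpha>\<in>A. \<Psi> \<alpha> (\<lambda>b. c b + d b))"
    using coordinates_simps(4)[OF V] by (auto simp: direct_sum_def intro!: restrict_ext)
  show "t \<odot>\<^bsub>direct_sum A V\<^esub> (\<lambda>\<alpha>\<in>A. \<Psi> \<alpha> c) = (\<lambda>\<alpha>\<in>A. \<Psi> \<alpha> (\<lambda>b. t * c b))" for t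
    using coordinates_simps(5)[OF V] by (auto simp: direct_sum_def intro!: restrict_ext)
  show "\<zero>\<^bsub>direct_sum A V\<^esub> = (\<lambda>\<alpha>\<in>A. \<Psi> \<alpha> (\<lambda>_. 0))"
    using coordinates_simps(6)[OF V] by (auto simp: direct_sum_def intro!: restrict_ext)
qed

section \<open>The hypercube in coordinates\<close>

locale hypercube_strand = gluing B \<delta> A aug cov "length gs" "cover gs"
  for B :: "nat \<Rightarrow> 'b set" and \<delta> :: "nat \<Rightarrow> 'b \<Rightarrow> ('n::{finite,linorder}) deg"
    and A :: "nat \<Rightarrow> 'b \<Rightarrow> 'b \<Rightarrow> 'k::field" and aug cov and gs :: "('n \<Rightarrow> nat) list" +
  fixes r :: nat
begin

abbreviation "M \<equiv> local_cohomology gs r :: (('n, 'k) mpoly, (nat set \<Rightarrow> ('n, 'k) laurent) set, 'n) graded_dmodule"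

definition corner_functional :: "'n set \<Rightarrow> ('b \<Rightarrow> 'k) \<Rightarrow> (nat set \<Rightarrow> 'k) \<Rightarrow> 'k" where
  "corner_functional N c l = (\<Sum>b\<in>corner_basis N r. c b * corner_value N r b l)"

lemma finite_corner_basis [simp]: "finite (corner_basis N r)"
  by (simp add: corner_basis_def)

lemma functional_corner_value: "b \<in> corner_basis N r \<Longrightarrow> functional gs r N (corner_value N r b)"
  by (simp add: functional_def corner_value_add corner_value_scale corner_value_exact_iff[symmetric])

lemma functional_corner: "functional gs r N (corner_functional N c)"
  unfolding functional_def corner_functional_def
  by (auto simp: corner_value_add corner_value_scale corner_value_exact_iff[symmetric] distrib_left sum.distrib
      sum_distrib_left mult.left_commute)

lemma dual_cochains:
  "\<exists>l. \<forall>b\<in>corner_basis N r. cech_closed gs N r (l b) \<and>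
     (\<forall>b'\<in>corner_basis N r. corner_value N r b' (l b) = (if b' = b then 1 else 0))"
proof -
  have "\<forall>b. \<exists>l. cech_closed gs N r l \<and>
      (\<forall>b'\<in>corner_basis N r. corner_value N r b' l = (if b' = b then 1 else 0))"
  proof
    fix b
    show "\<exists>l. cech_closed gs N r l \<and>
        (\<forall>b'\<in>corner_basis N r. corner_value N r b' l = (if b' = b then 1 else 0))"
      using corner_value_surjective[of N r "\<lambda>b'. if b' = b then 1 else 0"] .
  qed
  then show ?thesis by metis
qed

text \<open>
  The corner values are a basis of the functionals on the cohomology of \<open>C\<^sub>N\<close>: subtracting from a
  cocycle \<open>l\<close> the combination of dual cocycles with the corner values of \<open>l\<close> leaves a coboundary.
\<close>
lemma functional_is_corner_functional:
  assumes \<phi>: "functional gs r N \<phi>"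
  shows "\<exists>c. \<forall>l. cech_closed gs N r l \<longrightarrow> \<phi> l = corner_functional N c l"
proof -
  let ?B = "corner_basis N r"
  obtain e where e: "\<And>b. b \<in> ?B \<Longrightarrow> cech_closed gs N r (e b)"
    "\<And>b b'. b \<in> ?B \<Longrightarrow> b' \<in> ?B \<Longrightarrow> corner_value N r b' (e b) = (if b' = b then 1 else 0)"
    using dual_cochains[of N] by blast
  have "\<phi> l = corner_functional N (\<lambda>b. \<phi> (e b)) l" if l: "cech_closed gs N r l" for l
  proof -
    let ?s = "\<lambda>S. \<Sum>b\<in>?B. corner_value N r b l * e b S"
    have summand: "cech_closed gs N r (\<lambda>S. corner_value N r b l * e b S)" if "b \<in> ?B" for b
      using e(1)[OF that] by (rule closed_cochain_scale)
    have s: "cech_closed gs N r ?s" using summand by (intro closed_cochain_sum) auto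
    have ms: "cech_closed gs N r (\<lambda>S. - 1 * ?s S)" using s by (rule closed_cochain_scale)
    have dist: "\<psi> ?s = (\<Sum>b\<in>?B. corner_value N r b l * \<psi> (e b))" if \<psi>: "functional gs r N \<psi>" for \<psi>
      by (subst functional_sum[OF \<psi>]) (use summand e(1) functionalD(2)[OF \<psi>] in auto)
    have sub: "\<psi> (\<lambda>S. l S + - 1 * ?s S) = \<psi> l - (\<Sum>b\<in>?B. corner_value N r b l * \<psi> (e b))" if \<psi>: "functional gs r N \<psi>" for \<psi>
      using functionalD(1)[OF \<psi> l ms] functionalD(2)[OF \<psi> s, of "- 1"] dist[OF \<psi>] by simp
    have cl: "cech_closed gs N r (\<lambda>S. l S + - 1 * ?s S)" using l ms by (rule closed_cochain_add)
    have "corner_value N r b' (\<lambda>S. l S + - 1 * ?s S) = 0" if b': "b' \<in> ?B" for b'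
    proof -
      have "(\<Sum>b\<in>?B. corner_value N r b l * corner_value N r b' (e b)) = (\<Sum>b\<in>?B. corner_value N r b l * (if b = b' then 1 else 0))"
        by (rule sum.cong) (use e(2) b' in auto)
      also have "\<dots> = corner_value N r b' l" using sum_times_delta[OF finite_corner_basis b'] .
      finally show ?thesis using sub[OF functional_corner_value[OF b']] by simp
    qed
    then have "cech_exact gs N r (\<lambda>S. l S + - 1 * ?s S)"
      using corner_value_exact_iff[OF cl] by blast
    then have "\<phi> (\<lambda>S. l S + - 1 * ?s S) = 0" by (rule functionalD(3)[OF \<phi> cl])
    then have "\<phi> l = (\<Sum>b\<in>?B. corner_value N r b l * \<phi> (e b))" using sub[OF \<phi>] by simp
    then show ?thesis by (simp add: corner_functional_def mult.commute)
  qed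
  then show ?thesis by blast
qed

definition vertex_coords :: "'n deg \<Rightarrow> ('b \<Rightarrow> 'k) \<Rightarrow> (nat set \<Rightarrow> ('n, 'k) laurent) set \<Rightarrow> ('n, 'k) laurent set" where
  "vertex_coords \<alpha> c = hom_of gs r \<alpha> (corner_functional (face \<alpha>) c)"

text \<open>
  A homomorphism to \<open>E\<^sub>\<alpha>\<close> is a functional, and a functional is a combination of corner values; so the
  basis elements of degree \<open>\<alpha>\<close> in the strand are coordinates on \<open>[M]\<^sub>\<alpha>\<close>.
\<close>
lemma coordinates_hypercube:
  assumes \<alpha>: "\<alpha> \<in> cube"
  shows "coordinates (hypercube M \<alpha>) (corner_basis (face \<alpha>) r) (vertex_coords \<alpha>)"
  unfolding coordinates_def
proof (intro conjI allI)
  let ?B = "corner_basis (face \<alpha>) r"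
  note F = functional_corner[of "face \<alpha>"]
  show "finite ?B" by simp
  show "carrier (hypercube M \<alpha>) = range (vertex_coords \<alpha>)"
  proof (intro equalityI subsetI)
    fix x assume "x \<in> carrier (hypercube M \<alpha>)"
    then have "x \<in> diff_homs M (inj_module \<alpha>)" by (simp add: hypercube_def hom_space_def)
    then obtain \<phi> where \<phi>: "functional gs r (face \<alpha>) \<phi>" "x = hom_of gs r \<alpha> \<phi>"
      using diff_homs_are_functionals[OF \<alpha>] by blast
    then obtain c where "\<And>l. cech_closed gs (face \<alpha>) r l \<Longrightarrow> \<phi> l = corner_functional (face \<alpha>) c l"
      using functional_is_corner_functional by blast
    then have "x = vertex_coords \<alpha> c" unfolding vertex_coords_def \<phi>(2) by (intro hom_of_cong[OF \<phi>(1) F]) auto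
    then show "x \<in> range (vertex_coords \<alpha>)" by blast
  next
    fix x assume "x \<in> range (vertex_coords \<alpha>)"
    then show "x \<in> carrier (hypercube M \<alpha>)" using hypercube_carrier[OF F] by (auto simp: vertex_coords_def)
  qed
  fix c d
  show "vertex_coords \<alpha> c = vertex_coords \<alpha> d \<longleftrightarrow> (\<forall>b\<in>?B. c b = d b)"
  proof
    assume eq: "vertex_coords \<alpha> c = vertex_coords \<alpha> d"
    obtain e where e: "\<And>b. b \<in> ?B \<Longrightarrow> cech_closed gs (face \<alpha>) r (e b)"
      "\<And>b b'. b \<in> ?B \<Longrightarrow> b' \<in> ?B \<Longrightarrow> corner_value (face \<alpha>) r b' (e b) = (if b' = b then 1 else 0)"
      using dual_cochains[of "face \<alpha>"] by blast
    show "\<forall>b\<in>?B. c b = d b"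
    proof
      fix b assume b: "b \<in> ?B"
      have "corner_functional (face \<alpha>) h (e b) = h b" for h
        using sum_times_delta[OF finite_corner_basis b, of h] e(2)[OF b] by (simp add: corner_functional_def cong: sum.cong)
      then show "c b = d b"
        using hom_of_inject[OF \<alpha> F F eq[unfolded vertex_coords_def] e(1)[OF b]] by simp
    qed
  next
    assume "\<forall>b\<in>?B. c b = d b"
    then have "corner_functional (face \<alpha>) c = corner_functional (face \<alpha>) d"
      by (simp add: corner_functional_def fun_eq_iff)
    then show "vertex_coords \<alpha> c = vertex_coords \<alpha> d" by (simp add: vertex_coords_def)
  qed
  have "(\<lambda>l. corner_functional (face \<alpha>) c l + corner_functional (face \<alpha>) d l) = corner_functional (face \<alpha>) (\<lambda>b. c b + d b)"
    by (simp add: corner_functional_def fun_eq_iff distrib_right sum.distrib)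
  then show "vertex_coords \<alpha> c \<oplus>\<^bsub>hypercube M \<alpha>\<^esub> vertex_coords \<alpha> d = vertex_coords \<alpha> (\<lambda>b. c b + d b)"
    using hypercube_add[OF F F] by (simp add: vertex_coords_def)
  show "t \<odot>\<^bsub>hypercube M \<alpha>\<^esub> vertex_coords \<alpha> c = vertex_coords \<alpha> (\<lambda>b. t * c b)" for t
  proof -
    have "(\<lambda>l. t * corner_functional (face \<alpha>) c l) = corner_functional (face \<alpha>) (\<lambda>b. t * c b)"
      by (simp add: corner_functional_def fun_eq_iff sum_distrib_left mult.assoc)
    then show ?thesis using hypercube_smult[OF F] by (simp add: vertex_coords_def)
  qed
  have "corner_functional (face \<alpha>) (\<lambda>_. 0) = (\<lambda>_. 0)"
    by (simp add: corner_functional_def fun_eq_iff)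
  then show "\<zero>\<^bsub>hypercube M \<alpha>\<^esub> = vertex_coords \<alpha> (\<lambda>_. 0)"
    by (simp add: hypercube_zero vertex_coords_def)
qed

text \<open>
  The map keeps the functional and enlarges \<open>N\<close>; rewriting the corner values over the smaller set by lemma
  \<open>corner_value_insert\<close> and exchanging sums gives the transposed matrix and the Koszul sign.
\<close>
lemma hypercube_map_coords:
  assumes \<beta>: "\<beta> \<in> cube" and i: "i \<in> face \<beta>"
  shows "hypercube_map M (\<beta> - unit_vec i) i (vertex_coords (\<beta> - unit_vec i) c) =
    vertex_coords \<beta> (\<lambda>b'. koszul_sign i (face \<beta>) *
      (\<Sum>b\<in>corner_basis (face \<beta> - {i}) r. A (card (face \<beta> - {i}) - r) b b' * c b))"
proof -
  let ?N = "face \<beta>" and ?N' = "face \<beta> - {i}"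
  have \<beta>i: "\<beta> i = 1" using \<beta> i by (auto simp: cube_def face_def)
  have face: "face (\<beta> - unit_vec i) = ?N'"
    using \<beta>i by (auto simp: face_def unit_vec_def fun_diff_def)
  have zero: "(\<beta> - unit_vec i) i = 0" using \<beta>i by (simp add: unit_vec_def fun_diff_def)
  have ins: "insert i ?N' = ?N" using i by auto
  note F = functional_corner[of ?N' c]
  have "hypercube_map M (\<beta> - unit_vec i) i (vertex_coords (\<beta> - unit_vec i) c) = hom_of gs r \<beta> (corner_functional ?N' c)"
    using hypercube_map_hom_of[of gs r "\<beta> - unit_vec i" "corner_functional ?N' c" i] F zero
    by (simp add: vertex_coords_def face)
  also have "\<dots> = vertex_coords \<beta> (\<lambda>b'. koszul_sign i ?N * (\<Sum>b\<in>corner_basis ?N' r. A (card ?N' - r) b b' * c b))"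
    unfolding vertex_coords_def
  proof (rule hom_of_cong)
    show "functional gs r ?N (corner_functional ?N' c)" by (rule functional_antimono[OF F]) auto
    fix l :: "nat set \<Rightarrow> 'k" assume l: "cech_closed gs ?N r l"
    have "corner_functional ?N' c l = (\<Sum>b\<in>corner_basis ?N' r. c b * (koszul_sign i ?N *
        (\<Sum>b'\<in>corner_basis ?N r. A (card ?N' - r) b b' * corner_value ?N r b' l)))"
      unfolding corner_functional_def
    proof (rule sum.cong[OF refl])
      fix b assume b: "b \<in> corner_basis ?N' r"
      have "corner_value ?N' r b l = koszul_sign i ?N *
        (\<Sum>b'\<in>corner_basis ?N r. A (card ?N' - r) b b' * corner_value ?N r b' l)"
        using corner_value_insert[of i ?N' r l b] l b unfolding ins by simp
      then show "c b * corner_value ?N' r b l = c b * (koszul_sign i ?N *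
        (\<Sum>b'\<in>corner_basis ?N r. A (card ?N' - r) b b' * corner_value ?N r b' l))" by simp
    qed
    also have "\<dots> = (\<Sum>b\<in>corner_basis ?N' r. \<Sum>b'\<in>corner_basis ?N r.
        koszul_sign i ?N * (A (card ?N' - r) b b' * c b) * corner_value ?N r b' l)"
      by (simp add: sum_distrib_left mult.assoc mult.left_commute)
    also have "\<dots> = (\<Sum>b'\<in>corner_basis ?N r. \<Sum>b\<in>corner_basis ?N' r.
        koszul_sign i ?N * (A (card ?N' - r) b b' * c b) * corner_value ?N r b' l)"
      by (rule sum.swap)
    also have "\<dots> = corner_functional ?N (\<lambda>b'. koszul_sign i ?N * (\<Sum>b\<in>corner_basis ?N' r. A (card ?N' - r) b b' * c b)) l"
      by (simp add: corner_functional_def sum_distrib_right sum_distrib_left)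
    finally show "corner_functional ?N' c l
      = corner_functional ?N (\<lambda>b'. koszul_sign i ?N * (\<Sum>b\<in>corner_basis ?N' r. A (card ?N' - r) b b' * c b)) l" .
  qed (rule functional_corner)
  finally show ?thesis .
qed

definition level_basis :: "nat \<Rightarrow> 'b set" where
  "level_basis p = (\<Union>\<alpha>\<in>cube_level p. corner_basis (face \<alpha>) r)"

definition level_coords :: "nat \<Rightarrow> ('b \<Rightarrow> 'k) \<Rightarrow> 'n deg \<Rightarrow> (nat set \<Rightarrow> ('n, 'k) laurent) set \<Rightarrow> ('n, 'k) laurent set" where
  "level_coords p c = (\<lambda>\<alpha>\<in>cube_level p. vertex_coords \<alpha> c)"

lemma weight_face: "\<alpha> \<in> cube \<Longrightarrow> weight \<alpha> = int (card (face \<alpha>))"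
proof -
  assume "\<alpha> \<in> cube"
  then have "weight \<alpha> = (\<Sum>i\<in>UNIV. if i \<in> face \<alpha> then 1 else 0)"
    unfolding weight_def by (intro sum.cong) (auto simp: cube_def face_def)
  then show ?thesis by (simp add: sum.If_cases)
qed

lemma cube_level_iff:
  assumes "p \<le> CARD('n)"
  shows "\<alpha> \<in> cube_level p \<longleftrightarrow> \<alpha> \<in> cube \<and> card (face (\<alpha> :: 'n deg)) = CARD('n) - p"
  using assms by (auto simp: cube_level_def weight_face)

lemma finite_cube_level: "finite (cube_level p :: 'n deg set)"
proof (rule finite_subset)
  show "cube_level p \<subseteq> (indicator_deg ` (UNIV :: 'n set set))"
  proof
    fix \<alpha> :: "'n deg" assume "\<alpha> \<in> cube_level p"
    then have "\<alpha> = indicator_deg (face \<alpha>)" by (simp add: cube_level_def indicator_face)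
    then show "\<alpha> \<in> indicator_deg ` UNIV" by (rule image_eqI) simp
  qed
qed simp

lemma corner_basis_disjoint:
  assumes "\<alpha> \<in> cube_level p" "\<beta> \<in> cube_level p" "p \<le> CARD('n)"
    "b \<in> corner_basis (face \<alpha>) r" "b \<in> corner_basis (face \<beta>) r"
  shows "\<alpha> = \<beta>"
proof -
  have cube: "\<alpha> \<in> cube" "\<beta> \<in> cube" using assms(1,2) by (simp_all add: cube_level_def)
  have "card (face \<alpha>) = CARD('n) - p" "card (face \<beta>) = CARD('n) - p"
    using assms(1,2) by (simp_all add: cube_level_iff[OF assms(3)])
  then have "face (\<delta> (CARD('n) - p - r) b) = face \<alpha>" "face (\<delta> (CARD('n) - p - r) b) = face \<beta>"
    using assms(4,5) by (simp_all add: corner_basis_def split: if_splits)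
  then have "face \<alpha> = face \<beta>" by (rule trans[OF sym])
  then show ?thesis by (rule face_inj[OF cube])
qed

lemma coordinates_level: "p \<le> CARD('n) \<Longrightarrow> coordinates (cube_complex M p) (level_basis p) (level_coords p)"
  unfolding cube_complex_def level_basis_def level_coords_def
proof (rule coordinates_direct_sum)
  fix \<alpha> :: "'n deg" assume "\<alpha> \<in> cube_level p"
  then show "coordinates (hypercube M \<alpha>) (corner_basis (face \<alpha>) r) (vertex_coords \<alpha>)"
    by (intro coordinates_hypercube) (simp add: cube_level_def)
next
  fix \<alpha> \<beta> :: "'n deg" and b
  assume "p \<le> CARD('n)" "\<alpha> \<in> cube_level p" "\<beta> \<in> cube_level p" "b \<in> corner_basis (face \<alpha>) r" "b \<in> corner_basis (face \<beta>) r"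
  then show "\<alpha> = \<beta>" by (intro corner_basis_disjoint)
qed (rule finite_cube_level)

lemma level_basis_eq:
  assumes p: "p \<le> CARD('n)"
  shows "level_basis p = (if r + p \<le> CARD('n)
    then {b \<in> B (CARD('n) - r - p). weight (\<delta> (CARD('n) - r - p) b) = int (CARD('n) - r - p) + int r} else {})"
proof (cases "r + p \<le> CARD('n)")
  case False
  then show ?thesis using p by (auto simp: level_basis_def corner_basis_def cube_level_iff)
next
  case True
  let ?j = "CARD('n) - r - p"
  have j: "CARD('n) - p - r = ?j" "int ?j + int r = int (CARD('n) - p)" "r \<le> CARD('n) - p" using True by auto
  have "b \<in> level_basis p \<longleftrightarrow> b \<in> B ?j \<and> weight (\<delta> ?j b) = int ?j + int r" for b
  proof
    assume "b \<in> level_basis p"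
    then obtain \<alpha> where \<alpha>: "\<alpha> \<in> cube_level p" "b \<in> corner_basis (face \<alpha>) r" by (auto simp: level_basis_def)
    then have c: "card (face \<alpha>) = CARD('n) - p" using p by (simp add: cube_level_iff)
    then have b: "b \<in> B ?j" "face (\<delta> ?j b) = face \<alpha>" using \<alpha>(2) j by (auto simp: corner_basis_def split: if_splits)
    then show "b \<in> B ?j \<and> weight (\<delta> ?j b) = int ?j + int r"
      using weight_face[OF degree_in_cube[OF b(1)]] c j by simp
  next
    assume b: "b \<in> B ?j \<and> weight (\<delta> ?j b) = int ?j + int r"
    then have c: "card (face (\<delta> ?j b)) = CARD('n) - p" and cube: "\<delta> ?j b \<in> cube"
      using weight_face[OF degree_in_cube[of b ?j]] degree_in_cube[of b ?j] j by auto
    have "\<delta> ?j b \<in> cube_level p" using c cube p by (simp add: cube_level_iff)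
    moreover have "b \<in> corner_basis (face (\<delta> ?j b)) r" using b c j by (simp add: corner_basis_def)
    ultimately show "b \<in> level_basis p" by (auto simp: level_basis_def)
  qed
  then show ?thesis using True by auto
qed

text \<open>
  The signs of the complex cancel the Koszul signs.  For a basis element \<open>b'\<close> of degree \<open>\<beta>\<close>, the
  summands over \<open>i\<close> collect all basis elements of degree \<open>\<beta> - \<epsilon>\<^sub>i\<close>, and the others on the same level
  have matrix entry \<open>0\<close> because their degree is not below \<open>\<beta>\<close>.
\<close>
lemma cube_diff_coords:
  assumes p: "p < CARD('n)"
  shows "cube_diff M p (level_coords (Suc p) c) =
    level_coords p (\<lambda>b'. \<Sum>b\<in>level_basis (Suc p). A (CARD('n) - r - Suc p) b b' * c b)"
  unfolding cube_diff_def level_coords_def[of p]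
proof (rule restrict_ext)
  fix \<beta> :: "'n deg" assume \<beta>: "\<beta> \<in> cube_level p"
  then have cube: "\<beta> \<in> cube" and card: "card (face \<beta>) = CARD('n) - p" using p by (auto simp: cube_level_iff)
  let ?N = "face \<beta>" and ?j = "CARD('n) - r - Suc p"
  have N: "{i. \<beta> i \<noteq> 0} = ?N" by (simp add: face_def)
  have cN: "card (?N - {i}) = CARD('n) - Suc p" if "i \<in> ?N" for i
    using that card by (simp add: card_Diff_singleton)
  have level: "\<beta> - unit_vec i \<in> cube_level (Suc p)" "face (\<beta> - unit_vec i) = ?N - {i}" if i: "i \<in> ?N" for i
  proof -
    have \<beta>i: "\<beta> i = 1" using cube i by (auto simp: cube_def face_def)
    then show f: "face (\<beta> - unit_vec i) = ?N - {i}"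
      by (auto simp: face_def unit_vec_def fun_diff_def)
    have "\<beta> - unit_vec i \<in> cube" using cube \<beta>i by (auto simp: cube_def unit_vec_def fun_diff_def)
    then show "\<beta> - unit_vec i \<in> cube_level (Suc p)" using f cN[OF i] p by (simp add: cube_level_iff)
  qed
  note C = coordinates_hypercube[OF cube]
  let ?h = "\<lambda>i b'. \<Sum>b\<in>corner_basis (?N - {i}) r. A ?j b b' * c b"
  have j: "CARD('n) - Suc p - r = ?j" by simp
  have summand: "cube_sign i \<beta> \<odot>\<^bsub>hypercube M \<beta>\<^esub> hypercube_map M (\<beta> - unit_vec i) i (level_coords (Suc p) c (\<beta> - unit_vec i))
      = vertex_coords \<beta> (?h i)" if i: "i \<in> ?N" for i
  proof -
    have sign: "cube_sign i \<beta> = koszul_sign i ?N" by (simp add: cube_sign_def koszul_sign_def face_def)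
    have "hypercube_map M (\<beta> - unit_vec i) i (level_coords (Suc p) c (\<beta> - unit_vec i))
        = vertex_coords \<beta> (\<lambda>b'. koszul_sign i ?N * ?h i b')"
    proof -
      have "level_coords (Suc p) c (\<beta> - unit_vec i) = vertex_coords (\<beta> - unit_vec i) c"
        using level(1)[OF i] by (simp add: level_coords_def)
      then show ?thesis using hypercube_map_coords[OF cube i, of c] by (simp only: cN[OF i] j)
    qed
    then show ?thesis by (simp add: sign coordinates_simps(5)[OF C])
  qed
  have carr: "vertex_coords \<beta> h \<in> carrier (hypercube M \<beta>)" for h by (simp add: coordinates_simps(2)[OF C])
  interpret H: abelian_group "hypercube M \<beta>" by (rule abelian_group_coordinates[OF C])
  have "(\<Oplus>\<^bsub>hypercube M \<beta>\<^esub>i\<in>{i. \<beta> i \<noteq> 0}. cube_sign i \<beta> \<odot>\<^bsub>hypercube M \<beta>\<^esub>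
        hypercube_map M (\<beta> - unit_vec i) i (level_coords (Suc p) c (\<beta> - unit_vec i)))
      = (\<Oplus>\<^bsub>hypercube M \<beta>\<^esub>i\<in>?N. vertex_coords \<beta> (?h i))"
    unfolding N by (rule H.finsum_cong') (use summand carr in auto)
  also have "\<dots> = vertex_coords \<beta> (\<lambda>b'. \<Sum>i\<in>?N. ?h i b')"
    by (rule finsum_coordinates[OF C]) simp
  also have "\<dots> = vertex_coords \<beta> (\<lambda>b'. \<Sum>b\<in>level_basis (Suc p). A ?j b b' * c b)"
    unfolding coordinates_simps(3)[OF C]
  proof
    fix b' assume b': "b' \<in> corner_basis ?N r"
    have "(\<Sum>i\<in>?N. ?h i b') = (\<Sum>b\<in>(\<Union>i\<in>?N. corner_basis (?N - {i}) r). A ?j b b' * c b)"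
    proof (rule sum.UNION_disjoint[symmetric])
      show "\<forall>i\<in>?N. \<forall>k\<in>?N. i \<noteq> k \<longrightarrow> corner_basis (?N - {i}) r \<inter> corner_basis (?N - {k}) r = {}"
      proof (intro ballI impI, rule ccontr)
        fix i k assume ik: "i \<in> ?N" "k \<in> ?N" "i \<noteq> k" "corner_basis (?N - {i}) r \<inter> corner_basis (?N - {k}) r \<noteq> {}"
        then obtain b where "b \<in> corner_basis (?N - {i}) r" "b \<in> corner_basis (?N - {k}) r" by blast
        then have "\<beta> - unit_vec i = \<beta> - unit_vec k"
          using corner_basis_disjoint[OF level(1)[OF ik(1)] level(1)[OF ik(2)], of b] level(2) ik p by simp
        then have "?N - {i} = ?N - {k}" using level(2) ik by metis
        then show False using ik by auto
      qed
    qed simp_all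
    also have "\<dots> = (\<Sum>b\<in>level_basis (Suc p). A ?j b b' * c b)"
    proof (rule sum.mono_neutral_left)
      show "finite (level_basis (Suc p))" by (simp add: level_basis_def finite_cube_level)
      show "(\<Union>i\<in>?N. corner_basis (?N - {i}) r) \<subseteq> level_basis (Suc p)"
      proof
        fix b assume "b \<in> (\<Union>i\<in>?N. corner_basis (?N - {i}) r)"
        then obtain i where i: "i \<in> ?N" "b \<in> corner_basis (?N - {i}) r" by blast
        then have "b \<in> corner_basis (face (\<beta> - unit_vec i)) r" by (simp only: level(2))
        then show "b \<in> level_basis (Suc p)"
          unfolding level_basis_def by (rule UN_I[OF level(1)[OF i(1)]])
      qed
      show "\<forall>b\<in>level_basis (Suc p) - (\<Union>i\<in>?N. corner_basis (?N - {i}) r). A ?j b b' * c b = 0"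
      proof (rule ballI, rule ccontr)
        fix b assume b: "b \<in> level_basis (Suc p) - (\<Union>i\<in>?N. corner_basis (?N - {i}) r)" "A ?j b b' * c b \<noteq> 0"
        then obtain \<alpha> where \<alpha>: "\<alpha> \<in> cube_level (Suc p)" "b \<in> corner_basis (face \<alpha>) r" by (auto simp: level_basis_def)
        have ca: "card (face \<alpha>) = CARD('n) - Suc p" using \<alpha>(1) p by (simp add: cube_level_iff)
        then have bj: "b \<in> B ?j" "face (\<delta> ?j b) = face \<alpha>" "r \<le> CARD('n) - Suc p"
          using \<alpha>(2) j by (auto simp: corner_basis_def split: if_splits)
        have "card ?N - r = Suc ?j" using bj(3) p card by simp
        then have b'j: "b' \<in> B (Suc ?j)" "face (\<delta> (Suc ?j) b') = ?N" using b' by (auto simp: corner_basis_def split: if_splits)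
        have "face \<alpha> \<subset> ?N" using face_matrix[OF bj(1) b'j(1)] b(2) bj b'j by auto
        then obtain i where i: "i \<in> ?N" "face \<alpha> \<subseteq> ?N - {i}" by blast
        then have "face \<alpha> = ?N - {i}" using cN[OF i(1)] ca by (intro card_subset_eq) auto
        then show False using b(1) \<alpha>(2) i(1) by auto
      qed
    qed
    finally show "(\<Sum>i\<in>?N. ?h i b') = (\<Sum>b\<in>level_basis (Suc p). A ?j b b' * c b)" .
  qed
  finally show "(\<Oplus>\<^bsub>hypercube M \<beta>\<^esub>i\<in>{i. \<beta> i \<noteq> 0}. cube_sign i \<beta> \<odot>\<^bsub>hypercube M \<beta>\<^esub>
        hypercube_map M (\<beta> - unit_vec i) i (level_coords (Suc p) c (\<beta> - unit_vec i)))
      = vertex_coords \<beta> (\<lambda>b'. \<Sum>b\<in>level_basis (Suc p). A ?j b b' * c b)" .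
qed

end

theorem proposition4p1:
  fixes I :: "('n::{finite,linorder}, 'k::field) mpoly set"
    and gs :: "('n \<Rightarrow> nat) list"
    and r :: nat
    and L :: "('b, 'n, 'k) free_complex"
    and \<epsilon> :: "('b \<Rightarrow> ('n, 'k) mpoly) \<Rightarrow> ('n, 'k) mpoly"
    and M :: "(('n, 'k) mpoly, (nat set \<Rightarrow> ('n, 'k) laurent) set, 'n) graded_dmodule"
  assumes "squarefree_monomial_ideal I"
    and "I = Idl\<^bsub>mpoly_ring\<^esub> (xpow ` set gs)"
    and "M = local_cohomology gs r"
    and "minimal_free_resolution L \<epsilon> (alexander_dual I)"
  shows "\<exists>v :: nat \<Rightarrow> 'b \<Rightarrow> 'n deg \<Rightarrow> (nat set \<Rightarrow> ('n, 'k) laurent) set \<Rightarrow> ('n, 'k) laurent set.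
    (\<forall>p\<le>CARD('n).
       is_basis base_field (cube_complex M p) (strand_basis r L p) (v p) \<and>
       (\<forall>b\<in>strand_basis r L p.
          fc_deg L (CARD('n) - r - p) b \<in> cube_level p \<and>
          (\<forall>\<alpha>\<in>cube_level p. \<alpha> \<noteq> fc_deg L (CARD('n) - r - p) b \<longrightarrow>
             v p b \<alpha> = \<zero>\<^bsub>hypercube M \<alpha>\<^esub>))) \<and>
    (\<forall>p<CARD('n).
       is_matrix_of base_field
         (cube_complex M (Suc p)) (strand_basis r L (Suc p)) (v (Suc p))
         (cube_complex M p) (strand_basis r L p) (v p)
         (transpose_matrix (monomial_matrix (linear_strand r L) (CARD('n) - r - Suc p)))
         (cube_diff M p))"
proof -
  let ?aug = "augmentation L \<epsilon>"
  let ?n = "CARD('n)"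
  have "vertex_cover I N \<longleftrightarrow> (\<forall>t<length gs. N \<inter> cover gs t \<noteq> {})" for N
    by (auto simp: assms(2) vertex_cover_genideal cover_def all_set_conv_all_nth)
  moreover have "scalar_resolution (fc_basis L) (fc_deg L) (monomial_matrix L) ?aug (vertex_cover I)"
    by (rule scalar_resolution_of_minimal[OF assms(4) alexander_dual_eq[OF assms(1)]])
  ultimately interpret hypercube_strand "fc_basis L" "fc_deg L" "monomial_matrix L" ?aug "vertex_cover I" gs r
    by (intro hypercube_strand.intro gluing.intro gluing_axioms.intro)
  note M = assms(3)
  have basis: "strand_basis r L p = level_basis p" if "p \<le> ?n" for p
    by (simp add: strand_basis_def linear_strand_def Let_def level_basis_eq[OF that])
  let ?v = "\<lambda>p. coordinate_basis (level_coords p)"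
  have "is_basis base_field (cube_complex M p) (strand_basis r L p) (?v p)" if "p \<le> ?n" for p
    unfolding M basis[OF that] by (rule is_basis_coordinates[OF coordinates_level[OF that]])
  moreover have "fc_deg L (?n - r - p) b \<in> cube_level p \<and>
      (\<forall>\<alpha>\<in>cube_level p. \<alpha> \<noteq> fc_deg L (?n - r - p) b \<longrightarrow> ?v p b \<alpha> = \<zero>\<^bsub>hypercube M \<alpha>\<^esub>)"
    if p: "p \<le> ?n" and b: "b \<in> strand_basis r L p" for p b
  proof -
    have C: "coordinates (cube_complex (local_cohomology gs r) p) (level_basis p) (level_coords p)"
      by (rule coordinates_level[OF p])
    have rp: "r + p \<le> ?n" using b by (auto simp: strand_basis_def split: if_splits)
    obtain \<alpha> where \<alpha>: "\<alpha> \<in> cube_level p" "b \<in> corner_basis (face \<alpha>) r"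
      using b basis[OF p] by (auto simp: level_basis_def)
    have ca: "\<alpha> \<in> cube" "card (face \<alpha>) = ?n - p" using \<alpha>(1) p by (auto simp: cube_level_iff)
    have "?n - p - r = ?n - r - p" by simp
    then have bj: "b \<in> fc_basis L (?n - r - p)" "face (fc_deg L (?n - r - p) b) = face \<alpha>"
      using \<alpha>(2) ca by (auto simp: corner_basis_def split: if_splits)
    have deg: "fc_deg L (?n - r - p) b = \<alpha>" using face_inj[OF degree_in_cube[OF bj(1)] ca(1) bj(2)] .
    have "?v p b \<beta> = \<zero>\<^bsub>hypercube M \<beta>\<^esub>" if \<beta>: "\<beta> \<in> cube_level p" "\<beta> \<noteq> \<alpha>" for \<beta>
    proof -
      have D: "coordinates (hypercube (local_cohomology gs r) \<beta>) (corner_basis (face \<beta>) r) (vertex_coords \<beta>)"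
        by (rule coordinates_hypercube) (use \<beta>(1) in \<open>simp add: cube_level_def\<close>)
      have "b \<notin> corner_basis (face \<beta>) r" using corner_basis_disjoint[OF \<beta>(1) \<alpha>(1) p _ \<alpha>(2)] \<beta>(2) by blast
      then have "vertex_coords \<beta> (\<lambda>c. if c = b then 1 else 0) = vertex_coords \<beta> (\<lambda>_. 0)"
        unfolding coordinates_simps(3)[OF D] by auto
      then show ?thesis
        using \<beta>(1) by (simp add: coordinate_basis_def[OF C] level_coords_def coordinates_simps(6)[OF D] M)
    qed
    then show ?thesis using deg \<alpha>(1) by blast
  qed
  moreover have "is_matrix_of base_field (cube_complex M (Suc p)) (strand_basis r L (Suc p)) (?v (Suc p))
         (cube_complex M p) (strand_basis r L p) (?v p)
         (transpose_matrix (monomial_matrix (linear_strand r L) (?n - r - Suc p))) (cube_diff M p)" if p: "p < ?n" for p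
  proof -
    have p1: "Suc p \<le> ?n" "p \<le> ?n" using p by auto
    let ?j = "?n - r - Suc p"
    have entry: "transpose_matrix (monomial_matrix (linear_strand r L) ?j) b' b = monomial_matrix L ?j b b'"
      if "b \<in> level_basis (Suc p)" for b b'
      using that unfolding basis[OF p1(1), symmetric]
      by (simp add: strand_basis_def transpose_matrix_def monomial_matrix_def linear_strand_def Let_def split: if_splits)
    show ?thesis
      unfolding M basis[OF p1(1)] basis[OF p1(2)]
    proof (rule is_matrix_of_coordinates[OF coordinates_level[OF p1(1)] coordinates_level[OF p1(2)]])
      fix c
      show "cube_diff (local_cohomology gs r) p (level_coords (Suc p) c) =
        level_coords p (\<lambda>b'. \<Sum>b\<in>level_basis (Suc p). transpose_matrix (monomial_matrix (linear_strand r L) ?j) b' b * c b)"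
        unfolding cube_diff_coords[OF p]
        by (intro arg_cong[where f = "level_coords p"] ext sum.cong refl) (simp only: entry)
    qed
  qed
  ultimately show ?thesis by (intro exI[of _ ?v]) blast
qed

end
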